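(* Let $\beta>0$. For $1\le i\le 3$ let $r_i=\frac13$, and for $i\ge 4$ set $$r_i=\frac13\left(\frac1i+\frac{1}{i(\log\log i)^\beta}\right),$$ and assume that $r_i<\frac23$ for all $i$. Let $p_i=\frac13+r_i$ for $i\ge1$, and let $X=(X_k)_{k\ge 0}$ be the Markov chain on $\mathbb Z^+=\{0,1,2,\dots\}$ with $X_0=0$ and transition probabilities $P(X_{k+1}=n+2\mid X_k=n)=p_n$ and $P(X_{k+1}=n-1\mid X_k=n)=1-p_n$ for $n\ge 1$, and $P(X_{k+1}=2\mid X_k=0)=1$. If $\beta>1$, then almost surely $X$ has at most finitely many skipped points. If $\beta\le 1$, then with a positive probability $p$, $p\ge\frac{11}{27}$, $X$ has infinitely many skipped points.
   Context: A site $k$ is a skipped point of $X$ if $\#\{n\ge0:X_n=k\}=0$, i.e. $k$ is never visited by $X$. *)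

theory Defs
  imports "HOL-Probability.Probability"
begin

(* The conditional probability given the whole past is required only when the past has
   positive probability. *)
definition markov_chain ::
  "'a measure \<Rightarrow> ('s \<Rightarrow> 's \<Rightarrow> real) \<Rightarrow> (nat \<Rightarrow> 'a \<Rightarrow> 's) \<Rightarrow> bool" where
  "markov_chain M K X \<longleftrightarrow>
     prob_space M \<and>
     (\<forall>n. X n \<in> measurable M (count_space UNIV)) \<and>
     (\<forall>n x y. \<P>(\<omega> in M. \<forall>k\<le>n. X k \<omega> = x k) > 0 \<longrightarrow>
        \<P>(\<omega> in M. X (Suc n) \<omega> = y \<bar> \<forall>k\<le>n. X k \<omega> = x k) = K (x n) y)"

definition r_seq :: "real \<Rightarrow> nat \<Rightarrow> real" where
  "r_seq \<beta> i =
     (if i \<le> 3 then 1/3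
      else 1/3 * (1 / real i + 1 / (real i * (ln (ln (real i))) powr \<beta>)))"

definition step_prob :: "(nat \<Rightarrow> real) \<Rightarrow> nat \<Rightarrow> nat \<Rightarrow> real" where
  "step_prob p n m =
     (if n = 0 then (if m = 2 then 1 else 0)
      else if m = n + 2 then p n
      else if m = n - 1 then 1 - p n
      else 0)"

(* Not stated as "card {n. x n = k} = 0": card is 0 on infinite sets as well. *)
definition skipped_point :: "(nat \<Rightarrow> nat) \<Rightarrow> nat \<Rightarrow> bool" where
  "skipped_point x k \<longleftrightarrow> {n. x n = k} = {}"

end

theory Submission
  imports Defs "HOL-Real_Asymp.Real_Asymp"
begin

text \<open>
  The walk is skip-free downwards, so \<open>k\<close> is skipped exactly if it jumps from \<open>k - 1\<close> to \<open>k + 1\<close>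
  at its first passage above \<open>k\<close> and never returns to \<open>k\<close>. Write \<open>\<epsilon>(k) = (ln ln k) powr -\<beta>\<close>.
  The function \<open>x powr -\<delta>\<close> is superharmonic where \<open>2\<delta> \<le> \<epsilon>\<close> and subharmonic where \<open>\<delta> \<ge> 2\<epsilon>\<close>, and
  \<open>1 / ln x\<close> is superharmonic. Hence the escape probability from \<open>k\<close> is of order \<open>\<epsilon>(k) / k\<close>, and
  the probability of reaching \<open>j\<close> from \<open>k + 1\<close> before \<open>k\<close> is at most of order
  \<open>\<epsilon>(k) / k + 1 / (k ln (j / k))\<close> and at least of order \<open>1 / (j - k)\<close>.

  For \<open>\<beta> > 1\<close>: given that \<open>k\<close> is the first skipped point of the window \<open>(2^m, 2^(m+1)]\<close>, the
  expected number of skipped points in \<open>(2^m, 2^(m+2)]\<close> is at least of order \<open>m\<close>, whereas the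
  unconditional expectation is at most of order \<open>\<epsilon>(2^m)\<close>. So the window contains a skipped point
  with probability of order at most \<open>1 / (m (ln m) powr \<beta>)\<close>, and Borel--Cantelli applies.

  For \<open>\<beta> \<le> 1\<close>: give a skipped point \<open>j\<close> the weight \<open>1 / ln j\<close>. The expected total weight diverges
  and its second moment is comparable to its square, so, conditionally on any past event, a further
  point is skipped with probability bounded below. Therefore infinitely many points are skipped
  with probability 1, which is more than \<open>11/27\<close>.
\<close>

section \<open>Stopped walks and harmonic functions\<close>

text \<open>A step from x has mean 3 q(x) - 1 = (1 + eps)/x and second moment tending to 2, so the
  generator is close to f'' + (1 + eps)/x f', that of a time-changed Bessel process of dimension 2 +
  eps. On x^(-\<delta>) it gives about \<delta> (\<delta> - eps) x^(-\<delta>-2), so eps is the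
  critical exponent; the factors 2 in the thresholds absorb the Taylor error. Since eps decreases,
  no single power is superharmonic all the way out; 1 / ln x takes over beyond k^2, and between k
  and k^2 eps changes only by a bounded factor. For exponents above 1 the first moments over dyadic
  windows are not enough: they decay only like a power of ln m. Skipped points cluster, and the
  harmonic sum of 1 / (j - k) over a cluster supplies the missing factor m. For exponents up to 1
  the same clustering makes the unweighted second moment outgrow the square of the mean; with weight
  1 / ln j it does not, because the sum of 1 / (j ln j ln (j / k)) over j > k is bounded uniformly
  in k. No stopping time is formalised: each estimate is proved at a fixed time and then summed over
  the time of first passage.\<close>

text \<open>Events are predicates \<open>\<Phi>\<close> on trajectories; \<open>adapted m \<Phi>\<close> says that \<open>\<Phi>\<close> only looks at
  times up to \<open>m\<close>.\<close>

definition adapted :: "nat \<Rightarrow> ((nat \<Rightarrow> nat) \<Rightarrow> bool) \<Rightarrow> bool" where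
  "adapted m \<Phi> \<longleftrightarrow> (\<forall>x y. (\<forall>i\<le>m. x i = y i) \<longrightarrow> \<Phi> x \<longrightarrow> \<Phi> y)"

lemma adaptedD: "adapted m \<Phi> \<Longrightarrow> (\<And>i. i \<le> m \<Longrightarrow> x i = y i) \<Longrightarrow> \<Phi> x \<Longrightarrow> \<Phi> y"
  unfolding adapted_def by blast

lemma adaptedI: "(\<And>x y. (\<And>i. i \<le> m \<Longrightarrow> x i = y i) \<Longrightarrow> \<Phi> x \<Longrightarrow> \<Phi> y) \<Longrightarrow> adapted m \<Phi>"
  unfolding adapted_def by blast

lemma adapted_mono: "adapted m \<Phi> \<Longrightarrow> m \<le> n \<Longrightarrow> adapted n \<Phi>"
  unfolding adapted_def by (meson le_trans)

lemma adapted_conj: "adapted m \<Phi> \<Longrightarrow> adapted m \<Psi> \<Longrightarrow> adapted m (\<lambda>x. \<Phi> x \<and> \<Psi> x)"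
  unfolding adapted_def by blast

lemma adapted_at: "i \<le> m \<Longrightarrow> adapted m (\<lambda>x. Q (x i))"
  unfolding adapted_def by auto

text \<open>Fixing the position at time \<open>m\<close> as well makes the one-step law a constant
  factor. All estimates are then relative to \<open>pr \<Phi>\<close>, so conditioning on null
  events never occurs.\<close>

definition located :: "nat \<Rightarrow> nat \<Rightarrow> ((nat \<Rightarrow> nat) \<Rightarrow> bool) \<Rightarrow> bool" where
  "located m a \<Phi> \<longleftrightarrow> adapted m \<Phi> \<and> (\<forall>x. \<Phi> x \<longrightarrow> x m = a)"

lemma located_adapted: "located m a \<Phi> \<Longrightarrow> adapted m \<Phi>"
  unfolding located_def by blast

lemma locatedD: "located m a \<Phi> \<Longrightarrow> \<Phi> x \<Longrightarrow> x m = a"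
  unfolding located_def by blast

lemma locatedI: "adapted m \<Phi> \<Longrightarrow> (\<And>x. \<Phi> x \<Longrightarrow> x m = a) \<Longrightarrow> located m a \<Phi>"
  unfolding located_def by blast

lemma located_Suc: "adapted m \<Phi> \<Longrightarrow> located (Suc m) b (\<lambda>x. \<Phi> x \<and> x (Suc m) = b)"
  by (intro locatedI adapted_conj adapted_at) (auto intro: adapted_mono)

text \<open>A visit to \<open>U\<close> at time \<open>m\<close> itself counts. Leaving
  \<open>D\<close> anywhere outside \<open>U\<close> kills the path, so \<open>D\<close> carries the
  boundary condition.\<close>

definition hit :: "nat \<Rightarrow> nat set \<Rightarrow> nat set \<Rightarrow> (nat \<Rightarrow> nat) \<Rightarrow> bool" where
  "hit m D U x \<longleftrightarrow> (\<exists>n\<ge>m. x n \<in> U \<and> (\<forall>i. m \<le> i \<and> i < n \<longrightarrow> x i \<in> D))"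

definition hit_within :: "nat \<Rightarrow> nat set \<Rightarrow> nat set \<Rightarrow> nat \<Rightarrow> (nat \<Rightarrow> nat) \<Rightarrow> bool" where
  "hit_within m D U N x \<longleftrightarrow> (\<exists>n. m \<le> n \<and> n \<le> m + N \<and> x n \<in> U \<and> (\<forall>i. m \<le> i \<and> i < n \<longrightarrow> x i \<in> D))"

definition stay_within :: "nat \<Rightarrow> nat set \<Rightarrow> nat \<Rightarrow> (nat \<Rightarrow> nat) \<Rightarrow> bool" where
  "stay_within m D N x \<longleftrightarrow> (\<forall>i. m \<le> i \<and> i \<le> m + N \<longrightarrow> x i \<in> D)"

lemma hit_within_0: "hit_within m D U 0 x \<longleftrightarrow> x m \<in> U"
  unfolding hit_within_def by (auto simp: le_antisym)

lemma hit_within_Suc: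
  "hit_within m D U (Suc N) x \<longleftrightarrow> x m \<in> U \<or> (x m \<in> D \<and> hit_within (Suc m) D U N x)"
proof
  assume "hit_within m D U (Suc N) x"
  then obtain n where n: "m \<le> n" "n \<le> m + Suc N" "x n \<in> U" "\<forall>i. m \<le> i \<and> i < n \<longrightarrow> x i \<in> D"
    unfolding hit_within_def by blast
  show "x m \<in> U \<or> (x m \<in> D \<and> hit_within (Suc m) D U N x)"
  proof (cases "n = m")
    case False
    with n have "x m \<in> D" "hit_within (Suc m) D U N x"
      unfolding hit_within_def by (auto intro!: exI[of _ n])
    then show ?thesis by blast
  qed (use n in auto)
next
  assume "x m \<in> U \<or> (x m \<in> D \<and> hit_within (Suc m) D U N x)"
  then show "hit_within m D U (Suc N) x"
  proof
    assume "x m \<in> D \<and> hit_within (Suc m) D U N x"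
    then obtain n where n: "x m \<in> D" "Suc m \<le> n" "n \<le> Suc m + N" "x n \<in> U"
        "\<forall>i. Suc m \<le> i \<and> i < n \<longrightarrow> x i \<in> D"
      unfolding hit_within_def by blast
    have "x i \<in> D" if "m \<le> i" "i < n" for i
      using n that by (cases "i = m") auto
    with n show ?thesis unfolding hit_within_def by (intro exI[of _ n]) auto
  qed (auto simp: hit_within_def)
qed

lemma stay_within_0: "stay_within m D 0 x \<longleftrightarrow> x m \<in> D"
  unfolding stay_within_def by auto

lemma stay_within_Suc:
  "stay_within m D (Suc N) x \<longleftrightarrow> x m \<in> D \<and> stay_within (Suc m) D N x"
  unfolding stay_within_def
  by (auto simp: Suc_le_eq) (metis le_neq_implies_less)

text \<open>With \<open>q 0 = 1\<close> the step from the origin, which is deterministic, needs no separate case.\<close>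

locale walk = prob_space M for M :: "'a measure" +
  fixes X :: "nat \<Rightarrow> 'a \<Rightarrow> nat" and q :: "nat \<Rightarrow> real"
  assumes X_meas [measurable]: "\<And>n. X n \<in> measurable M (count_space UNIV)"
    and markov: "\<And>n x y. \<P>(\<omega> in M. \<forall>k\<le>n. X k \<omega> = x k) > 0 \<Longrightarrow>
        \<P>(\<omega> in M. X (Suc n) \<omega> = y \<bar> \<forall>k\<le>n. X k \<omega> = x k) =
          (if y = x n + 2 then q (x n) else if y = x n - 1 then 1 - q (x n) else 0)"
    and X0: "AE \<omega> in M. X 0 \<omega> = 0"
    and q_ge: "\<And>i. q i \<ge> 1/3" and q_le: "\<And>i. q i \<le> 1"
begin

section \<open>Probabilities of trajectory events\<close>

definition pr :: "((nat \<Rightarrow> nat) \<Rightarrow> bool) \<Rightarrow> real" where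
  "pr \<Phi> = measure M {\<omega> \<in> space M. \<Phi> (\<lambda>n. X n \<omega>)}"

definition ev :: "((nat \<Rightarrow> nat) \<Rightarrow> bool) \<Rightarrow> bool" where
  "ev \<Phi> \<longleftrightarrow> {\<omega> \<in> space M. \<Phi> (\<lambda>n. X n \<omega>)} \<in> sets M"

lemma pr_nonneg [simp]: "0 \<le> pr \<Phi>"
  unfolding pr_def by simp

lemma pr_False [simp]: "pr (\<lambda>x. False) = 0"
  unfolding pr_def by simp

lemma pr_mono: "ev \<Psi> \<Longrightarrow> (\<And>x. \<Phi> x \<Longrightarrow> \<Psi> x) \<Longrightarrow> pr \<Phi> \<le> pr \<Psi>"
  unfolding pr_def ev_def by (rule finite_measure_mono) auto

lemma ev_at: "ev (\<lambda>x. Q (x i))"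
  unfolding ev_def by measurable

lemma ev_conj: "ev \<Phi> \<Longrightarrow> ev \<Psi> \<Longrightarrow> ev (\<lambda>x. \<Phi> x \<and> \<Psi> x)"
  unfolding ev_def by (rule sets.sets_Collect_conj)

lemma ev_disj: "ev \<Phi> \<Longrightarrow> ev \<Psi> \<Longrightarrow> ev (\<lambda>x. \<Phi> x \<or> \<Psi> x)"
  unfolding ev_def by (rule sets.sets_Collect_disj)

lemma ev_not: "ev \<Phi> \<Longrightarrow> ev (\<lambda>x. \<not> \<Phi> x)"
  unfolding ev_def by (rule sets.sets_Collect_neg)

lemma ev_imp: "ev \<Phi> \<Longrightarrow> ev \<Psi> \<Longrightarrow> ev (\<lambda>x. \<Phi> x \<longrightarrow> \<Psi> x)"
  unfolding ev_def by (rule sets.sets_Collect_imp)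

lemma ev_all: "(\<And>n::nat. ev (\<Phi> n)) \<Longrightarrow> ev (\<lambda>x. \<forall>n. \<Phi> n x)"
  unfolding ev_def by (rule sets.sets_Collect_countable_All)

lemma ev_ex: "(\<And>n::nat. ev (\<Phi> n)) \<Longrightarrow> ev (\<lambda>x. \<exists>n. \<Phi> n x)"
  unfolding ev_def by (rule sets.sets_Collect_countable_Ex)

lemma ev_const: "ev (\<lambda>x. P)"
  unfolding ev_def by simp

lemmas ev_intros = ev_all ev_ex ev_conj ev_disj ev_imp ev_not ev_const ev_at

lemma pr_sums:
  assumes "\<And>n. ev (\<Phi> n)" "\<And>x m n. \<Phi> m x \<Longrightarrow> \<Phi> n x \<Longrightarrow> m = n"
  shows "(\<lambda>n. pr (\<Phi> n)) sums pr (\<lambda>x. \<exists>n. \<Phi> n x)"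
proof -
  have "(\<lambda>i. measure M {\<omega> \<in> space M. \<Phi> i (\<lambda>n. X n \<omega>)}) sums
      measure M (\<Union>i. {\<omega> \<in> space M. \<Phi> i (\<lambda>n. X n \<omega>)})"
    using assms by (intro finite_measure_UNION) (auto simp: ev_def disjoint_family_on_def)
  also have "(\<Union>i. {\<omega> \<in> space M. \<Phi> i (\<lambda>n. X n \<omega>)}) = {\<omega> \<in> space M. \<exists>i. \<Phi> i (\<lambda>n. X n \<omega>)}"
    by auto
  finally show ?thesis unfolding pr_def .
qed

text \<open>Uniqueness of \<open>n\<close> turns it into a random time, and the inequalities at
  fixed times add up. With a constant on each side the lemma serves for upper bounds
  (\<open>a = 1\<close>) and for lower bounds (\<open>b = 1\<close>).\<close>

lemma pr_Ex_le:
  assumes "\<And>n::nat. ev (\<Phi> n)" "\<And>x m n. \<Phi> m x \<Longrightarrow> \<Phi> n x \<Longrightarrow> m = n"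
    and "\<And>n::nat. ev (\<Psi> n)" "\<And>x m n. \<Psi> m x \<Longrightarrow> \<Psi> n x \<Longrightarrow> m = n"
    and "\<And>n. a * pr (\<Phi> n) \<le> b * pr (\<Psi> n)"
  shows "a * pr (\<lambda>x. \<exists>n. \<Phi> n x) \<le> b * pr (\<lambda>x. \<exists>n. \<Psi> n x)"
proof -
  have "(\<lambda>n. a * pr (\<Phi> n)) sums (a * pr (\<lambda>x. \<exists>n. \<Phi> n x))"
    by (rule sums_mult[OF pr_sums[OF assms(1,2)]])
  moreover have "(\<lambda>n. b * pr (\<Psi> n)) sums (b * pr (\<lambda>x. \<exists>n. \<Psi> n x))"
    by (rule sums_mult[OF pr_sums[OF assms(3,4)]])
  ultimately show ?thesis using assms(5) by (rule sums_le[rotated])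
qed

lemma pr_disj:
  assumes "ev \<Phi>" "ev \<Psi>" "\<And>x. \<Phi> x \<Longrightarrow> \<Psi> x \<Longrightarrow> False"
  shows "pr (\<lambda>x. \<Phi> x \<or> \<Psi> x) = pr \<Phi> + pr \<Psi>"
proof -
  have "{\<omega> \<in> space M. \<Phi> (\<lambda>n. X n \<omega>) \<or> \<Psi> (\<lambda>n. X n \<omega>)} =
      {\<omega> \<in> space M. \<Phi> (\<lambda>n. X n \<omega>)} \<union> {\<omega> \<in> space M. \<Psi> (\<lambda>n. X n \<omega>)}" by auto
  then show ?thesis
    using assms unfolding pr_def ev_def by (auto intro!: finite_measure_Union)
qed

lemma pr_disj_le:
  assumes "ev \<Phi>" "ev \<Psi>"
  shows "pr (\<lambda>x. \<Phi> x \<or> \<Psi> x) \<le> pr \<Phi> + pr \<Psi>"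
proof -
  have "{\<omega> \<in> space M. \<Phi> (\<lambda>n. X n \<omega>) \<or> \<Psi> (\<lambda>n. X n \<omega>)} =
      {\<omega> \<in> space M. \<Phi> (\<lambda>n. X n \<omega>)} \<union> {\<omega> \<in> space M. \<Psi> (\<lambda>n. X n \<omega>)}" by auto
  then show ?thesis
    using assms unfolding pr_def ev_def by (auto intro!: measure_Un_le)
qed

section \<open>The Markov property for events of the past\<close>

definition prefix_code :: "nat \<Rightarrow> (nat \<Rightarrow> nat) \<Rightarrow> nat" where
  "prefix_code m x = to_nat (map x [0..<Suc m])"

lemma prefix_code_eq: "prefix_code m x = prefix_code m y \<longleftrightarrow> (\<forall>k\<le>m. x k = y k)"
proof -
  have "prefix_code m x = prefix_code m y \<longleftrightarrow> map x [0..<Suc m] = map y [0..<Suc m]"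
    unfolding prefix_code_def by (rule inj_eq[OF inj_to_nat])
  also have "\<dots> \<longleftrightarrow> (\<forall>k\<le>m. x k = y k)"
    unfolding map_eq_conv set_upt by (auto simp: less_Suc_eq_le)
  finally show ?thesis .
qed

lemma ev_cylinder: "ev (\<lambda>x. \<forall>k\<le>m. x k = y k)"
  by (intro ev_intros)

lemma prefix_cases:
  assumes "adapted m \<Phi>"
  obtains "\<And>x. \<Phi> x \<and> prefix_code m x = i \<longleftrightarrow> False"
  | y where "\<Phi> y" "\<And>x. \<Phi> x \<and> prefix_code m x = i \<longleftrightarrow> (\<forall>k\<le>m. x k = y k)"
proof (cases "\<exists>y. \<Phi> y \<and> prefix_code m y = i")
  case True
  then obtain y where y: "\<Phi> y" "prefix_code m y = i" by blast
  have "\<Phi> x" if "\<forall>k\<le>m. x k = y k" for x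
    using adaptedD[OF assms, of y x] y(1) that by simp
  then have "\<Phi> x \<and> prefix_code m x = i \<longleftrightarrow> (\<forall>k\<le>m. x k = y k)" for x
    unfolding y(2)[symmetric] prefix_code_eq by auto
  with y(1) show thesis by (rule that(2))
qed (use that(1) in blast)

lemma ev_prefix: "adapted m \<Phi> \<Longrightarrow> ev (\<lambda>x. \<Phi> x \<and> prefix_code m x = i)"
proof (erule prefix_cases[of m \<Phi> i])
  assume *: "\<And>x. \<Phi> x \<and> prefix_code m x = i \<longleftrightarrow> False"
  show ?thesis unfolding * by (rule ev_const)
next
  fix y assume *: "\<And>x. (\<Phi> x \<and> prefix_code m x = i) \<longleftrightarrow> (\<forall>k\<le>m. x k = y k)"
  show ?thesis unfolding * by (rule ev_cylinder)
qed

text \<open>States are countable, so an adapted event is a countable union of cylinders, indexed by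
  \<open>prefix_code\<close>; adaptedness alone gives measurability.\<close>

lemma ev_adapted: "adapted m \<Phi> \<Longrightarrow> ev \<Phi>"
  using ev_ex[of "\<lambda>i x. \<Phi> x \<and> prefix_code m x = i", OF ev_prefix] by simp

text \<open>Multiplied out, the Markov property needs no positivity: on a null cylinder both sides
  vanish.\<close>

lemma markov_cylinder:
  "pr (\<lambda>x. (\<forall>k\<le>m. x k = y k) \<and> x (Suc m) = b) =
    (if b = y m + 2 then q (y m) else if b = y m - 1 then 1 - q (y m) else 0) * pr (\<lambda>x. \<forall>k\<le>m. x k = y k)"
proof (cases "pr (\<lambda>x. \<forall>k\<le>m. x k = y k) > 0")
  case True
  with markov[of m y b] show ?thesis
    unfolding pr_def cond_prob_def by (auto simp: conj_commute field_simps)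
next
  case False
  then have "pr (\<lambda>x. \<forall>k\<le>m. x k = y k) = 0"
    using pr_nonneg[of "\<lambda>x. \<forall>k\<le>m. x k = y k"] by linarith
  moreover have "pr (\<lambda>x. (\<forall>k\<le>m. x k = y k) \<and> x (Suc m) = b) \<le> pr (\<lambda>x. \<forall>k\<le>m. x k = y k)"
    by (rule pr_mono[OF ev_cylinder]) simp
  ultimately show ?thesis
    using pr_nonneg[of "\<lambda>x. (\<forall>k\<le>m. x k = y k) \<and> x (Suc m) = b"] by simp
qed

lemma markov_adapted:
  assumes loc: "located m a \<Phi>"
  shows "pr (\<lambda>x. \<Phi> x \<and> x (Suc m) = b) =
    (if b = a + 2 then q a else if b = a - 1 then 1 - q a else 0) * pr \<Phi>"
proof -
  note ad = located_adapted[OF loc] and a = locatedD[OF loc]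
  let ?C = "\<lambda>i x. \<Phi> x \<and> prefix_code m x = i"
  have ev: "ev (?C i)" for i by (rule ev_prefix[OF ad])
  have ev2: "ev (\<lambda>x. ?C i x \<and> x (Suc m) = b)" for i by (rule ev_conj[OF ev ev_at])
  have eq: "pr (\<lambda>x. ?C i x \<and> x (Suc m) = b) =
    (if b = a + 2 then q a else if b = a - 1 then 1 - q a else 0) * pr (?C i)" for i
  proof (rule prefix_cases[OF ad, of i])
    fix y assume y: "\<Phi> y" "\<And>x. ?C i x \<longleftrightarrow> (\<forall>k\<le>m. x k = y k)"
    show ?thesis unfolding y(2) using markov_cylinder[of m y b] a[OF y(1)] by simp
  next
    assume *: "\<And>x. ?C i x \<longleftrightarrow> False"
    show ?thesis unfolding * by simp
  qed
  have "(\<lambda>i. pr (\<lambda>x. ?C i x \<and> x (Suc m) = b)) sums pr (\<lambda>x. \<exists>i. ?C i x \<and> x (Suc m) = b)"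
    by (rule pr_sums[OF ev2]) blast
  moreover have "(\<lambda>i. (if b = a + 2 then q a else if b = a - 1 then 1 - q a else 0) * pr (?C i))
      sums ((if b = a + 2 then q a else if b = a - 1 then 1 - q a else 0) * pr (\<lambda>x. \<exists>i. ?C i x))"
    by (rule sums_mult[OF pr_sums[OF ev]]) blast
  ultimately show ?thesis unfolding eq using sums_unique2 by fastforce
qed

text \<open>The two admissible steps from \<open>a\<close> already carry the whole mass of being at
  \<open>a\<close>, so nothing remains for other targets; there are only countably many
  \<open>a\<close>.\<close>

lemma AE_step: "AE \<omega> in M. X (Suc n) \<omega> = X n \<omega> + 2 \<or> X (Suc n) \<omega> = X n \<omega> - 1"
proof -
  have "AE \<omega> in M. \<not> (X n \<omega> = a \<and> X (Suc n) \<omega> \<noteq> a + 2 \<and> X (Suc n) \<omega> \<noteq> a - 1)" for a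
  proof (rule AE_I)
    have ad: "located n a (\<lambda>x. x n = a)" by (intro locatedI adapted_at) auto
    have "pr (\<lambda>x. x n = a \<and> x (Suc n) = a + 2) + pr (\<lambda>x. x n = a \<and> x (Suc n) = a - 1) =
        pr (\<lambda>x. x n = a)"
      using markov_adapted[OF ad, of "a + 2"] markov_adapted[OF ad, of "a - 1"]
      by (simp add: algebra_simps)
    moreover have "pr (\<lambda>x. x n = a \<and> x (Suc n) = a + 2) + pr (\<lambda>x. x n = a \<and> x (Suc n) = a - 1)
        = pr (\<lambda>x. x n = a \<and> x (Suc n) = a + 2 \<or> x n = a \<and> x (Suc n) = a - 1)"
      by (rule pr_disj[symmetric]) (auto intro!: ev_intros)
    moreover have "pr (\<lambda>x. (x n = a \<and> x (Suc n) = a + 2 \<or> x n = a \<and> x (Suc n) = a - 1) \<or>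
        (x n = a \<and> x (Suc n) \<noteq> a + 2 \<and> x (Suc n) \<noteq> a - 1)) =
       pr (\<lambda>x. x n = a \<and> x (Suc n) = a + 2 \<or> x n = a \<and> x (Suc n) = a - 1) +
       pr (\<lambda>x. x n = a \<and> x (Suc n) \<noteq> a + 2 \<and> x (Suc n) \<noteq> a - 1)"
      by (rule pr_disj) (auto intro!: ev_intros)
    moreover have "pr (\<lambda>x. (x n = a \<and> x (Suc n) = a + 2 \<or> x n = a \<and> x (Suc n) = a - 1) \<or>
        (x n = a \<and> x (Suc n) \<noteq> a + 2 \<and> x (Suc n) \<noteq> a - 1)) \<le> pr (\<lambda>x. x n = a)"
      by (rule pr_mono) (auto intro!: ev_intros)
    ultimately have "pr (\<lambda>x. x n = a \<and> x (Suc n) \<noteq> a + 2 \<and> x (Suc n) \<noteq> a - 1) = 0"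
      using pr_nonneg[of "\<lambda>x. x n = a \<and> x (Suc n) \<noteq> a + 2 \<and> x (Suc n) \<noteq> a - 1"] by linarith
    then show "emeasure M {\<omega> \<in> space M. X n \<omega> = a \<and> X (Suc n) \<omega> \<noteq> a + 2 \<and> X (Suc n) \<omega> \<noteq> a - 1} = 0"
      unfolding pr_def by (simp add: emeasure_eq_measure)
    show "{\<omega> \<in> space M. X n \<omega> = a \<and> X (Suc n) \<omega> \<noteq> a + 2 \<and> X (Suc n) \<omega> \<noteq> a - 1} \<in> sets M"
      by measurable
  qed auto
  then have "AE \<omega> in M. \<forall>a. \<not> (X n \<omega> = a \<and> X (Suc n) \<omega> \<noteq> a + 2 \<and> X (Suc n) \<omega> \<noteq> a - 1)"
    by (subst AE_all_countable) blast
  then show ?thesis by eventually_elim auto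
qed

text \<open>Subtraction on naturals makes \<open>x n - 1\<close> equal to 0 at the origin, so
  waiting there is allowed. Almost every path is valid, which is how path arguments enter the
  probability bounds.\<close>

definition valid :: "(nat \<Rightarrow> nat) \<Rightarrow> bool" where
  "valid x \<longleftrightarrow> x 0 = 0 \<and> (\<forall>n. x (Suc n) = x n + 2 \<or> x (Suc n) = x n - 1)"

lemma AE_valid: "AE \<omega> in M. valid (\<lambda>n. X n \<omega>)"
proof -
  have "AE \<omega> in M. \<forall>n. X (Suc n) \<omega> = X n \<omega> + 2 \<or> X (Suc n) \<omega> = X n \<omega> - 1"
    by (subst AE_all_countable) (use AE_step in blast)
  with X0 show ?thesis unfolding valid_def by eventually_elim simp
qed

lemma valid_le: "valid x \<Longrightarrow> x n \<le> 2 * n"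
proof (induction n)
  case (Suc n)
  from \<open>valid x\<close> have "x (Suc n) = x n + 2 \<or> x (Suc n) = x n - 1" unfolding valid_def by blast
  with Suc show ?case by auto
qed (simp add: valid_def)

lemma pr_mono_valid:
  assumes "ev \<Psi>" "\<And>x. valid x \<Longrightarrow> \<Phi> x \<Longrightarrow> \<Psi> x"
  shows "pr \<Phi> \<le> pr \<Psi>"
  unfolding pr_def
proof (rule finite_measure_mono_AE)
  show "AE \<omega> in M. \<omega> \<in> {\<omega> \<in> space M. \<Phi> (\<lambda>n. X n \<omega>)} \<longrightarrow> \<omega> \<in> {\<omega> \<in> space M. \<Psi> (\<lambda>n. X n \<omega>)}"
    using AE_valid by eventually_elim (use assms(2) in auto)
qed (use assms(1) in \<open>simp add: ev_def\<close>)

lemma pr_step: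
  assumes loc: "located m a \<Phi>" and ev: "ev \<Psi>"
  shows "pr (\<lambda>x. \<Phi> x \<and> \<Psi> x) =
    pr (\<lambda>x. (\<Phi> x \<and> x (Suc m) = a + 2) \<and> \<Psi> x) + pr (\<lambda>x. (\<Phi> x \<and> x (Suc m) = a - 1) \<and> \<Psi> x)"
proof -
  note ad = located_adapted[OF loc] and a = locatedD[OF loc]
  note ev' = ev_adapted[OF ad]
  have "pr (\<lambda>x. \<Phi> x \<and> \<Psi> x) =
      pr (\<lambda>x. (\<Phi> x \<and> x (Suc m) = a + 2) \<and> \<Psi> x \<or> (\<Phi> x \<and> x (Suc m) = a - 1) \<and> \<Psi> x)"
  proof (rule antisym)
    show "pr (\<lambda>x. \<Phi> x \<and> \<Psi> x) \<le>
      pr (\<lambda>x. (\<Phi> x \<and> x (Suc m) = a + 2) \<and> \<Psi> x \<or> (\<Phi> x \<and> x (Suc m) = a - 1) \<and> \<Psi> x)"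
    proof (rule pr_mono_valid)
      fix x assume "valid x" "\<Phi> x \<and> \<Psi> x"
      moreover from this have "x (Suc m) = x m + 2 \<or> x (Suc m) = x m - 1"
        unfolding valid_def by blast
      ultimately show "(\<Phi> x \<and> x (Suc m) = a + 2) \<and> \<Psi> x \<or> (\<Phi> x \<and> x (Suc m) = a - 1) \<and> \<Psi> x"
        using a by auto
    qed (intro ev_intros ev ev')
  qed (rule pr_mono, intro ev_intros ev ev', auto)
  also have "\<dots> = pr (\<lambda>x. (\<Phi> x \<and> x (Suc m) = a + 2) \<and> \<Psi> x) +
      pr (\<lambda>x. (\<Phi> x \<and> x (Suc m) = a - 1) \<and> \<Psi> x)"
    by (rule pr_disj) (auto intro!: ev_intros ev ev')
  finally show ?thesis .
qed

section \<open>Comparison with super- and subharmonic functions\<close>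

definition gen :: "(nat \<Rightarrow> real) \<Rightarrow> nat \<Rightarrow> real" where
  "gen f a = q a * f (a + 2) + (1 - q a) * f (a - 1)"

text \<open>One-step induction for any functional \<open>F\<close> that is additive over the two possible steps.\<close>

lemma step_bound:
  fixes F :: "((nat \<Rightarrow> nat) \<Rightarrow> bool) \<Rightarrow> real"
  assumes loc: "located m a \<Phi>"
    and F: "F \<Phi> = F (\<lambda>x. \<Phi> x \<and> x (Suc m) = a + 2) + F (\<lambda>x. \<Phi> x \<and> x (Suc m) = a - 1)"
  shows "(\<And>\<Phi>' b. located (Suc m) b \<Phi>' \<Longrightarrow> F \<Phi>' \<le> f b * pr \<Phi>')
      \<Longrightarrow> F \<Phi> \<le> gen f a * pr \<Phi>"
    and "(\<And>\<Phi>' b. located (Suc m) b \<Phi>' \<Longrightarrow> f b * pr \<Phi>' \<le> F \<Phi>')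
      \<Longrightarrow> gen f a * pr \<Phi> \<le> F \<Phi>"
proof -
  note loc' = located_Suc[OF located_adapted[OF loc]]
  have m: "gen f a * pr \<Phi> = f (a + 2) * pr (\<lambda>x. \<Phi> x \<and> x (Suc m) = a + 2) +
      f (a - 1) * pr (\<lambda>x. \<Phi> x \<and> x (Suc m) = a - 1)"
    using markov_adapted[OF loc, of "a + 2"] markov_adapted[OF loc, of "a - 1"]
    by (simp add: gen_def algebra_simps)
  {
    assume "\<And>\<Phi>' b. located (Suc m) b \<Phi>' \<Longrightarrow> F \<Phi>' \<le> f b * pr \<Phi>'"
    from this[OF loc', of "a+2"] this[OF loc', of "a-1"]
    show "F \<Phi> \<le> gen f a * pr \<Phi>" unfolding F m by simp
  }
  {
    assume "\<And>\<Phi>' b. located (Suc m) b \<Phi>' \<Longrightarrow> f b * pr \<Phi>' \<le> F \<Phi>'"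
    from this[OF loc', of "a+2"] this[OF loc', of "a-1"]
    show "gen f a * pr \<Phi> \<le> F \<Phi>" unfolding F m by simp
  }
qed

lemma ev_hit_within: "ev (hit_within m D U N)"
  unfolding hit_within_def by (intro ev_intros)

lemma ev_stay_within: "ev (stay_within m D N)"
  unfolding stay_within_def by (intro ev_intros)

lemma ev_hit: "ev (hit m D U)"
  unfolding hit_def by (intro ev_intros)

lemma pr_cong: "(\<And>x. \<Phi> x \<longleftrightarrow> \<Psi> x) \<Longrightarrow> pr \<Phi> = pr \<Psi>"
  unfolding pr_def by simp

lemma pr_conj_le: "adapted m \<Phi> \<Longrightarrow> pr (\<lambda>x. \<Phi> x \<and> \<Psi> x) \<le> pr \<Phi>"
  by (rule pr_mono) (auto intro: ev_adapted)

lemma pr_conj_eq: "(\<And>x. \<Phi> x \<Longrightarrow> \<Psi> x) \<Longrightarrow> pr (\<lambda>x. \<Phi> x \<and> \<Psi> x) = pr \<Phi>"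
  by (rule pr_cong) blast

lemma pr_conj_0: "(\<And>x. \<Phi> x \<Longrightarrow> \<not> \<Psi> x) \<Longrightarrow> pr (\<lambda>x. \<Phi> x \<and> \<Psi> x) = 0"
  using pr_cong[of "\<lambda>x. \<Phi> x \<and> \<Psi> x" "\<lambda>x. False"] by auto

text \<open>Optional stopping for the non-negative supermartingale \<open>f (X n)\<close>, carried
  out as an induction on the horizon by first-step analysis.\<close>

lemma hit_within_le:
  assumes f0: "\<And>x. f x \<ge> 0" and fU: "\<And>x. x \<in> U \<Longrightarrow> f x \<ge> 1"
    and fD: "\<And>x. x \<in> D \<Longrightarrow> gen f x \<le> f x"
  shows "located m a \<Phi> \<Longrightarrow>
    pr (\<lambda>x. \<Phi> x \<and> hit_within m D U N x) \<le> f a * pr \<Phi>"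
proof (induction N arbitrary: m \<Phi> a)
  case (0 m \<Phi> a)
  show ?case
  proof (cases "a \<in> U")
    case True
    have "pr (\<lambda>x. \<Phi> x \<and> hit_within m D U 0 x) \<le> 1 * pr \<Phi>" using pr_conj_le[OF located_adapted[OF 0]] by simp
    also have "\<dots> \<le> f a * pr \<Phi>" using fU[OF True] by (intro mult_right_mono) auto
    finally show ?thesis .
  next
    case False
    then show ?thesis using locatedD[OF 0] f0[of a] by (subst pr_conj_0) (auto simp: hit_within_0)
  qed
next
  case (Suc N m \<Phi> a)
  consider "a \<in> U" | "a \<notin> U" "a \<in> D" | "a \<notin> U" "a \<notin> D" by blast
  then show ?case
  proof cases
    case 1
    have "pr (\<lambda>x. \<Phi> x \<and> hit_within m D U (Suc N) x) \<le> 1 * pr \<Phi>"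
      using pr_conj_le[OF located_adapted[OF Suc(2)]] by simp
    also have "\<dots> \<le> f a * pr \<Phi>" using fU[OF 1] by (intro mult_right_mono) auto
    finally show ?thesis .
  next
    case 2
    have "pr (\<lambda>x. \<Phi> x \<and> hit_within m D U (Suc N) x) = pr (\<lambda>x. \<Phi> x \<and> hit_within (Suc m) D U N x)"
      using 2 locatedD[OF Suc(2)] by (intro pr_cong) (auto simp: hit_within_Suc)
    also have "\<dots> \<le> gen f a * pr \<Phi>"
      by (rule step_bound(1)[OF Suc(2), where F = "\<lambda>\<Phi>. pr (\<lambda>x. \<Phi> x \<and> hit_within (Suc m) D U N x)"])
        (rule pr_step[OF Suc(2) ev_hit_within], rule Suc.IH)
    also have "\<dots> \<le> f a * pr \<Phi>" using fD[OF 2(2)] by (intro mult_right_mono) auto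
    finally show ?thesis .
  next
    case 3
    then show ?thesis using locatedD[OF Suc(2)] f0[of a] by (subst pr_conj_0) (auto simp: hit_within_Suc)
  qed
qed

lemma pr_Ex_mono_le:
  assumes ev: "\<And>N. ev (\<Phi> N)" and mono: "\<And>N x. \<Phi> N x \<Longrightarrow> \<Phi> (Suc N) x"
    and le: "\<And>N. pr (\<Phi> N) \<le> c"
  shows "pr (\<lambda>x. \<exists>N. \<Phi> N x) \<le> c"
proof -
  let ?A = "\<lambda>N. {\<omega> \<in> space M. \<Phi> N (\<lambda>n. X n \<omega>)}"
  have "(\<lambda>N. measure M (?A N)) \<longlonglongrightarrow> measure M (\<Union>N. ?A N)"
    using ev mono by (intro finite_Lim_measure_incseq) (auto simp: ev_def incseq_Suc_iff)
  moreover have "(\<Union>N. ?A N) = {\<omega> \<in> space M. \<exists>N. \<Phi> N (\<lambda>n. X n \<omega>)}" by auto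
  ultimately have "(\<lambda>N. pr (\<Phi> N)) \<longlonglongrightarrow> pr (\<lambda>x. \<exists>N. \<Phi> N x)" unfolding pr_def by simp
  then show ?thesis using le by (intro LIMSEQ_le_const2) auto
qed

lemma pr_All_mono_ge:
  assumes ev: "\<And>N. ev (\<Phi> N)" and mono: "\<And>N x. \<Phi> (Suc N) x \<Longrightarrow> \<Phi> N x"
    and le: "\<And>N. c \<le> pr (\<Phi> N)"
  shows "c \<le> pr (\<lambda>x. \<forall>N. \<Phi> N x)"
proof -
  let ?A = "\<lambda>N. {\<omega> \<in> space M. \<Phi> N (\<lambda>n. X n \<omega>)}"
  have "(\<lambda>N. measure M (?A N)) \<longlonglongrightarrow> measure M (\<Inter>N. ?A N)"
    using ev mono by (intro finite_Lim_measure_decseq) (auto simp: ev_def decseq_Suc_iff)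
  moreover have "(\<Inter>N. ?A N) = {\<omega> \<in> space M. \<forall>N. \<Phi> N (\<lambda>n. X n \<omega>)}" by auto
  ultimately have "(\<lambda>N. pr (\<Phi> N)) \<longlonglongrightarrow> pr (\<lambda>x. \<forall>N. \<Phi> N x)" unfolding pr_def by simp
  then show ?thesis using le by (intro LIMSEQ_le_const) auto
qed

lemma hit_iff: "hit m D U x \<longleftrightarrow> (\<exists>N. hit_within m D U N x)"
proof
  assume "hit m D U x"
  then obtain n where n: "n \<ge> m" "x n \<in> U" "\<forall>i. m \<le> i \<and> i < n \<longrightarrow> x i \<in> D"
    unfolding hit_def by blast
  then have "hit_within m D U n x" unfolding hit_within_def by (intro exI[of _ n]) auto
  then show "\<exists>N. hit_within m D U N x" ..
qed (auto simp: hit_def hit_within_def)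

lemma hit_le:
  assumes f0: "\<And>x. f x \<ge> 0" and fU: "\<And>x. x \<in> U \<Longrightarrow> f x \<ge> 1"
    and fD: "\<And>x. x \<in> D \<Longrightarrow> gen f x \<le> f x"
    and loc: "located m a \<Phi>"
  shows "pr (\<lambda>x. \<Phi> x \<and> hit m D U x) \<le> f a * pr \<Phi>"
proof -
  have "pr (\<lambda>x. \<exists>N. \<Phi> x \<and> hit_within m D U N x) \<le> f a * pr \<Phi>"
  proof (rule pr_Ex_mono_le)
    fix N x assume "\<Phi> x \<and> hit_within m D U N x"
    then show "\<Phi> x \<and> hit_within m D U (Suc N) x" 
      unfolding hit_within_def by (metis add_Suc_right le_SucI)
  qed (use hit_within_le[OF f0 fU fD loc] in \<open>auto intro!: ev_conj ev_adapted[OF located_adapted[OF loc]] ev_hit_within\<close>)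
  then show ?thesis unfolding hit_iff by simp
qed

text \<open>The submartingale counterpart. Paths still inside \<open>D\<close> at the horizon have
  not been decided; \<open>f\<close> is at most \<open>B\<close> there, which produces the second
  summand.\<close>

lemma hit_within_ge:
  assumes fU: "\<And>x. x \<in> U \<Longrightarrow> f x \<le> 1" and f0: "\<And>x. x \<notin> U \<Longrightarrow> x \<notin> D \<Longrightarrow> f x \<le> 0"
    and fB: "\<And>x. x \<in> D \<Longrightarrow> f x \<le> B" and B: "B \<ge> 0"
    and fD: "\<And>x. x \<in> D \<Longrightarrow> f x \<le> gen f x"
  shows "located m a \<Phi> \<Longrightarrow>
    f a * pr \<Phi> \<le> pr (\<lambda>x. \<Phi> x \<and> hit_within m D U N x) + B * pr (\<lambda>x. \<Phi> x \<and> stay_within m D N x)"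
proof (induction N arbitrary: m \<Phi> a)
  case (0 m \<Phi> a)
  consider "a \<in> U" | "a \<notin> U" "a \<in> D" | "a \<notin> U" "a \<notin> D" by blast
  then show ?case
  proof cases
    case 1
    have "f a * pr \<Phi> \<le> 1 * pr \<Phi>" using fU[OF 1] by (intro mult_right_mono) auto
    also have "\<dots> = pr (\<lambda>x. \<Phi> x \<and> hit_within m D U 0 x)"
      using 1 locatedD[OF 0] by (subst pr_conj_eq) (auto simp: hit_within_0)
    finally show ?thesis using B by (simp add: add_increasing2)
  next
    case 2
    have "f a * pr \<Phi> \<le> B * pr \<Phi>" using fB[OF 2(2)] by (intro mult_right_mono) auto
    also have "B * pr \<Phi> = B * pr (\<lambda>x. \<Phi> x \<and> stay_within m D 0 x)"
      using 2 locatedD[OF 0] by (subst pr_conj_eq) (auto simp: stay_within_0)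
    finally show ?thesis using pr_nonneg[of "\<lambda>x. \<Phi> x \<and> hit_within m D U 0 x"] by linarith
  next
    case 3
    have "f a * pr \<Phi> \<le> 0" using f0[OF 3] by (simp add: mult_nonpos_nonneg)
    also have "\<dots> \<le> pr (\<lambda>x. \<Phi> x \<and> hit_within m D U 0 x) + B * pr (\<lambda>x. \<Phi> x \<and> stay_within m D 0 x)"
      using B by simp
    finally show ?thesis .
  qed
next
  case (Suc N m \<Phi> a)
  consider "a \<in> U" | "a \<notin> U" "a \<in> D" | "a \<notin> U" "a \<notin> D" by blast
  then show ?case
  proof cases
    case 1
    have "f a * pr \<Phi> \<le> 1 * pr \<Phi>" using fU[OF 1] by (intro mult_right_mono) auto
    also have "\<dots> = pr (\<lambda>x. \<Phi> x \<and> hit_within m D U (Suc N) x)"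
      using 1 locatedD[OF Suc(2)] by (subst pr_conj_eq) (auto simp: hit_within_Suc)
    finally show ?thesis using B by (simp add: add_increasing2)
  next
    case 2
    have "f a * pr \<Phi> \<le> gen f a * pr \<Phi>" using fD[OF 2(2)] by (intro mult_right_mono) auto
    also have "\<dots> \<le> pr (\<lambda>x. \<Phi> x \<and> hit_within (Suc m) D U N x)
       + B * pr (\<lambda>x. \<Phi> x \<and> stay_within (Suc m) D N x)"
      by (rule step_bound(2)[OF Suc(2), where F = "\<lambda>\<Phi>. pr (\<lambda>x. \<Phi> x \<and> hit_within (Suc m) D U N x)
       + B * pr (\<lambda>x. \<Phi> x \<and> stay_within (Suc m) D N x)"])
       (use pr_step[OF Suc(2) ev_hit_within[of "Suc m" D U N]]
            pr_step[OF Suc(2) ev_stay_within[of "Suc m" D N]] Suc.IH in \<open>auto simp: algebra_simps\<close>)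
    also have "pr (\<lambda>x. \<Phi> x \<and> hit_within (Suc m) D U N x) = pr (\<lambda>x. \<Phi> x \<and> hit_within m D U (Suc N) x)"
      using 2 locatedD[OF Suc(2)] by (intro pr_cong) (auto simp: hit_within_Suc)
    also have "pr (\<lambda>x. \<Phi> x \<and> stay_within (Suc m) D N x) = pr (\<lambda>x. \<Phi> x \<and> stay_within m D (Suc N) x)"
      using 2 locatedD[OF Suc(2)] by (intro pr_cong) (auto simp: stay_within_Suc)
    finally show ?thesis .
  next
    case 3
    have "f a * pr \<Phi> \<le> 0" using f0[OF 3] by (simp add: mult_nonpos_nonneg)
    also have "\<dots> \<le> pr (\<lambda>x. \<Phi> x \<and> hit_within m D U (Suc N) x) + B * pr (\<lambda>x. \<Phi> x \<and> stay_within m D (Suc N) x)"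
      using B by simp
    finally show ?thesis .
  qed
qed

text \<open>The case of an empty target and \<open>B = 1\<close> of \<open>hit_within_ge\<close>:
  only the undecided paths remain, and the horizon tends to infinity.\<close>

lemma stay_ge:
  assumes fD1: "\<And>x. x \<in> D \<Longrightarrow> f x \<le> 1" and f0: "\<And>x. x \<notin> D \<Longrightarrow> f x \<le> 0"
    and fD: "\<And>x. x \<in> D \<Longrightarrow> f x \<le> gen f x"
    and loc: "located m a \<Phi>"
  shows "f a * pr \<Phi> \<le> pr (\<lambda>x. \<Phi> x \<and> (\<forall>i\<ge>m. x i \<in> D))"
proof -
  have "f a * pr \<Phi> \<le> pr (\<lambda>x. \<forall>N. \<Phi> x \<and> stay_within m D N x)"
  proof (rule pr_All_mono_ge)
    fix N
    have "pr (\<lambda>x. \<Phi> x \<and> hit_within m D {} N x) = 0"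
      by (rule pr_conj_0) (auto simp: hit_within_def)
    then show "f a * pr \<Phi> \<le> pr (\<lambda>x. \<Phi> x \<and> stay_within m D N x)"
      using hit_within_ge[of "{}" f D 1 m a \<Phi> N] assms by simp
  next
    show "ev (\<lambda>x. \<Phi> x \<and> stay_within m D N x)" for N
      by (intro ev_conj ev_adapted[OF located_adapted[OF loc]] ev_stay_within)
  qed (auto simp: stay_within_def)
  also have "\<dots> = pr (\<lambda>x. \<Phi> x \<and> (\<forall>i\<ge>m. x i \<in> D))"
    by (rule pr_cong) (auto simp: stay_within_def, metis le_add1 le_add2 add_leD2 trans_le_add2)
  finally show ?thesis .
qed

text \<open>The generator maps \<open>2^x\<close> to at least \<open>5/3 * 2^x\<close>, so a bounded function of the form
  \<open>const - 3/2 * 2^x\<close> decreases by at least 1 in mean at each step.\<close>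

lemma stay_bounded_le:
  "located m a \<Phi> \<Longrightarrow>
    real n * pr (\<lambda>x. \<Phi> x \<and> stay_within m {..<N} n x) \<le> max 0 (3/2 * (2^(N+2) - 2^a)) * pr \<Phi>"
proof (induction n arbitrary: m \<Phi> a)
  case (Suc n m \<Phi> a)
  define g :: "nat \<Rightarrow> real" where "g a = max 0 (3/2 * (2^(N+2) - 2^a))" for a
  show ?case
  proof (cases "a < N")
    case True
    \<comment> \<open>From a site below \<open>N\<close> one step reaches at most
      \<open>N + 1\<close>, where the truncation by \<open>max 0\<close> is still inactive; this is
      the purpose of the exponent \<open>N + 2\<close>.\<close>
    have geq: "g b = 3/2 * (2^(N+2) - 2^b)" if "b \<le> N + 2" for b
      using power_increasing[of b "N + 2" "2::real"] that by (simp add: g_def)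
    have "real (Suc n) * pr (\<lambda>x. \<Phi> x \<and> stay_within m {..<N} (Suc n) x) =
       real (Suc n) * pr (\<lambda>x. \<Phi> x \<and> stay_within (Suc m) {..<N} n x)"
      using True locatedD[OF Suc(2)] by (intro arg_cong2[where f = "(*)"] pr_cong) (auto simp: stay_within_Suc)
    \<comment> \<open>\<open>real (Suc n)\<close> times the probability is \<open>real n\<close>
      times it, which the induction hypothesis bounds through \<open>g\<close>, plus one more copy,
      which is at most \<open>pr \<Phi>'\<close>; hence the summand 1.\<close>
    also have "\<dots> \<le> gen (\<lambda>b. g b + 1) a * pr \<Phi>"
    proof (rule step_bound(1)[OF Suc(2), where F = "\<lambda>\<Phi>. real (Suc n) * pr (\<lambda>x. \<Phi> x \<and> stay_within (Suc m) {..<N} n x)"], goal_cases)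
      case 1
      show ?case unfolding pr_step[OF Suc(2) ev_stay_within] by (simp add: algebra_simps)
    next
      case (2 \<Phi>' b)
      have "pr (\<lambda>x. \<Phi>' x \<and> stay_within (Suc m) {..<N} n x) \<le> pr \<Phi>'" by (rule pr_conj_le[OF located_adapted[OF 2]])
      with Suc.IH[OF 2] show ?case by (simp add: g_def algebra_simps)
    qed
    also have "gen (\<lambda>b. g b + 1) a \<le> g a"
    proof -
      have e: "(2::real) ^ (a - 1) \<ge> 2 ^ a / 2" by (cases a) auto
      have "q a * (2 ^ (a+2)) + (1 - q a) * 2 ^ (a - 1) \<ge> q a * (4 * 2^a) + (1 - q a) * (2 ^ a / (2::real))"
        using e q_le[of a] q_ge[of a] by (intro add_mono mult_left_mono) auto
      also have "q a * (4 * 2^a) + (1 - q a) * (2 ^ a / (2::real)) = 2^a * (1/2 + 7/2 * q a)"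
        by (simp add: field_simps)
      finally have "q a * (2 ^ (a+2)) + (1 - q a) * 2 ^ (a - 1) \<ge> 2^a * (1/2 + 7/2 * q a)" .
      moreover have "2^a * (1/2 + 7/2 * q a) \<ge> 2^a * (5/3)"
        using q_ge[of a] by (intro mult_left_mono) auto
      moreover have "(2::real)^a \<ge> 1" by simp
      ultimately have *: "q a * (2 ^ (a+2)) + (1 - q a) * 2 ^ (a - 1) \<ge> 2^a + 2/3" by linarith
      have "gen (\<lambda>b. g b + 1) a = 1 + 3/2 * 2^(N+2) - 3/2 * (q a * (2 ^ (a+2)) + (1 - q a) * 2 ^ (a - 1))"
      proof -
        have e2: "g (a + 2) = 3/2 * (2^(N+2) - 2^(a+2))" by (rule geq) (use True in simp)
        have e1: "g (a - 1) = 3/2 * (2^(N+2) - 2^(a-1))" by (rule geq) (use True in simp)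
        show ?thesis unfolding gen_def e1 e2 by (simp add: field_simps)
      qed
      also have "\<dots> \<le> 3/2 * (2^(N+2) - 2^a)" 
      proof -
        have "1 + 3/2 * Z - 3/2 * Y \<le> 3/2 * (Z - W)" if "W + 2/3 \<le> Y" for W Y Z :: real
          using that by simp
        from this[OF *] show ?thesis .
      qed
      also have "\<dots> = g a" using geq[of a] True by simp
      finally show ?thesis .
    qed
    finally show ?thesis by (simp add: g_def mult_right_mono)
  next
    case False
    then show ?thesis using locatedD[OF Suc(2)] by (subst pr_conj_0) (auto simp: stay_within_Suc)
  qed
qed auto

lemma stay_bounded_tendsto:
  assumes "located m a \<Phi>"
  shows "(\<lambda>n. pr (\<lambda>x. \<Phi> x \<and> stay_within m {..<N} n x)) \<longlonglongrightarrow> 0"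
proof (rule tendsto_sandwich[OF _ _ tendsto_const])
  define C where "C = max 0 (3/2 * (2^(N+2) - 2^a)) * pr \<Phi>"
  show "\<forall>\<^sub>F n in sequentially. pr (\<lambda>x. \<Phi> x \<and> stay_within m {..<N} n x) \<le> C / real n"
    using eventually_gt_at_top[of 0]
    by eventually_elim (use stay_bounded_le[OF assms] in \<open>auto simp: field_simps C_def\<close>)
  show "(\<lambda>n. C / real n) \<longlonglongrightarrow> 0" by (rule lim_const_over_n)
qed auto

text \<open>On a bounded \<open>D\<close> the function is bounded and the walk almost surely leaves,
  so the error term of \<open>hit_within_ge\<close> tends to 0.\<close>

lemma hit_ge:
  assumes fU: "\<And>x. x \<in> U \<Longrightarrow> f x \<le> 1" and f0: "\<And>x. x \<notin> U \<Longrightarrow> x \<notin> D \<Longrightarrow> f x \<le> 0"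
    and D: "D \<subseteq> {..<N}"
    and fD: "\<And>x. x \<in> D \<Longrightarrow> f x \<le> gen f x"
    and loc: "located m a \<Phi>"
  shows "f a * pr \<Phi> \<le> pr (\<lambda>x. \<Phi> x \<and> hit m D U x)"
proof -
  define B where "B = (\<Sum>x\<in>D. \<bar>f x\<bar>)"
  have fin: "finite D" using D finite_subset by blast
  have B: "B \<ge> 0" "f x \<le> B" if "x \<in> D" for x
    using member_le_sum[OF that _ fin, of "\<lambda>x. \<bar>f x\<bar>"] by (auto simp: B_def sum_nonneg)
  have B0: "B \<ge> 0" by (simp add: B_def sum_nonneg)
  have le: "f a * pr \<Phi> \<le> pr (\<lambda>x. \<Phi> x \<and> hit m D U x) + B * pr (\<lambda>x. \<Phi> x \<and> stay_within m {..<N} n x)" for n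
  proof -
    have "f a * pr \<Phi> \<le> pr (\<lambda>x. \<Phi> x \<and> hit_within m D U n x) + B * pr (\<lambda>x. \<Phi> x \<and> stay_within m D n x)"
      by (rule hit_within_ge[OF fU f0 B(2) B0 fD loc])
    also have "\<dots> \<le> pr (\<lambda>x. \<Phi> x \<and> hit m D U x) + B * pr (\<lambda>x. \<Phi> x \<and> stay_within m {..<N} n x)"
      using B0 D by (intro add_mono mult_left_mono pr_mono ev_conj ev_adapted[OF located_adapted[OF loc]] ev_hit ev_stay_within)
        (auto simp: hit_iff stay_within_def)
    finally show ?thesis .
  qed
  have "(\<lambda>n. pr (\<lambda>x. \<Phi> x \<and> hit m D U x) + B * pr (\<lambda>x. \<Phi> x \<and> stay_within m {..<N} n x))
     \<longlonglongrightarrow> pr (\<lambda>x. \<Phi> x \<and> hit m D U x) + B * 0"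
    by (intro tendsto_intros stay_bounded_tendsto[OF loc])
  from LIMSEQ_le_const[OF this] le show ?thesis by auto
qed

lemma pr_bounded_0: "pr (\<lambda>x. \<forall>i\<ge>m. x i < N) = 0"
proof -
  have z: "pr (\<lambda>x. x m = a \<and> (\<forall>i\<ge>m. x i < N)) = 0" for a
  proof -
    have ad: "located m a (\<lambda>x. x m = a)" by (intro locatedI adapted_at) auto
    have "pr (\<lambda>x. x m = a \<and> (\<forall>i\<ge>m. x i < N)) \<le> pr (\<lambda>x. x m = a \<and> stay_within m {..<N} n x)" for n
      by (rule pr_mono) (auto simp: stay_within_def intro!: ev_intros)
    then have "pr (\<lambda>x. x m = a \<and> (\<forall>i\<ge>m. x i < N)) \<le> 0"
      using stay_bounded_tendsto[OF ad, of N] by (intro LIMSEQ_le_const) auto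
    then show ?thesis using pr_nonneg antisym by blast
  qed
  have "(\<lambda>a. pr (\<lambda>x. x m = a \<and> (\<forall>i\<ge>m. x i < N))) sums pr (\<lambda>x. \<exists>a. x m = a \<and> (\<forall>i\<ge>m. x i < N))"
    by (rule pr_sums) (auto intro!: ev_intros)
  then show ?thesis unfolding z using sums_unique2[OF sums_zero] by force
qed

end

section \<open>Generator estimates\<close>

text \<open>The error has to keep the factor \<delta>, because \<delta> will be as small as eps and
  the main term of the generator is itself proportional to \<delta>. The third derivative is at most
  6 \<delta> times 16, and division by 3! leaves 16 \<delta>.\<close>

lemma powr_one_plus_taylor:
  fixes u \<delta> :: real
  assumes u: "\<bar>u\<bar> \<le> 1/2" and \<delta>: "0 \<le> \<delta>" "\<delta> \<le> 1"
  shows "\<bar>(1 + u) powr (-\<delta>) - (1 - \<delta> * u + \<delta> * (\<delta> + 1) / 2 * u\<^sup>2)\<bar> \<le> 16 * \<delta> * \<bar>u\<bar>^3"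
proof (cases "u = 0")
  case False
  define f where "f m t = (if m = 0 then (1 + t) powr (-\<delta>) else if m = 1 then -\<delta> * (1 + t) powr (-\<delta>-1)
      else if m = 2 then \<delta> * (\<delta>+1) * (1 + t) powr (-\<delta>-2) else -\<delta> * (\<delta>+1) * (\<delta>+2) * (1 + t) powr (-\<delta>-3))"
    for m :: nat and t :: real
  have d: "(f m has_real_derivative f (Suc m) t) (at t)" if "m < 3" "t > -1" for m t
  proof -
    have "m = 0 \<or> m = 1 \<or> m = 2" using that by auto
    moreover have "((\<lambda>t. a * (1 + t) powr c) has_real_derivative a * c * (1 + t) powr (c - 1)) (at t)" for a c
      using that by (auto intro!: derivative_eq_intros)
    from this[of 1 "-\<delta>"] this[of "-\<delta>" "-\<delta>-1"] this[of "\<delta> * (\<delta>+1)" "-\<delta>-2"]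
    have "(f 0 has_real_derivative f 1 t) (at t)" "(f 1 has_real_derivative f 2 t) (at t)"
      "(f 2 has_real_derivative f 3 t) (at t)"
      unfolding f_def[abs_def] by (simp_all add: algebra_simps)
    ultimately show ?thesis by (auto simp: numeral_2_eq_2 numeral_3_eq_3)
  qed
  have "\<exists>t. (if u < 0 then u < t \<and> t < 0 else 0 < t \<and> t < u) \<and>
    f 0 u = (\<Sum>m<3. f m 0 / fact m * (u - 0)^m) + f 3 t / fact 3 * (u - 0)^3"
    by (rule Taylor[where a = "-1/2" and b = "1/2"]) (use False u d in auto)
  then obtain t where t': "if u < 0 then u < t \<and> t < 0 else 0 < t \<and> t < u"
    and t2: "f 0 u = (\<Sum>m<3. f m 0 / fact m * u^m) + f 3 t / fact 3 * u^3" by auto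
  have t: "\<bar>t\<bar> < 1/2" using t' u by (auto split: if_splits)
  have "f 0 u - (1 - \<delta> * u + \<delta> * (\<delta> + 1) / 2 * u\<^sup>2) = f 3 t / 6 * u^3"
    unfolding t2 by (simp add: f_def numeral_3_eq_3 lessThan_Suc power2_eq_square)
  moreover have "\<bar>f 3 t\<bar> \<le> 96 * \<delta>"
  proof -
    have "(1 + t) powr (-\<delta>-3) \<le> (1/2) powr (-\<delta>-3)"
      using t \<delta> by (intro powr_mono2') auto
    also have "\<dots> \<le> (1/2) powr (-4)" using \<delta> by (intro powr_mono') auto
    also have "\<dots> = 16" by (simp add: powr_minus powr_numeral power_divide)
    finally have p: "(1 + t) powr (-\<delta>-3) \<le> 16" .
    have "(\<delta>+1) * (\<delta>+2) \<le> 2 * 3" using \<delta> by (intro mult_mono) auto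
    then have "((\<delta>+1) * (\<delta>+2)) * (1 + t) powr (-\<delta>-3) \<le> 6 * 16" using p \<delta> by (intro mult_mono) auto
    then have "\<delta> * (((\<delta>+1) * (\<delta>+2)) * (1 + t) powr (-\<delta>-3)) \<le> \<delta> * (6 * 16)" using \<delta> by (intro mult_left_mono) auto
    then show ?thesis using \<delta> by (simp add: f_def abs_mult mult.assoc)
  qed
  moreover from this have "\<bar>f 3 t / 6 * u^3\<bar> \<le> 96 * \<delta> / 6 * \<bar>u\<bar>^3"
    unfolding abs_mult power_abs by (intro mult_right_mono) auto
  ultimately have "\<bar>f 0 u - (1 - \<delta> * u + \<delta> * (\<delta> + 1) / 2 * u\<^sup>2)\<bar> \<le> 96 * \<delta> / 6 * \<bar>u\<bar>^3"
    by simp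
  then show ?thesis by (simp add: f_def)
qed simp

text \<open>The drift contributes -\<delta> (1 + \<epsilon>) and half the second moment \<delta>
  (\<delta> + 1), in units of x^(-\<delta>-2), whence \<delta> (\<delta> - \<epsilon>). In 146 = 2 +
  128 + 16, the 2 comes from the excess of the second moment over 2, the rest from the Taylor errors
  of the steps +2 and -1.\<close>

lemma powr_generator_expansion:
  fixes x \<delta> \<epsilon> :: real
  assumes x: "x \<ge> 4" and \<delta>: "0 \<le> \<delta>" "\<delta> \<le> 1" and \<epsilon>: "0 \<le> \<epsilon>" "\<epsilon> \<le> 1"
  defines "p \<equiv> 1/3 + (1 + \<epsilon>) / (3 * x)"
  shows "\<bar>p * (x + 2) powr (-\<delta>) + (1 - p) * (x - 1) powr (-\<delta>) - x powr (-\<delta>) - 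
     x powr (-\<delta>) * (\<delta> / x\<^sup>2) * (\<delta> - \<epsilon>)\<bar> \<le> x powr (-\<delta>) * (\<delta> / x\<^sup>2) * (146 / x)"
proof -
  define T where "T u = 1 - \<delta> * u + \<delta> * (\<delta> + 1) / 2 * u\<^sup>2" for u
  define R where "R u = (1 + u) powr (-\<delta>) - T u" for u
  have p: "0 \<le> p" "p \<le> 1" using x \<epsilon> by (auto simp: p_def field_simps)
  have R: "\<bar>R (2/x)\<bar> \<le> 16 * \<delta> * (8 / x^3)" "\<bar>R (-1/x)\<bar> \<le> 16 * \<delta> * (1 / x^3)"
    using powr_one_plus_taylor[of "2/x" \<delta>] powr_one_plus_taylor[of "-1/x" \<delta>] x \<delta>
    by (auto simp: R_def T_def power_divide)
  have e1: "(x + 2) powr (-\<delta>) = x powr (-\<delta>) * (T (2/x) + R (2/x))"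
  proof -
    have "x * (1 + 2/x) = x + 2" using x by (simp add: field_simps)
    then have "(x + 2) powr (-\<delta>) = x powr (-\<delta>) * (1 + 2/x) powr (-\<delta>)"
      using x powr_mult[of x "1 + 2/x" "-\<delta>"] by simp
    then show ?thesis by (simp add: R_def)
  qed
  have e2: "(x - 1) powr (-\<delta>) = x powr (-\<delta>) * (T (-1/x) + R (-1/x))"
  proof -
    have "x * (1 + -1/x) = x - 1" using x by (simp add: field_simps)
    then have "(x - 1) powr (-\<delta>) = x powr (-\<delta>) * (1 + -1/x) powr (-\<delta>)"
      using x powr_mult[of x "1 + -1/x" "-\<delta>"] by simp
    then show ?thesis by (simp add: R_def)
  qed
  have "p * T (2/x) + (1 - p) * T (-1/x) - 1 =
      \<delta> / x\<^sup>2 * (\<delta> - \<epsilon>) + \<delta> / x\<^sup>2 * ((\<delta> + 1) * (1 + \<epsilon>) / (2 * x))"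
    using x by (simp add: T_def p_def field_simps power2_eq_square power3_eq_cube)
  note M = this
  have "p * (x + 2) powr (-\<delta>) + (1 - p) * (x - 1) powr (-\<delta>) - x powr (-\<delta>) - 
     x powr (-\<delta>) * (\<delta> / x\<^sup>2) * (\<delta> - \<epsilon>) = 
     x powr (-\<delta>) * (\<delta> / x\<^sup>2 * ((\<delta> + 1) * (1 + \<epsilon>) / (2 * x)) + (p * R (2/x) + (1 - p) * R (-1/x)))"
  proof -
    have "p * (w * (T1 + R1)) + (1 - p) * (w * (T2 + R2)) - w - w * d * e = w * (B + (p * R1 + (1 - p) * R2))"
      if "p * T1 + (1 - p) * T2 - 1 = d * e + B" for w T1 R1 T2 R2 d e B :: real
    proof -
      have "p * (w * (T1 + R1)) + (1 - p) * (w * (T2 + R2)) - w - w * d * e =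
        w * ((p * T1 + (1 - p) * T2 - 1) - d * e + (p * R1 + (1 - p) * R2))" by (simp add: algebra_simps)
      then show ?thesis unfolding that by simp
    qed
    from this[OF M] show ?thesis unfolding e1 e2 .
  qed
  moreover have "\<bar>\<delta> / x\<^sup>2 * ((\<delta> + 1) * (1 + \<epsilon>) / (2 * x)) + (p * R (2/x) + (1 - p) * R (-1/x))\<bar> \<le>
     \<delta> / x\<^sup>2 * (146 / x)"
  proof -
    have "(\<delta> + 1) * (1 + \<epsilon>) \<le> 2 * 2" using \<delta> \<epsilon> by (intro mult_mono) auto
    then have "\<bar>\<delta> / x\<^sup>2 * ((\<delta> + 1) * (1 + \<epsilon>) / (2 * x))\<bar> \<le> \<delta> / x\<^sup>2 * (2 * 2 / (2 * x))"
    proof (subst abs_of_nonneg)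
      assume "(\<delta> + 1) * (1 + \<epsilon>) \<le> 2 * 2"
      then show "\<delta> / x\<^sup>2 * ((\<delta> + 1) * (1 + \<epsilon>) / (2 * x)) \<le> \<delta> / x\<^sup>2 * (2 * 2 / (2 * x))"
        using x \<delta> by (intro mult_left_mono divide_right_mono) auto
    qed (use x \<delta> \<epsilon> in auto)
    moreover have "\<bar>p * R (2/x) + (1 - p) * R (-1/x)\<bar> \<le> 1 * \<bar>R (2/x)\<bar> + 1 * \<bar>R (-1/x)\<bar>"
      using p by (intro order_trans[OF abs_triangle_ineq] add_mono) (auto simp: abs_mult intro!: mult_left_le_one_le)
    moreover have "\<delta> / x\<^sup>2 * (146 / x) = \<delta> / x\<^sup>2 * (2 * 2 / (2 * x)) + (16 * \<delta> * (8 / x^3) + 16 * \<delta> * (1 / x^3))"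
      using x by (simp add: field_simps power2_eq_square power3_eq_cube)
    moreover have "\<bar>a + b\<bar> \<le> c"
      if "\<bar>a\<bar> \<le> t" "\<bar>b\<bar> \<le> 1 * r1 + 1 * r2" "c = t + (s1 + s2)" "r1 \<le> s1" "r2 \<le> s2" for a b c t r1 r2 s1 s2 :: real
      using that by linarith
    ultimately show ?thesis using R by blast
  qed
  moreover have "\<bar>a\<bar> \<le> w * d * e" if "a = w * b" "\<bar>b\<bar> \<le> d * e" "w \<ge> 0" for a b w d e :: real
    using mult_left_mono[OF that(2,3)] that by (simp add: abs_mult mult.assoc)
  ultimately show ?thesis by (meson powr_ge_zero)
qed

text \<open>For 1 / ln x the logarithmic correction in f'' contributes 2 / (x^2 ln^3 x) and the
  excess drift -\<epsilon> / (x^2 ln^2 x). So \<epsilon> = 2 / ln x is the balance point, and 3 / ln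
  x wins with a margin that covers the lower-order terms.\<close>

lemma inverse_ln_superharmonic:
  "\<forall>\<^sub>F x::real in at_top. (1/3 + (1 + 3 / ln x) / (3 * x)) * (1 / ln (x + 2)) +
     (2/3 - (1 + 3 / ln x) / (3 * x)) * (1 / ln (x - 1)) \<le> 1 / ln x"
  by real_asymp

text \<open>Since 1 / ln is decreasing, a larger upward probability only lowers the mean, so the
  boundary case 3 / ln x suffices.\<close>

lemma inverse_ln_generator:
  "\<forall>\<^sub>F x::real in at_top. \<forall>\<epsilon> \<ge> 3 / ln x. (1/3 + (1 + \<epsilon>) / (3 * x)) * (1 / ln (x + 2)) +
     (1 - (1/3 + (1 + \<epsilon>) / (3 * x))) * (1 / ln (x - 1)) \<le> 1 / ln x"
  using inverse_ln_superharmonic eventually_ge_at_top[of 4]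
proof eventually_elim
  case (elim x)
  show ?case
  proof (intro allI impI)
    fix \<epsilon> assume e: "3 / ln x \<le> \<epsilon>"
    define c d where "c = (1 + 3 / ln x) / (3 * x)" and "d = (1 + \<epsilon>) / (3 * x)"
    define a b where "a = 1 / ln (x + 2)" and "b = 1 / ln (x - 1)"
    have ab: "a \<le> b" using elim(2) unfolding a_def b_def by (intro divide_left_mono mult_pos_pos) auto
    have "c \<le> d" unfolding c_def d_def using e elim(2) by (intro divide_right_mono) auto
    then have "c * (b - a) \<le> d * (b - a)"
      using ab by (intro mult_right_mono) auto
    moreover have "(1/3 + c) * a + (2/3 - c) * b \<le> 1 / ln x"
      using elim(1) unfolding a_def b_def c_def .
    ultimately show "(1/3 + (1 + \<epsilon>) / (3 * x)) * (1 / ln (x + 2)) +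
     (1 - (1/3 + (1 + \<epsilon>) / (3 * x))) * (1 / ln (x - 1)) \<le> 1 / ln x"
      unfolding a_def[symmetric] b_def[symmetric] d_def[symmetric] by (simp add: algebra_simps)
  qed
qed

text \<open>The constant 292 is twice the 146 of \<open>powr_generator_expansion\<close>, so that
  the Taylor error is at most half of eps.\<close>

lemma eventually_lnln_powr:
  fixes \<beta> :: real
  assumes "\<beta> > 0"
  shows "\<forall>\<^sub>F x::real in at_top. 3 / ln x \<le> ln (ln x) powr (-\<beta>)"
    and "\<forall>\<^sub>F x::real in at_top. 292 / x \<le> ln (ln x) powr (-\<beta>)"
    and "\<forall>\<^sub>F x::real in at_top. ln (ln x) powr (-\<beta>) \<le> 1/2"
  using assms by real_asymp+

section \<open>Reaching and escape probabilities\<close>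

text \<open>Applied to y = \<delta> ln (j / k). The reciprocal of the lower bound is 1 + 1/y, which
  is the source of the two summands in \<open>reach_le\<close>.\<close>

lemma one_minus_powr_bounds:
  fixes y :: real
  assumes "y \<ge> 0"
  shows "y / (1 + y) \<le> 1 - exp (-y)" "1 - exp (-y) \<le> y"
proof -
  have "exp (-y) \<le> 1 / (1 + y)"
    using assms exp_ge_add_one_self[of y] by (simp add: exp_minus field_simps)
  also have "\<dots> = 1 - y / (1 + y)" using assms by (simp add: field_simps)
  finally show "y / (1 + y) \<le> 1 - exp (-y)" by simp
  show "1 - exp (-y) \<le> y" using exp_ge_add_one_self[of "-y"] by simp
qed

context walk
begin

lemma gen_mono: "(\<And>x. f x \<le> g x) \<Longrightarrow> gen f a \<le> gen g a"
  unfolding gen_def using q_ge[of a] q_le[of a]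
  by (intro add_mono mult_left_mono) auto

lemma gen_affine: "gen (\<lambda>x. c + d * f x) a = c + d * gen f a"
  unfolding gen_def by (simp add: algebra_simps)

lemma gen_cong: "f (a + 2) = g (a + 2) \<Longrightarrow> f (a - 1) = g (a - 1) \<Longrightarrow> gen f a = gen g a"
  unfolding gen_def by simp

end

locale lnln_walk = walk M X q for M :: "'a measure" and X q +
  fixes \<beta> :: real
  assumes \<beta>: "\<beta> > 0"
    and q_eq: "\<And>i. i \<ge> 4 \<Longrightarrow> q i = 1/3 + (1 + ln (ln (real i)) powr (-\<beta>)) / (3 * real i)"
begin

definition eps :: "nat \<Rightarrow> real" where
  "eps k = ln (ln (real k)) powr (-\<beta>)"

text \<open>The local facts about a site on which all witnesses rely. The bound on
  \<open>eps\<close> makes \<delta> = 2 eps an admissible exponent; the bound on \<open>q\<close> is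
  needed next to a site that is to be jumped over.\<close>

definition good :: "nat \<Rightarrow> bool" where
  "good k \<longleftrightarrow> eps k \<le> 1/2 \<and> q k \<le> 1/2 \<and>
     (\<forall>\<delta>. 0 \<le> \<delta> \<longrightarrow> 2 * \<delta> \<le> eps k \<longrightarrow> gen (\<lambda>y. real y powr (-\<delta>)) k \<le> real k powr (-\<delta>)) \<and>
     (\<forall>\<delta>. 2 * eps k \<le> \<delta> \<longrightarrow> \<delta> \<le> 1 \<longrightarrow> real k powr (-\<delta>) \<le> gen (\<lambda>y. real y powr (-\<delta>)) k) \<and>
     gen (\<lambda>y. 1 / ln (real y)) k \<le> 1 / ln (real k)"

lemma eventually_good: "\<forall>\<^sub>F k in sequentially. good k"
proof -
  note ev = eventually_lnln_powr[OF \<beta>] inverse_ln_generator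
  have "\<forall>\<^sub>F x::real in at_top. 3 / ln x \<le> ln (ln x) powr (-\<beta>) \<and> 292 / x \<le> ln (ln x) powr (-\<beta>) \<and>
      ln (ln x) powr (-\<beta>) \<le> 1/2 \<and> 
    (\<forall>\<epsilon> \<ge> 3 / ln x. (1/3 + (1 + \<epsilon>) / (3 * x)) * (1 / ln (x + 2)) +
     (1 - (1/3 + (1 + \<epsilon>) / (3 * x))) * (1 / ln (x - 1)) \<le> 1 / ln x)"
    using ev by eventually_elim blast
  from eventually_compose_filterlim[OF this filterlim_real_sequentially]
  show ?thesis using eventually_ge_at_top[of 4]
  proof eventually_elim
    case (elim k)
    let ?x = "real k"
    have e: "0 \<le> eps k" "3 / ln ?x \<le> eps k" "292 / ?x \<le> eps k" "eps k \<le> 1/2"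
      using elim unfolding eps_def by auto
    have q: "q k = 1/3 + (1 + eps k) / (3 * ?x)" using q_eq elim(2) unfolding eps_def by auto
    have r: "real (k + 2) = ?x + 2" "real (k - 1) = ?x - 1" using elim(2) by auto
    have P: "\<bar>gen (\<lambda>y. real y powr (-\<delta>)) k - ?x powr (-\<delta>) - 
       ?x powr (-\<delta>) * (\<delta> / ?x\<^sup>2) * (\<delta> - eps k)\<bar> \<le> ?x powr (-\<delta>) * (\<delta> / ?x\<^sup>2) * (146 / ?x)"
      if "0 \<le> \<delta>" "\<delta> \<le> 1" for \<delta>
      using powr_generator_expansion[of ?x \<delta> "eps k"] that e elim(2)
      unfolding gen_def q r by simp
    have n: "?x powr (-\<delta>) * (\<delta> / ?x\<^sup>2) \<ge> 0" if "0 \<le> \<delta>" for \<delta> using that by simp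
    have "gen (\<lambda>y. real y powr (-\<delta>)) k \<le> real k powr (-\<delta>)" if "0 \<le> \<delta>" "2 * \<delta> \<le> eps k" for \<delta>
    proof -
      \<comment> \<open>Here \<delta> - eps is at most -eps/2, and 146 / x is at most eps/2.\<close>
      have "?x powr (-\<delta>) * (\<delta> / ?x\<^sup>2) * ((\<delta> - eps k) + 146 / ?x) \<le> 0"
        using that e by (intro mult_nonneg_nonpos n) auto
      then show ?thesis using P[of \<delta>] that e by (simp add: distrib_left)
    qed
    moreover have "real k powr (-\<delta>) \<le> gen (\<lambda>y. real y powr (-\<delta>)) k" if "2 * eps k \<le> \<delta>" "\<delta> \<le> 1" for \<delta>
    proof -
      have "0 \<le> ?x powr (-\<delta>) * (\<delta> / ?x\<^sup>2) * ((\<delta> - eps k) - 146 / ?x)"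
      proof (intro mult_nonneg_nonneg[OF n])
        have "146 / ?x \<le> 292 / ?x" by (intro divide_right_mono) auto
        then show "0 \<le> (\<delta> - eps k) - 146 / ?x" using that e by linarith
      qed (use that e in linarith)
      then show ?thesis using P[of \<delta>] that e by (simp add: right_diff_distrib)
    qed
    moreover have "gen (\<lambda>y. 1 / ln (real y)) k \<le> 1 / ln (real k)"
      using elim(1) e(2) unfolding gen_def q r by blast
    moreover have "q k \<le> 1/2"
    proof -
      have "(1 + eps k) / (3 * ?x) \<le> (1 + 1/2) / (3 * 4)"
        using e elim(2) by (intro frac_le) auto
      then have "(1 + eps k) / (3 * ?x) \<le> 1/8" by simp
      then show ?thesis unfolding q by linarith
    qed
    ultimately show ?case using e unfolding good_def by blast
  qed
qed

text \<open>\<open>SOME\<close> is harmless: such a threshold exists by \<open>eventually_good\<close>.\<close>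

definition K0 :: nat where
  "K0 = (SOME K. K \<ge> 16 \<and> (\<forall>k\<ge>K. good k))"

lemma K0: "K0 \<ge> 16" "k \<ge> K0 \<Longrightarrow> good k"
proof -
  obtain K where "\<forall>k\<ge>K. good k" using eventually_good unfolding eventually_sequentially by blast
  then have "max K 16 \<ge> 16 \<and> (\<forall>k\<ge>max K 16. good k)" by auto
  then have "K0 \<ge> 16 \<and> (\<forall>k\<ge>K0. good k)" unfolding K0_def by (rule someI)
  then show "K0 \<ge> 16" "k \<ge> K0 \<Longrightarrow> good k" by auto
qed

lemma lnln_pos: "k \<ge> 16 \<Longrightarrow> ln (ln (real k)) \<ge> ln 2"
proof -
  assume "k \<ge> 16"
  have "exp (2::real) = exp 1 * exp 1" by (simp add: exp_add[symmetric])
  also have "\<dots> \<le> 3 * 3" using exp_le by (intro mult_mono) auto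
  finally have "exp 2 \<le> real k" using \<open>k \<ge> 16\<close> by simp
  then have "2 \<le> ln (real k)" using \<open>k \<ge> 16\<close> by (simp add: ln_ge_iff)
  then show ?thesis by simp
qed

lemma lnln_pos': "k \<ge> 16 \<Longrightarrow> ln (ln (real k)) > 0"
  using lnln_pos[of k] ln_gt_zero[of "2::real"] by linarith

lemma eps_pos: "k \<ge> 16 \<Longrightarrow> eps k > 0"
  using lnln_pos'[of k] unfolding eps_def by simp

lemma eps_antimono: "16 \<le> k \<Longrightarrow> k \<le> j \<Longrightarrow> eps j \<le> eps k"
  unfolding eps_def using lnln_pos'[of k] \<beta>
  by (intro powr_mono2') auto

text \<open>Squaring adds only ln 2 to ln ln k, hence at most doubles it. Up to a constant,
  \<open>eps\<close> may therefore be frozen on the whole range from k to k^2.\<close>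

lemma eps_square:
  assumes "k \<ge> 16" shows "2 powr (-\<beta>) * eps k \<le> eps (k^2)"
proof -
  have "ln (ln (real (k^2))) = ln 2 + ln (ln (real k))"
    using assms by (simp add: ln_realpow ln_mult)
  also have "\<dots> \<le> 2 * ln (ln (real k))" using lnln_pos[OF assms] by simp
  finally have le: "ln (ln (real (k^2))) \<le> 2 * ln (ln (real k))" .
  have pos: "ln (ln (real (k^2))) > 0" 
    using assms by (intro lnln_pos') (simp add: power2_eq_square, metis le_trans le_square power2_eq_square)
  have "2 powr (-\<beta>) * eps k = (2 * ln (ln (real k))) powr (-\<beta>)"
    unfolding eps_def using lnln_pos'[OF assms] by (simp add: powr_mult)
  also have "\<dots> \<le> eps (k^2)"
    unfolding eps_def using le pos \<beta> by (intro powr_mono2') auto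
  finally show ?thesis .
qed

text \<open>The witness is the affine image of x^(-\<delta>) that is 0 at \<open>k\<close> and 1 at
  \<open>j\<close>. The exponent \<delta> = 2 eps k serves on the whole interval because
  \<open>eps\<close> decreases. The walk may overshoot to \<open>j + 1\<close>, hence the target
  \<open>{j..}\<close>, on which the witness is at least 1.\<close>

lemma reach_le:
  assumes k: "k \<ge> K0" and j: "k < j" and loc: "located m (k + 1) \<Phi>"
  shows "pr (\<lambda>x. \<Phi> x \<and> hit m {k<..<j} {j..} x)
     \<le> (2 * eps k / real k + 1 / (real k * ln (real j / real k))) * pr \<Phi>"
proof -
  note K = K0(1) K0(2)[OF k]
  define \<delta> where "\<delta> = 2 * eps k"
  have \<delta>: "0 < \<delta>" "\<delta> \<le> 1" using eps_pos[of k] K k by (auto simp: \<delta>_def good_def)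
  define D where "D = real k powr (-\<delta>) - real j powr (-\<delta>)"
  have kpos: "real k > 0" using K k by simp
  have D: "D > 0" using j kpos \<delta> powr_less_mono2_neg[of "-\<delta>" "real k" "real j"] by (simp add: D_def)
  define f where "f x = (if x \<le> k then 0 else (real k powr (-\<delta>) - real x powr (-\<delta>)) / D)" for x
  have f0: "f x \<ge> 0" for x
    using D kpos \<delta> powr_mono2'[of "-\<delta>" "real k" "real x"] by (auto simp: f_def)
  have "pr (\<lambda>x. \<Phi> x \<and> hit m {k<..<j} {j..} x) \<le> f (k + 1) * pr \<Phi>"
  proof (rule hit_le[OF f0 _ _ loc])
    fix x assume "x \<in> {j..}"
    then show "1 \<le> f x"
      using D j kpos \<delta> powr_mono2'[of "-\<delta>" "real j" "real x"] by (auto simp: f_def D_def field_simps)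
  next
    fix x assume x: "x \<in> {k<..<j}"
    have "good x" using K0(2) x k by auto
    moreover have "2 * eps x \<le> \<delta>" using eps_antimono[of k x] K k x by (auto simp: \<delta>_def)
    ultimately have "real x powr (-\<delta>) \<le> gen (\<lambda>y. real y powr (-\<delta>)) x"
      using \<delta> unfolding good_def by blast
    then have "real k powr (-\<delta>) / D + (-1/D) * gen (\<lambda>y. real y powr (-\<delta>)) x \<le>
       real k powr (-\<delta>) / D + (-1/D) * real x powr (-\<delta>)"
      using D by (auto simp: field_simps)
    \<comment> \<open>The walk goes down by single steps, so \<open>k\<close> is the only site
      outside the upper region that it can enter, and there the affine expression vanishes like
      \<open>f\<close>.\<close>
    moreover have "gen f x = gen (\<lambda>y. real k powr (-\<delta>) / D + (-1/D) * real y powr (-\<delta>)) x"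
    proof (rule gen_cong)
      show "f (x - 1) = real k powr (-\<delta>) / D + (-1/D) * real (x - 1) powr (-\<delta>)"
        using x by (cases "x - 1 = k") (auto simp: f_def diff_divide_distrib)
    qed (use x in \<open>auto simp: f_def diff_divide_distrib\<close>)
    ultimately show "gen f x \<le> f x" using x unfolding gen_affine by (auto simp: f_def diff_divide_distrib)
  qed
  also have "f (k + 1) \<le> 2 * eps k / real k + 1 / (real k * ln (real j / real k))"
  proof -
    define L where "L = ln (real j / real k)"
    have L: "L > 0" using j kpos by (simp add: L_def)
    have e1: "real k powr (-\<delta>) - real (k+1) powr (-\<delta>) = real k powr (-\<delta>) * (1 - exp (-(\<delta> * ln (1 + 1/real k))))"
    proof -
      have "1 + 1/real k > 0" using kpos by (simp add: add_pos_pos)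
      then have "exp (-(\<delta> * ln (1 + 1/real k))) = (1 + 1/real k) powr (-\<delta>)" by (simp add: powr_def)
      moreover have "real (k+1) = real k * (1 + 1/real k)" using kpos by (simp add: field_simps)
      ultimately show ?thesis using kpos powr_mult[of "real k" "1 + 1/real k" "-\<delta>"] by (simp add: algebra_simps)
    qed
    have e2: "D = real k powr (-\<delta>) * (1 - exp (-(\<delta> * L)))"
    proof -
      have "exp (-(\<delta> * L)) = (real j/real k) powr (-\<delta>)" using kpos j by (simp add: powr_def L_def)
      moreover have "real j = real k * (real j/real k)" using kpos by (simp add: field_simps)
      ultimately show ?thesis using kpos powr_mult[of "real k" "real j/real k" "-\<delta>"] by (simp add: algebra_simps D_def)
    qed
    have "1 - exp (-(\<delta> * ln (1 + 1/real k))) \<le> \<delta> * ln (1 + 1/real k)"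
      using \<delta> kpos by (intro one_minus_powr_bounds mult_nonneg_nonneg) auto
    also have "\<dots> \<le> \<delta> * (1/real k)" using \<delta> kpos by (intro mult_left_mono ln_add_one_self_le_self) auto
    finally have n: "1 - exp (-(\<delta> * ln (1 + 1/real k))) \<le> \<delta> / real k" by simp
    have d: "\<delta> * L / (1 + \<delta> * L) \<le> 1 - exp (-(\<delta> * L))" using \<delta> L by (intro one_minus_powr_bounds) auto
    have "f (k + 1) = (1 - exp (-(\<delta> * ln (1 + 1/real k)))) / (1 - exp (-(\<delta> * L)))"
      unfolding f_def e1 e2 using kpos by simp
    also have "\<dots> \<le> (\<delta> / real k) / (\<delta> * L / (1 + \<delta> * L))"
    proof (rule frac_le[OF _ n _ d])
      show "0 < \<delta> * L / (1 + \<delta> * L)" using \<delta> L by (intro divide_pos_pos mult_pos_pos add_pos_pos) auto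
    qed (use \<delta> kpos in simp)
    also have "\<dots> = 2 * eps k / real k + 1 / (real k * L)"
      using \<delta> L kpos unfolding \<delta>_def[symmetric] by (simp add: field_simps)
    finally show ?thesis unfolding L_def .
  qed
  finally show ?thesis by (simp add: mult_right_mono)
qed

text \<open>Bounded paths are null, so a path that stays above \<open>k\<close> passes every
  \<open>j\<close> first; letting \<open>j\<close> tend to infinity removes the logarithmic term of
  \<open>reach_le\<close>.\<close>

lemma escape_le:
  assumes k: "k \<ge> K0" and loc: "located m (k + 1) \<Phi>"
  shows "pr (\<lambda>x. \<Phi> x \<and> (\<forall>i\<ge>m. x i > k)) \<le> 2 * eps k / real k * pr \<Phi>"
proof -
  have kpos: "real k > 0" using K0(1) k by simp
  note ev = ev_adapted[OF located_adapted[OF loc]]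
  have "pr (\<lambda>x. \<Phi> x \<and> (\<forall>i\<ge>m. x i > k)) \<le>
     (2 * eps k / real k + 1 / (real k * ln (real j / real k))) * pr \<Phi>" if j: "j > k" for j
  proof -
    have "pr (\<lambda>x. \<Phi> x \<and> (\<forall>i\<ge>m. x i > k)) \<le>
        pr (\<lambda>x. (\<Phi> x \<and> hit m {k<..<j} {j..} x) \<or> (\<forall>i\<ge>m. x i < j))"
    proof (rule pr_mono)
      fix x assume x: "\<Phi> x \<and> (\<forall>i\<ge>m. x i > k)"
      show "(\<Phi> x \<and> hit m {k<..<j} {j..} x) \<or> (\<forall>i\<ge>m. x i < j)"
      proof (cases "\<forall>i\<ge>m. x i < j")
        case False
        define n where "n = (LEAST n. m \<le> n \<and> x n \<ge> j)"
        have "m \<le> n \<and> x n \<ge> j" unfolding n_def by (rule LeastI_ex) (use False in force)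
        moreover have "x i < j" if "m \<le> i" "i < n" for i
          using not_less_Least[OF that(2)[unfolded n_def]] that(1) by auto
        ultimately have "hit m {k<..<j} {j..} x" unfolding hit_def using x by (intro exI[of _ n]) auto
        with x show ?thesis by blast
      qed simp
    qed (intro ev_intros ev ev_hit)
    also have "\<dots> \<le> pr (\<lambda>x. \<Phi> x \<and> hit m {k<..<j} {j..} x) + pr (\<lambda>x. \<forall>i\<ge>m. x i < j)"
      by (rule pr_disj_le; intro ev_intros ev ev_hit)
    finally show ?thesis using reach_le[OF k j loc] pr_bounded_0[of m j] by simp
  qed
  then have "\<forall>\<^sub>F j in sequentially. pr (\<lambda>x. \<Phi> x \<and> (\<forall>i\<ge>m. x i > k)) \<le>
     (2 * eps k / real k + 1 / (real k * ln (real j / real k))) * pr \<Phi>"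
    by (rule eventually_mono[OF eventually_gt_at_top[of k]])
  moreover have "(\<lambda>j. 1 / (real k * ln (real j / real k))) \<longlonglongrightarrow> 0"
    using kpos by real_asymp
  then have "(\<lambda>j. (2 * eps k / real k + 1 / (real k * ln (real j / real k))) * pr \<Phi>)
     \<longlonglongrightarrow> (2 * eps k / real k + 0) * pr \<Phi>" by (intro tendsto_intros)
  ultimately show ?thesis using tendsto_lowerbound[of _ _ sequentially] by fastforce
qed

text \<open>A superharmonic \<open>h\<close> with value 1 at \<open>k\<close> bounds the return
  probability, and 1 - h (k + 1) is of order \<delta> / k. The 40 collects 5 from the weight 1/5, 4
  from the elementary estimates and 2 from \<delta> = eps (k^2) / 2.\<close>

lemma escape_ge:
  assumes k: "k \<ge> K0" and loc: "located m (k + 1) \<Phi>"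
  shows "2 powr (-\<beta>) / 40 * (eps k / real k) * pr \<Phi> \<le> pr (\<lambda>x. \<Phi> x \<and> (\<forall>i\<ge>m. x i > k))"
proof -
  note K = K0(1) K0(2)[OF k]
  have kpos: "real k > 0" and k16: "k \<ge> 16" using K k by auto
  define \<delta> where "\<delta> = eps (k^2) / 2"
  have kk: "k \<le> k^2" by (simp add: power2_eq_square)
  then have k2: "k^2 \<ge> 16" using k16 by linarith
  have \<delta>: "0 < \<delta>" "\<delta> \<le> 1" "2 * \<delta> \<le> eps k"
    using eps_pos[OF k2] eps_antimono[OF k16 kk] K by (auto simp: \<delta>_def good_def)
  \<comment> \<open>\<open>h1\<close> is superharmonic only up to \<open>k\<^sup>2\<close>, because \<open>eps\<close> decreases; beyond that \<open>h2\<close> is the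
    smaller of the two, and \<open>h2\<close> is superharmonic everywhere.\<close>
  define h1 where "h1 x = 4/5 + 1/5 * real k powr \<delta> * real x powr (-\<delta>)" for x
  define h2 where "h2 x = 0 + 3/2 * ln (real k) * (1 / ln (real x))" for x
  \<comment> \<open>At \<open>k\<close> the minimum is h1 = 1 against h2 = 3/2; beyond k^2 it is h2,
    at most 3/4, against h1, at least 4/5. The constants are chosen for this change-over.\<close>
  define h where "h x = min (h1 x) (h2 x)" for x
  define f where "f x = (if x \<le> k then 0 else 1 - h x)" for x
  have lnk: "ln (real k) > 0" using k16 by simp
  have hk: "h k = 1" using lnk kpos by (simp add: h_def h1_def h2_def powr_minus)
  have h1: "4/5 \<le> h1 x" for x by (simp add: h1_def)
  have gh1: "gen h1 x \<le> h1 x" if "good x" "2 * \<delta> \<le> eps x" for x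
  proof -
    have "gen (\<lambda>y. real y powr (-\<delta>)) x \<le> real x powr (-\<delta>)"
      using that \<delta> unfolding good_def by auto
    then show ?thesis unfolding h1_def[abs_def] gen_affine by (intro add_left_mono mult_left_mono) auto
  qed
  have gh2: "gen h2 x \<le> h2 x" if "good x" for x
    using that lnk unfolding h2_def[abs_def] gen_affine good_def by (intro add_left_mono mult_left_mono) auto
  have gh: "gen h x \<le> h x" if x: "x > k" for x
  proof -
    have gx: "good x" using K0(2) x k by auto
    have g1: "gen h x \<le> gen h1 x" "gen h x \<le> gen h2 x" by (rule gen_mono; simp add: h_def)+
    show ?thesis
    proof (cases "x \<le> k^2")
      case True
      have "2 * \<delta> \<le> eps x" using eps_antimono[of x "k^2"] x k16 True by (simp add: \<delta>_def)
      from g1 gh1[OF gx this] gh2[OF gx] show ?thesis unfolding h_def by linarith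
    next
      case False
      have "2 * ln (real k) = ln (real (k^2))" using kpos by (simp add: ln_realpow)
      also have "\<dots> \<le> ln (real x)" using False kpos by (subst ln_le_cancel_iff) (auto simp del: of_nat_power)
      finally have "2 * ln (real k) \<le> ln (real x)" .
      then have "h2 x \<le> 3/4" using lnk by (simp add: h2_def field_simps)
      then have "h x = h2 x" using h1[of x] by (simp add: h_def)
      with g1 gh2[OF gx] show ?thesis by linarith
    qed
  qed
  have "f (k + 1) * pr \<Phi> \<le> pr (\<lambda>x. \<Phi> x \<and> (\<forall>i\<ge>m. x i \<in> {k<..}))"
  proof (rule stay_ge[OF _ _ _ loc])
    fix x assume x: "x \<in> {k<..}"
    have "h2 x \<ge> 0" using lnk x by (auto simp: h2_def)
    then have "h x \<ge> 0" using h1[of x] by (simp add: h_def)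
    then show "f x \<le> 1" by (simp add: f_def)
    \<comment> \<open>The truncated \<open>f\<close> agrees with 1 - h at \<open>k\<close> because
      \<open>h k = 1\<close>.\<close>
    have "gen f x = gen (\<lambda>y. 1 + (-1) * h y) x"
    proof (rule gen_cong)
      show "f (x - 1) = 1 + (-1) * h (x - 1)" using hk x by (cases "x - 1 = k") (auto simp: f_def)
    qed (use x in \<open>simp add: f_def\<close>)
    also have "\<dots> = 1 + (-1) * gen h x" by (rule gen_affine)
    finally show "f x \<le> gen f x" using gh x by (auto simp: f_def)
  qed (auto simp: f_def)
  moreover have "2 powr (-\<beta>) / 40 * (eps k / real k) \<le> f (k + 1)"
  proof -
    define y where "y = \<delta> * ln (1 + 1/real k)"
    have u: "1/real k - (1/real k)^2 \<le> ln (1 + 1/real k)" "ln (1 + 1/real k) \<le> 1/real k"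
      using kpos k16 ln_one_plus_pos_lower_bound[of "1/real k"] ln_add_one_self_le_self[of "1/real k"] by auto
    have "1/real k * (1/2) \<le> 1/real k * (1 - 1/real k)" using k16 by (intro mult_left_mono) (auto simp: field_simps)
    also have "\<dots> = 1/real k - (1/real k)^2" by (simp add: power2_eq_square algebra_simps)
    finally have u1: "1/real k / 2 \<le> ln (1 + 1/real k)" using u by linarith
    have y1: "\<delta> / (2 * real k) \<le> y" using mult_left_mono[OF u1, of \<delta>] \<delta> by (simp add: y_def)
    have "ln (1 + 1/real k) \<le> 1" using u k16 by (auto intro!: order_trans[OF u(2)])
    then have y2: "y \<le> 1" using mult_mono[of \<delta> 1 "ln (1 + 1/real k)" 1] \<delta> kpos by (simp add: y_def)
    have y0: "y \<ge> 0" using \<delta> kpos by (simp add: y_def)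
    have "\<delta> / (4 * real k) \<le> y / 2" using y1 by simp
    also have "\<dots> \<le> y / (1 + y)" using y0 y2 by (intro divide_left_mono) auto
    also have "\<dots> \<le> 1 - exp (-y)" by (rule one_minus_powr_bounds[OF y0])
    also have "exp (-y) = real k powr \<delta> * real (k+1) powr (-\<delta>)"
    proof -
      have "1 + 1/real k > 0" using kpos by (simp add: add_pos_pos)
      then have "exp (-y) = (1 + 1/real k) powr (-\<delta>)" by (simp add: powr_def y_def)
      moreover have "real (k+1) = real k * (1 + 1/real k)" using kpos by (simp add: field_simps)
      ultimately show ?thesis using kpos powr_mult[of "real k" "1 + 1/real k" "-\<delta>"]
        by (simp add: powr_add[symmetric] mult.assoc[symmetric])
    qed
    finally have "1/5 * (\<delta> / (4 * real k)) \<le> 1 - h1 (k + 1)" by (simp add: h1_def)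
    moreover have "2 powr (-\<beta>) / 40 * (eps k / real k) \<le> 1/5 * (\<delta> / (4 * real k))"
    proof -
      have "2 powr (-\<beta>) * eps k / (40 * real k) \<le> eps (k^2) / (40 * real k)"
        using kpos by (intro divide_right_mono eps_square[OF k16]) auto
      then show ?thesis by (simp add: \<delta>_def mult.commute)
    qed
    ultimately show ?thesis by (simp add: f_def h_def)
  qed
  then have "2 powr (-\<beta>) / 40 * (eps k / real k) * pr \<Phi> \<le> f (k + 1) * pr \<Phi>"
    by (intro mult_right_mono) auto
  ultimately show ?thesis by simp
qed

section \<open>Jumping over a site at first passage\<close>

lemma jump_ge:
  assumes k: "k \<ge> K0 + 4" and a: "a < k" and loc: "located m a \<Phi>"
  shows "1/13 * pr \<Phi> \<le> pr (\<lambda>x. \<Phi> x \<and> hit m {..<k} {k + 1} x)"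
proof -
  \<comment> \<open>With 1/13 far below, q = 1/3 gives 1/3 + 2/3 * 1/13 = 5/13 at
    \<open>k - 1\<close>. From \<open>k - 2\<close> the upward step lands on \<open>k\<close>, where
    \<open>g\<close> is 0, and q may be as large as 1/2; so \<open>k - 3\<close> needs twice 1/13,
    which the value at \<open>k - 1\<close> supports.\<close>
  define g :: "nat \<Rightarrow> real" where
    "g x = (if x = k + 1 then 1 else if x \<ge> k then 0 else if x = k - 1 then 5/13
       else if x = k - 3 then 2/13 else 1/13)" for x
  have k16: "k \<ge> 16" using k K0(1) by simp
  have "g a * pr \<Phi> \<le> pr (\<lambda>x. \<Phi> x \<and> hit m {..<k} {k + 1} x)"
  proof (rule hit_ge[OF _ _ _ _ loc])
    fix x assume x: "x \<in> {..<k}"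
    have qx: "1/3 \<le> q x" "q x \<le> 1" using q_ge q_le by auto
    have q13: "(1 - q x) * (1/13) = 1/13 - q x / 13" "(1 - q x) * (2/13) = 2/13 - q x * 2/13"
      by (simp_all add: diff_divide_distrib left_diff_distrib)
    have g: "g (k + 1) = 1" "g k = 0" "g (k - 1) = 5/13" "g (k - 2) = 1/13" "g (k - 3) = 2/13" "g (k - 4) = 1/13"
      using k16 by (auto simp: g_def)
    consider "x = k - 1" | "x = k - 2" | "x = k - 3" | "x + 3 < k" using x by force
    then show "g x \<le> gen g x"
    proof cases
      case 1
      then have e: "x + 2 = k + 1" "x - 1 = k - 2" using k16 by auto
      have "5/13 \<le> q x * 1 + (1 - q x) * (1/13)" unfolding q13 using qx by simp
      then show ?thesis unfolding gen_def e unfolding 1 g .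
    next
      case 2
      then have e: "x + 2 = k" "x - 1 = k - 3" using k16 by auto
      have "q x \<le> 1/2" using K0(2)[of x] k 2 by (auto simp: good_def)
      then have "1/13 \<le> q x * 0 + (1 - q x) * (2/13)" unfolding q13 by simp
      then show ?thesis unfolding gen_def e unfolding 2 g .
    next
      case 3
      then have e: "x + 2 = k - 1" "x - 1 = k - 4" using k16 by auto
      have "2/13 \<le> q x * (5/13) + (1 - q x) * (1/13)" unfolding q13 using qx by simp
      then show ?thesis unfolding gen_def e unfolding 3 g .
    next
      case 4
      then have "g (x + 2) \<ge> 1/13" "g (x - 1) \<ge> 1/13" "g x = 1/13"
        unfolding g_def by auto
      then have "q x * (1/13) + (1 - q x) * (1/13) \<le> gen g x" 
        unfolding gen_def using qx by (intro add_mono mult_left_mono) auto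
      then show ?thesis using \<open>g x = 1/13\<close> unfolding q13 by simp
    qed
  qed (auto simp: g_def)
  moreover have "1/13 \<le> g a" using a by (auto simp: g_def)
  then have "1/13 * pr \<Phi> \<le> g a * pr \<Phi>" by (intro mult_right_mono) auto
  ultimately show ?thesis by linarith
qed

text \<open>The witness is linear away from \<open>j\<close>; it has to vanish at \<open>j\<close>, and its
  values next to \<open>j\<close> are raised to keep it subharmonic there.\<close>

lemma jump_above_ge:
  assumes k: "k \<ge> K0" and j: "j \<ge> k + 8" and loc: "located m (k + 1) \<Phi>"
  shows "1 / (13 * (real j - real k)) * pr \<Phi> \<le> pr (\<lambda>x. \<Phi> x \<and> hit m {k<..<j} {j + 1} x)"
proof -
  define J where "J = real j - real k"
  have J: "J \<ge> 8" using j by (simp add: J_def)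
  \<comment> \<open>The profile of \<open>jump_ge\<close> times 13 J, with the constant far value
    replaced by the linear function x - k, which is subharmonic because the drift 3 q - 1 is
    non-negative and which vanishes at \<open>k\<close>.\<close>
  define g :: "nat \<Rightarrow> real" where
    "g x = (if x = j + 1 then 13 * J else if x \<ge> j \<or> x \<le> k then 0 else if x = j - 1 then 5 * J
       else if x = j - 2 then J else if x = j - 3 then 2 * J else real x - real k)" for x
  define f where "f x = 0 + 1 / (13 * J) * g x" for x
  have "f (k + 1) * pr \<Phi> \<le> pr (\<lambda>x. \<Phi> x \<and> hit m {k<..<j} {j + 1} x)"
  proof (rule hit_ge[OF _ _ _ _ loc])
    fix x assume x: "x \<in> {k<..<j}"
    have qx: "1/3 \<le> q x" "q x \<le> 1/2" using q_ge K0(2)[of x] k x by (auto simp: good_def)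
    have gl: "g y = real y - real k" if "k \<le> y" "y + 3 < j" for y using that by (auto simp: g_def)
    have g: "g (j + 1) = 13 * J" "g j = 0" "g (j - 1) = 5 * J" "g (j - 2) = J" "g (j - 3) = 2 * J"
        "g (j - 4) = J - 4" "g (j - 5) = J - 5" "g (j - 6) = J - 6"
    proof -
      obtain i where i: "j = k + 8 + i" using j le_Suc_ex by blast
      show "g (j + 1) = 13 * J" "g j = 0" "g (j - 1) = 5 * J" "g (j - 2) = J" "g (j - 3) = 2 * J"
        "g (j - 4) = J - 4" "g (j - 5) = J - 5" "g (j - 6) = J - 6"
        unfolding g_def J_def i by simp_all
    qed
    consider "x = j - 1" | "x = j - 2" | "x = j - 3" | "x = j - 4" | "x = j - 5" | "x + 5 < j" using x by force
    then have "g x \<le> gen g x"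
    proof cases
      case 1
      then have e: "x + 2 = j + 1" "x - 1 = j - 2" using j by auto
      have "4 * J \<le> 12 * J * q x" using mult_left_mono[OF qx(1), of "12 * J"] J by simp
      then have "5 * J \<le> q x * (13 * J) + (1 - q x) * J" by (simp add: algebra_simps)
      then show ?thesis unfolding gen_def e unfolding 1 g .
    next
      case 2
      then have e: "x + 2 = j" "x - 1 = j - 3" using j by auto
      have "J * q x \<le> J * (1/2)" using qx J by (intro mult_left_mono) auto
      then have "J \<le> q x * 0 + (1 - q x) * (2 * J)" by (simp add: algebra_simps)
      then show ?thesis unfolding gen_def e unfolding 2 g .
    next
      case 3
      then have e: "x + 2 = j - 1" "x - 1 = j - 4" using j by auto
      have "(4 * J + 4) * (1/3) \<le> (4 * J + 4) * q x" using qx J by (intro mult_left_mono) auto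
      then have "2 * J \<le> q x * (5 * J) + (1 - q x) * (J - 4)" using J by (simp add: algebra_simps)
      then show ?thesis unfolding gen_def e unfolding 3 g .
    next
      case 4
      then have e: "x + 2 = j - 2" "x - 1 = j - 5" using j by auto
      have "J - 4 \<le> q x * J + (1 - q x) * (J - 5)" using J qx by (simp add: algebra_simps)
      then show ?thesis unfolding gen_def e unfolding 4 g .
    next
      case 5
      then have e: "x + 2 = j - 3" "x - 1 = j - 6" using j by auto
      have "(J + 6) * (1/3) \<le> (J + 6) * q x" using qx J by (intro mult_left_mono) auto
      then have "J - 5 \<le> q x * (2 * J) + (1 - q x) * (J - 6)" using J by (simp add: algebra_simps)
      then show ?thesis unfolding gen_def e unfolding 5 g .
    next
      case 6
      have "g (x - 1) = real x - 1 - real k" "g x = real x - real k" "g (x + 2) = real x + 2 - real k"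
        using gl[of "x - 1"] gl[of x] gl[of "x + 2"] 6 x by auto
      then have "gen g x = g x + (3 * q x - 1)" unfolding gen_def by (simp only:) (simp add: algebra_simps)
      then show ?thesis using qx by linarith
    qed
    then show "f x \<le> gen f x" using J unfolding f_def[abs_def] gen_affine by (intro add_left_mono mult_left_mono) auto
  qed (use J in \<open>auto simp: f_def g_def\<close>)
  moreover have "f (k + 1) = 1 / (13 * J)"
  proof -
    have "k + 1 \<noteq> j - 1" "k + 1 \<noteq> j - 2" "k + 1 \<noteq> j - 3" using j by arith+
    then show ?thesis using j by (simp add: f_def g_def)
  qed
  ultimately show ?thesis unfolding J_def by simp
qed

end

section \<open>Logarithmic sums\<close>

lemma summable_inverse_ln_powr:
  assumes "\<beta> > 1"
  shows "summable (\<lambda>n. 1 / (real n * ln (real n) powr \<beta>))"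
proof -
  \<comment> \<open>At n = 1 the series has the term 1/0 = 0, which would spoil the monotonicity
    required by condensation.\<close>
  define f where "f n = (if n < 2 then 1 / ln 2 powr \<beta> else 1 / (real n * ln (real n) powr \<beta>))" for n :: nat
  have l2: "ln 2 > (0::real)" by simp
  have "summable f \<longleftrightarrow> summable (\<lambda>n. 2^n * f (2^n))"
  proof (rule condensation_test)
    fix m :: nat assume "0 < m"
    show "f (Suc m) \<le> f m"
    proof (cases "m < 2")
      case True
      with \<open>0 < m\<close> have [simp]: "m = 1" by simp
      show ?thesis using l2 by (simp add: f_def field_simps)
    next
      case False
      then have "real m * ln (real m) powr \<beta> \<le> real (Suc m) * ln (real (Suc m)) powr \<beta>"
        using assms by (intro mult_mono powr_mono2) auto
      moreover have "0 < real m * ln (real m) powr \<beta>" using False by simp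
      ultimately show ?thesis using False by (auto simp: f_def intro!: divide_left_mono)
    qed
  qed (auto simp: f_def)
  moreover have "summable (\<lambda>n. 2^n * f (2^n))"
  proof -
    have "summable (\<lambda>n. ln 2 powr (-\<beta>) * real n powr (-\<beta>))"
      using assms by (intro summable_mult) (simp add: summable_real_powr_iff)
    moreover have "\<forall>\<^sub>F n in sequentially. ln 2 powr (-\<beta>) * real n powr (-\<beta>) = 2^n * f (2^n)"
      using eventually_ge_at_top[of 1]
    proof eventually_elim
      case (elim n)
      have "\<not> (2::nat)^n < 2" using elim power_increasing[of 1 n "2::nat"] by simp
      moreover have "ln ((2::real)^n) = real n * ln 2" by (simp add: ln_realpow)
      ultimately show ?case using l2
        by (simp add: f_def powr_mult powr_minus field_simps)
    qed
    ultimately show ?thesis using summable_cong by fast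
  qed
  ultimately have "summable f" by simp
  moreover have "\<forall>\<^sub>F n in sequentially. f n = 1 / (real n * ln (real n) powr \<beta>)"
    using eventually_ge_at_top[of 2] by eventually_elim (auto simp: f_def)
  ultimately show ?thesis using summable_cong by fast
qed

text \<open>Split at k^2. Below it, ln (j / k) is at least (j - k) / j, and the resulting harmonic
  sum of order ln k is cancelled by 1 / ln j; above it, ln (j / k) is at least half of ln j, and the
  sum of 1 / (j ln^2 j) converges.\<close>

lemma sum_inverse_ln_ratio_bounded:
  "\<exists>C>0. \<forall>k\<ge>3. \<forall>N. (\<Sum>j\<in>{k<..N}. 1 / (real j * ln (real j) * ln (real j / real k))) \<le> C"
proof -
  define S where "S = (\<Sum>n. 1 / (real n * ln (real n) powr 2))"
  have sm: "summable (\<lambda>n. 1 / (real n * ln (real n) powr 2))" by (rule summable_inverse_ln_powr) simp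
  have "(\<Sum>j\<in>{k<..N}. 1 / (real j * ln (real j) * ln (real j / real k))) \<le> 3 + 2 * S" if k: "k \<ge> 3" for k N
  proof -
    define t where "t j = 1 / (real j * ln (real j) * ln (real j / real k))" for j
    have e: "exp 1 \<le> real k" using exp_le k by linarith
    then have lnk: "ln (real k) \<ge> 1" using k by (subst ln_ge_iff) auto
    have t0: "t j \<ge> 0" if "j > k" for j using that k by (auto simp: t_def)
    have t1: "t j \<le> 1 / ln (real k) * (1 / real (j - k))" if j: "j > k" for j
    proof -
      have "ln (real k / real j) \<le> real k / real j - 1" using j k by (intro ln_le_minus_one) auto
      then have "(real j - real k) / real j \<le> ln (real j / real k)"
        using j k by (simp add: ln_div field_simps)
      then have "real j * ((real j - real k) / real j) \<le> real j * ln (real j / real k)"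
        by (intro mult_left_mono) auto
      then have "real (j - k) \<le> real j * ln (real j / real k)" using j by (simp add: of_nat_diff)
      then have "ln (real k) * real (j - k) \<le> ln (real j) * (real j * ln (real j / real k))"
        using j k by (intro mult_mono) auto
      then have "t j \<le> 1 / (ln (real k) * real (j - k))"
        unfolding t_def using j lnk by (intro frac_le) (auto simp: mult_ac)
      then show ?thesis by simp
    qed
    have t2: "t j \<le> 2 * (1 / (real j * ln (real j) powr 2))" if j: "j > k^2" for j
    proof -
      have "k \<le> k^2" by (simp add: power2_eq_square)
      then have jk: "j > k" using j by linarith
      have "real (k^2) \<le> real j" using j by (subst of_nat_le_iff) auto
      then have "ln (real (k^2)) \<le> ln (real j)" using k jk by (subst ln_le_cancel_iff) (auto simp del: of_nat_power)
      then have "2 * ln (real k) \<le> ln (real j)" using k by (simp add: ln_realpow)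
      then have l: "ln (real j) / 2 \<le> ln (real j / real k)" using k jk by (simp add: ln_div)
      have lj: "ln (real j) > 0" using k jk by simp
      have "t j \<le> 1 / (real j * ln (real j) * (ln (real j) / 2))"
        unfolding t_def using l lj jk k by (intro divide_left_mono mult_left_mono mult_pos_pos) auto
      also have "\<dots> = 2 * (1 / (real j * ln (real j) powr 2))" using lj by (simp add: powr_numeral power2_eq_square)
      finally show ?thesis .
    qed
    have kk: "k \<le> k^2" by (simp add: power2_eq_square)
    have "(\<Sum>j\<in>{k<..N}. t j) \<le> (\<Sum>j\<in>{k<..k^2} \<union> {k^2<..N}. t j)"
      by (rule sum_mono2) (use t0 kk in auto)
    also have "\<dots> \<le> (\<Sum>j\<in>{k<..k^2}. t j) + (\<Sum>j\<in>{k^2<..N}. t j)"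
      by (subst sum.union_disjoint) auto
    also have "(\<Sum>j\<in>{k<..k^2}. t j) \<le> 3"
    proof -
      have "(\<Sum>j\<in>{k<..k^2}. t j) \<le> (\<Sum>j\<in>{k<..k^2}. 1 / ln (real k) * (1 / real (j - k)))"
        by (intro sum_mono t1) auto
      also have "\<dots> = 1 / ln (real k) * (\<Sum>j\<in>{k<..k^2}. inverse (real (j - k)))"
        by (simp add: sum_distrib_left inverse_eq_divide)
      also have "(\<Sum>j\<in>{k<..k^2}. inverse (real (j - k))) = (\<Sum>d=1..k^2 - k. inverse (real d))"
        by (rule sum.reindex_bij_witness[of _ "\<lambda>d. d + k" "\<lambda>j. j - k"]) auto
      also have "\<dots> = harm (k^2 - k)" by (simp add: harm_def)
      finally have 1: "(\<Sum>j\<in>{k<..k^2}. t j) \<le> 1 / ln (real k) * harm (k^2 - k)" .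
      have "harm (k^2 - k) \<le> (harm (k^2) :: real)" by (rule harm_mono) auto
      also have "harm (k^2) \<le> 1 + ln (real (k^2))"
        using decseqD[OF decseq_harm_diff_ln, of 0 "k^2 - 1"] k by (simp add: harm_expand)
      also have "\<dots> \<le> 3 * ln (real k)" using lnk k by (simp add: ln_realpow)
      finally have "1 / ln (real k) * harm (k^2 - k) \<le> 1 / ln (real k) * (3 * ln (real k))"
        using lnk by (intro mult_left_mono) auto
      with 1 show ?thesis using lnk by simp
    qed
    also have "(\<Sum>j\<in>{k^2<..N}. t j) \<le> 2 * S"
    proof -
      have "(\<Sum>j\<in>{k^2<..N}. t j) \<le> (\<Sum>j\<in>{k^2<..N}. 2 * (1 / (real j * ln (real j) powr 2)))"
        by (intro sum_mono t2) auto
      also have "\<dots> \<le> 2 * S"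
        unfolding sum_distrib_left[symmetric] S_def
        by (intro mult_left_mono sum_le_suminf sm) auto
      finally show ?thesis .
    qed
    finally show ?thesis unfolding t_def by simp
  qed
  moreover have "S \<ge> 0" unfolding S_def by (intro suminf_nonneg sm) auto
  ultimately show ?thesis by (intro exI[of _ "3 + 2 * S"]) auto
qed

text \<open>Comparison with the primitive ln ln ln: three uses of ln y - ln x \<le> (y - x) / x
  bound its increments by the terms.\<close>

lemma sum_inverse_ln_lnln_unbounded:
  "\<exists>N. (\<Sum>j\<in>{K<..N}. 1 / (real j * ln (real j) * ln (ln (real j)))) \<ge> 1" if K: "K \<ge> 16" for K :: nat
proof -
  define f where "f x = ln (ln (ln x))" for x :: real
  have lim: "filterlim (\<lambda>N. f (real N + 1)) at_top sequentially" unfolding f_def by real_asymp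
  have pos: "0 < ln (ln (real j)) \<and> 1 < ln (real j)" if "j \<ge> 16" for j
  proof -
    have "exp (1::real) < 16" using exp_le by linarith
    then have "ln (exp 1) < ln (real j)" using that by (subst ln_less_cancel_iff) auto
    then have "1 < ln (real j)" by simp
    then show ?thesis by (simp add: ln_gt_zero)
  qed
  have telescope: "f (real j + 1) - f (real j) \<le> 1 / (real j * ln (real j) * ln (ln (real j)))" if j: "j \<ge> 16" for j
  proof -
    define a b where "a = real j" and "b = real j + 1"
    have p: "0 < a" "a < b" "1 < ln a" "0 < ln (ln a)" using j pos[OF j] ln_gt_zero by (auto simp: a_def b_def)
    have p2: "ln a < ln b" using p by simp
    have "0 < ln a" "0 < ln b" using p p2 by linarith+
    then have p3: "ln (ln a) < ln (ln b)" using p2 by (subst ln_less_cancel_iff)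
    have d: "ln y - ln x \<le> (y - x) / x" if "0 < x" "x \<le> y" for x y :: real
      using ln_le_minus_one[of "y/x"] that by (simp add: ln_div field_simps)
    have "f b - f a \<le> (ln (ln b) - ln (ln a)) / ln (ln a)" unfolding f_def using p p3 by (intro d) linarith+
    also have "\<dots> \<le> ((ln b - ln a) / ln a) / ln (ln a)" using p p2 by (intro divide_right_mono d) linarith+
    also have "\<dots> \<le> (((b - a) / a) / ln a) / ln (ln a)" using p by (intro divide_right_mono d) linarith+
    also have "\<dots> = 1 / (a * ln a * ln (ln a))" by (simp add: b_def a_def)
    finally show ?thesis by (simp add: a_def b_def)
  qed
  have "f (real N + 1) - f (real K + 1) \<le> (\<Sum>j\<in>{K<..N}. 1 / (real j * ln (real j) * ln (ln (real j))))"
    if "N \<ge> K" for N using that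
  proof (induction N rule: dec_induct)
    case (step n)
    have "{K<..Suc n} = insert (Suc n) {K<..n}" using step by auto
    then show ?case using step.IH telescope[of "Suc n"] step.hyps K by (simp add: add_ac)
  qed simp
  moreover obtain N where "N \<ge> K" "f (real N + 1) \<ge> 1 + f (real K + 1)"
    using lim[unfolded filterlim_at_top, rule_format, of "1 + f (real K + 1)"] eventually_ge_at_top[of K]
    by (metis (mono_tags, lifting) eventually_conj eventually_sequentially order_refl)
  ultimately show ?thesis by (intro exI[of _ N]) fastforce
qed

section \<open>Skipped points\<close>

text \<open>\<open>n\<close> is the time of first passage to level \<open>k\<close> or above, and
  the passage overshoots \<open>k\<close>. Hence \<open>n\<close> is determined by the path.\<close>

definition jump :: "nat \<Rightarrow> nat \<Rightarrow> (nat \<Rightarrow> nat) \<Rightarrow> bool" where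
  "jump k n x \<longleftrightarrow> (\<forall>i<n. x i < k) \<and> x n = k + 1"

text \<open>\<open>skips\<close> implies \<open>skipped_point\<close> on every path. The converse
  holds for \<open>k \<ge> 1\<close> on valid paths that get as high as \<open>k\<close>.\<close>

definition skips :: "nat \<Rightarrow> (nat \<Rightarrow> nat) \<Rightarrow> bool" where
  "skips k x \<longleftrightarrow> (\<exists>n. jump k n x \<and> (\<forall>i\<ge>n. x i > k))"

text \<open>First passage over \<open>k\<close> together with any information available at that
  time. Summing over \<open>n\<close> stands in for the strong Markov property.\<close>

definition jump_family :: "nat \<Rightarrow> (nat \<Rightarrow> (nat \<Rightarrow> nat) \<Rightarrow> bool) \<Rightarrow> bool" where
  "jump_family k \<Psi> \<longleftrightarrow> (\<forall>n. adapted n (\<Psi> n) \<and> (\<forall>x. \<Psi> n x \<longrightarrow> jump k n x))"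

text \<open>Paths of the family that go on to jump over \<open>j\<close> before returning to
  \<open>k\<close>. They form a jump family at \<open>j\<close>, so the estimates can be
  chained.\<close>

definition cross :: "nat \<Rightarrow> (nat \<Rightarrow> (nat \<Rightarrow> nat) \<Rightarrow> bool) \<Rightarrow> nat \<Rightarrow> nat \<Rightarrow> (nat \<Rightarrow> nat) \<Rightarrow> bool" where
  "cross k \<Psi> j n' x \<longleftrightarrow> jump j n' x \<and> (\<exists>n<n'. \<Psi> n x \<and> (\<forall>i. n \<le> i \<and> i < n' \<longrightarrow> x i \<in> {k<..<j}))"

lemma jump_unique: "jump k m x \<Longrightarrow> jump k n x \<Longrightarrow> m = n"
  unfolding jump_def by (metis add_lessD1 less_irrefl linorder_neqE_nat)

lemma adapted_jump: "adapted n (jump k n)"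
  unfolding jump_def by (rule adaptedI) auto

lemma skips_imp_skipped_point: "skips k x \<Longrightarrow> skipped_point x k"
proof -
  assume "skips k x"
  then obtain n where n: "\<forall>i<n. x i < k" "\<forall>i\<ge>n. x i > k" unfolding skips_def jump_def by blast
  have "x i \<noteq> k" for i using n by (metis less_irrefl not_le)
  then show ?thesis unfolding skipped_point_def by blast
qed

lemma jump_familyD:
  assumes "jump_family k \<Psi>"
  shows "adapted n (\<Psi> n)" "\<Psi> n x \<Longrightarrow> jump k n x" "located n (k + 1) (\<Psi> n)"
    "\<Psi> m x \<Longrightarrow> \<Psi> n x \<Longrightarrow> m = n"
  using assms jump_unique unfolding jump_family_def located_def jump_def by blast+

lemma jump_family_cross:
  assumes "jump_family k \<Psi>"
  shows "jump_family j (cross k \<Psi> j)"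
  unfolding jump_family_def
proof (intro allI conjI impI)
  fix n' show "adapted n' (cross k \<Psi> j n')"
  proof (rule adaptedI)
    fix x y :: "nat \<Rightarrow> nat" assume eq: "\<And>i. i \<le> n' \<Longrightarrow> x i = y i" and x: "cross k \<Psi> j n' x"
    then obtain n where n: "jump j n' x" "n < n'" "\<Psi> n x" "\<forall>i. n \<le> i \<and> i < n' \<longrightarrow> x i \<in> {k<..<j}"
      unfolding cross_def by blast
    have "jump j n' y" using adaptedD[OF adapted_jump, of n' x y j] eq n by simp
    moreover have "\<Psi> n y" using adaptedD[OF jump_familyD(1)[OF assms], of n x y] eq n by simp
    ultimately show "cross k \<Psi> j n' y" unfolding cross_def using n eq by (intro conjI exI[of _ n]) auto
  qed
qed (auto simp: cross_def)

lemma cross_of_hit: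
  assumes fam: "jump_family k \<Psi>" and kj: "k < j" and \<Psi>: "\<Psi> n x" and hit: "hit n {k<..<j} {j + 1} x"
  shows "\<exists>n'. cross k \<Psi> j n' x"
proof -
  obtain n' where n': "n' \<ge> n" "x n' = j + 1" "\<forall>i. n \<le> i \<and> i < n' \<longrightarrow> x i \<in> {k<..<j}"
    using hit unfolding hit_def by blast
  have jp: "\<forall>i<n. x i < k" "x n = k + 1" using jump_familyD(2)[OF fam \<Psi>] unfolding jump_def by auto
  have "x i < j" if "i < n'" for i
    using that n'(3) jp(1) kj by (cases "i < n") force+
  moreover have "n \<noteq> n'" using n' jp kj by auto
  ultimately have "cross k \<Psi> j n' x" unfolding cross_def jump_def
    using n' \<Psi> by (intro conjI exI[of _ n]) auto
  then show ?thesis ..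
qed

lemma cross_hit: "cross k \<Psi> j n' x \<Longrightarrow> \<exists>n. \<Psi> n x \<and> hit n {k<..<j} {j..} x"
  unfolding cross_def hit_def jump_def by (metis atLeast_iff le_add1 less_imp_le)

text \<open>Before \<open>n\<close> the path is below \<open>k\<close>, so its passage over
  \<open>j\<close> comes after \<open>n\<close>; by then it never goes back to
  \<open>k\<close>.\<close>

lemma cross_of_skips:
  assumes fam: "jump_family k \<Psi>" and kj: "k < j" and \<Psi>: "\<Psi> n x" and esc: "\<forall>i\<ge>n. x i > k"
    and j: "jump j n' x"
  shows "cross k \<Psi> j n' x"
proof -
  have jp: "\<forall>i<n. x i < k" "x n = k + 1" using jump_familyD(2)[OF fam \<Psi>] unfolding jump_def by auto
  have "\<not> n' < n" using jp j kj unfolding jump_def by fastforce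
  moreover have "n' \<noteq> n" using jp j kj unfolding jump_def by auto
  ultimately show ?thesis unfolding cross_def using j \<Psi> esc
    by (intro conjI exI[of _ n]) (auto simp: jump_def)
qed

context walk
begin

lemma ev_family: "jump_family k \<Psi> \<Longrightarrow> ev (\<Psi> n)"
  using ev_adapted jump_familyD(1) by blast

lemma ev_skips: "ev (skips k)"
  unfolding skips_def jump_def by (intro ev_intros)

lemma jump_family_Ex_le:
  assumes fam: "jump_family k \<Psi>" and ev: "\<And>n. ev (P n)"
    and le: "\<And>n. pr (\<lambda>x. \<Psi> n x \<and> P n x) \<le> b * pr (\<Psi> n)"
  shows "pr (\<lambda>x. \<exists>n. \<Psi> n x \<and> P n x) \<le> b * pr (\<lambda>x. \<exists>n. \<Psi> n x)"
  using pr_Ex_le[of "\<lambda>n x. \<Psi> n x \<and> P n x" \<Psi> 1 b] jump_familyD(4)[OF fam]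
    ev_conj[OF ev_family[OF fam] ev] ev_family[OF fam] le by auto

lemma jump_family_Ex_ge:
  assumes fam: "jump_family k \<Psi>" and ev: "\<And>n. ev (P n)"
    and le: "\<And>n. a * pr (\<Psi> n) \<le> pr (\<lambda>x. \<Psi> n x \<and> P n x)"
  shows "a * pr (\<lambda>x. \<exists>n. \<Psi> n x) \<le> pr (\<lambda>x. \<exists>n. \<Psi> n x \<and> P n x)"
  using pr_Ex_le[of \<Psi> "\<lambda>n x. \<Psi> n x \<and> P n x" a 1] jump_familyD(4)[OF fam]
    ev_conj[OF ev_family[OF fam] ev] ev_family[OF fam] le by auto

text \<open>The first entry into \<open>{k..}\<close> cannot be at \<open>k\<close>, so it is a jump
  from \<open>k - 1\<close> to \<open>k + 1\<close>. Later downward steps have size one and would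
  have to land on \<open>k\<close>.\<close>

lemma valid_skipped_skips:
  assumes valid: "valid x" and k: "k \<ge> 1" "skipped_point x k" and ex: "x n \<ge> k"
  shows "skips k x"
proof -
  define m where "m = (LEAST n. x n \<ge> k)"
  have m: "x m \<ge> k" unfolding m_def by (rule LeastI[of _ n]) (rule ex)
  have lt: "x i < k" if "i < m" for i using not_less_Least[OF that[unfolded m_def]] by simp
  have ne: "x i \<noteq> k" for i using k(2) unfolding skipped_point_def by blast
  have "x 0 = 0" using valid unfolding valid_def by blast
  then have "m \<noteq> 0" using m k(1) by (intro notI) simp
  then obtain m' where m': "m = Suc m'" by (cases m) auto
  have "x m = x m' + 2 \<or> x m = x m' - 1" using valid unfolding valid_def m' by blast
  with m lt[of m'] ne[of m] have xm: "x m = k + 1" unfolding m' by auto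
  have "x i > k" if "i \<ge> m" for i using that
  proof (induction i rule: dec_induct)
    case (step i)
    have "x (Suc i) = x i + 2 \<or> x (Suc i) = x i - 1" using valid unfolding valid_def by blast
    with step.IH ne[of "Suc i"] show ?case by auto
  qed (use xm in simp)
  then show ?thesis unfolding skips_def jump_def using lt xm by blast
qed

lemma AE_unbounded: "AE \<omega> in M. \<forall>k. \<exists>n. X n \<omega> \<ge> k"
proof -
  have "AE \<omega> in M. \<exists>n. X n \<omega> \<ge> k" for k
  proof (rule AE_I)
    show "emeasure M {\<omega> \<in> space M. \<forall>i\<ge>0. X i \<omega> < k} = 0"
      using pr_bounded_0[of 0 k] unfolding pr_def by (simp add: emeasure_eq_measure)
  qed (auto simp: not_le)
  then show ?thesis by (subst AE_all_countable) blast
qed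

end

context lnln_walk
begin

definition c0 :: real where "c0 = 2 powr (-\<beta>) / 40"

lemma c0_pos: "c0 > 0" unfolding c0_def by simp

lemma family_escape_le:
  assumes k: "k \<ge> K0" and fam: "jump_family k \<Psi>"
  shows "pr (\<lambda>x. \<exists>n. \<Psi> n x \<and> (\<forall>i\<ge>n. x i > k)) \<le> 2 * eps k / real k * pr (\<lambda>x. \<exists>n. \<Psi> n x)"
  by (rule jump_family_Ex_le[OF fam _ escape_le[OF k jump_familyD(3)[OF fam]]]) (intro ev_intros)

lemma family_escape_ge:
  assumes k: "k \<ge> K0" and fam: "jump_family k \<Psi>"
  shows "c0 * (eps k / real k) * pr (\<lambda>x. \<exists>n. \<Psi> n x) \<le> pr (\<lambda>x. \<exists>n. \<Psi> n x \<and> (\<forall>i\<ge>n. x i > k))"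
  unfolding c0_def
  by (rule jump_family_Ex_ge[OF fam _ escape_ge[OF k jump_familyD(3)[OF fam]]]) (intro ev_intros)

text \<open>Reach \<open>j + 1\<close> before \<open>k\<close>, then escape above \<open>j\<close>.
  This escape also counts as the escape from \<open>k\<close>, so no factor \<open>eps k / k\<close>
  is paid: that is the clustering of skipped points.\<close>

lemma family_skips_ge:
  assumes k: "k \<ge> K0" and j: "j \<ge> k + 8" and fam: "jump_family k \<Psi>"
  shows "c0 * (eps j / real j) * (1 / (13 * (real j - real k))) * pr (\<lambda>x. \<exists>n. \<Psi> n x)
    \<le> pr (\<lambda>x. (\<exists>n. \<Psi> n x \<and> (\<forall>i\<ge>n. x i > k)) \<and> skips j x)"
proof -
  note fam' = jump_family_cross[OF fam, of j]
  have jK: "j \<ge> K0" and j16: "j \<ge> 16" using j k K0(1) by auto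
  have "1 / (13 * (real j - real k)) * pr (\<lambda>x. \<exists>n. \<Psi> n x) \<le> pr (\<lambda>x. \<exists>n. \<Psi> n x \<and> hit n {k<..<j} {j + 1} x)"
    by (rule jump_family_Ex_ge[OF fam ev_hit jump_above_ge[OF k j jump_familyD(3)[OF fam]]])
  also have "\<dots> \<le> pr (\<lambda>x. \<exists>n'. cross k \<Psi> j n' x)"
    using cross_of_hit[OF fam, of j] j by (intro pr_mono ev_ex ev_family[OF fam']) auto
  finally have *: "1 / (13 * (real j - real k)) * pr (\<lambda>x. \<exists>n. \<Psi> n x) \<le> pr (\<lambda>x. \<exists>n'. cross k \<Psi> j n' x)" .
  have "0 \<le> c0 * (eps j / real j)" using c0_pos eps_pos[OF j16] by simp
  from mult_left_mono[OF * this] family_escape_ge[OF jK fam']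
  have "c0 * (eps j / real j) * (1 / (13 * (real j - real k))) * pr (\<lambda>x. \<exists>n. \<Psi> n x)
    \<le> pr (\<lambda>x. \<exists>n'. cross k \<Psi> j n' x \<and> (\<forall>i\<ge>n'. x i > j))" by (simp only: mult.assoc)
  also have "\<dots> \<le> pr (\<lambda>x. (\<exists>n. \<Psi> n x \<and> (\<forall>i\<ge>n. x i > k)) \<and> skips j x)"
  proof (rule pr_mono)
    fix x assume "\<exists>n'. cross k \<Psi> j n' x \<and> (\<forall>i\<ge>n'. x i > j)"
    then obtain n n' where n: "jump j n' x" "n < n'" "\<Psi> n x" "\<forall>i. n \<le> i \<and> i < n' \<longrightarrow> x i \<in> {k<..<j}" "\<forall>i\<ge>n'. x i > j"
      unfolding cross_def by blast
    have "x i > k" if "i \<ge> n" for i 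
    proof (cases "i < n'")
      case True
      with n(4) that show ?thesis by auto
    next
      case False
      with n(5) have "x i > j" by simp
      with j show ?thesis by simp
    qed
    with n show "(\<exists>n. \<Psi> n x \<and> (\<forall>i\<ge>n. x i > k)) \<and> skips j x" unfolding skips_def by blast
  qed (intro ev_intros ev_family[OF fam] ev_skips)
  finally show ?thesis .
qed

text \<open>Both skips force a passage from \<open>k + 1\<close> to level \<open>j\<close> that
  avoids \<open>k\<close>, followed by an escape from \<open>j\<close>; the two bounds
  multiply.\<close>

lemma family_skips_le:
  assumes k: "k \<ge> K0" and j: "j > k" and fam: "jump_family k \<Psi>"
  shows "pr (\<lambda>x. (\<exists>n. \<Psi> n x \<and> (\<forall>i\<ge>n. x i > k)) \<and> skips j x) \<le> 
   2 * eps j / real j * (2 * eps k / real k + 1 / (real k * ln (real j / real k))) * pr (\<lambda>x. \<exists>n. \<Psi> n x)"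
proof -
  note fam' = jump_family_cross[OF fam, of j]
  have jK: "j \<ge> K0" and j16: "j \<ge> 16" using j k K0(1) by auto
  have "pr (\<lambda>x. (\<exists>n. \<Psi> n x \<and> (\<forall>i\<ge>n. x i > k)) \<and> skips j x) \<le> 
     pr (\<lambda>x. \<exists>n'. cross k \<Psi> j n' x \<and> (\<forall>i\<ge>n'. x i > j))"
    using cross_of_skips[OF fam j] unfolding skips_def by (intro pr_mono ev_intros ev_family[OF fam']) blast
  also have "\<dots> \<le> 2 * eps j / real j * pr (\<lambda>x. \<exists>n'. cross k \<Psi> j n' x)"
    by (rule family_escape_le[OF jK fam'])
  finally have 1: "pr (\<lambda>x. (\<exists>n. \<Psi> n x \<and> (\<forall>i\<ge>n. x i > k)) \<and> skips j x)
     \<le> 2 * eps j / real j * pr (\<lambda>x. \<exists>n'. cross k \<Psi> j n' x)" .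
  have "pr (\<lambda>x. \<exists>n'. cross k \<Psi> j n' x) \<le> pr (\<lambda>x. \<exists>n. \<Psi> n x \<and> hit n {k<..<j} {j..} x)"
    using cross_hit[of k \<Psi> j] by (intro pr_mono ev_intros ev_family[OF fam] ev_hit) blast
  also have "\<dots> \<le> (2 * eps k / real k + 1 / (real k * ln (real j / real k))) * pr (\<lambda>x. \<exists>n. \<Psi> n x)"
    by (rule jump_family_Ex_le[OF fam ev_hit reach_le[OF k j jump_familyD(3)[OF fam]]])
  finally have "2 * eps j / real j * pr (\<lambda>x. \<exists>n'. cross k \<Psi> j n' x) \<le>
     2 * eps j / real j * ((2 * eps k / real k + 1 / (real k * ln (real j / real k))) * pr (\<lambda>x. \<exists>n. \<Psi> n x))"
    using eps_pos[OF j16] by (intro mult_left_mono) auto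
  with 1 show ?thesis by (simp only: mult.assoc)
qed

lemma skips_le:
  assumes k: "k \<ge> K0" shows "pr (skips k) \<le> 2 * eps k / real k"
proof -
  have fam: "jump_family k (jump k)" unfolding jump_family_def using adapted_jump by blast
  have "pr (skips k) = pr (\<lambda>x. \<exists>n. jump k n x \<and> (\<forall>i\<ge>n. x i > k))" unfolding skips_def by simp
  also have "\<dots> \<le> 2 * eps k / real k * pr (\<lambda>x. \<exists>n. jump k n x)" by (rule family_escape_le[OF k fam])
  also have "\<dots> \<le> 2 * eps k / real k * 1"
    using eps_pos[of k] K0(1) k by (intro mult_left_mono) (auto simp: pr_def)
  finally show ?thesis by simp
qed

end

section \<open>Finitely many skipped points for exponents above 1\<close>

text \<open>That no smaller site of \<open>W\<close> is skipped is demanded already before time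
  \<open>n\<close>, which keeps the event adapted. Once the path stays above \<open>k\<close>, this
  amounts to \<open>k\<close> being the first skipped site of \<open>W\<close>.\<close>

definition first_skip :: "nat set \<Rightarrow> nat \<Rightarrow> nat \<Rightarrow> (nat \<Rightarrow> nat) \<Rightarrow> bool" where
  "first_skip W k n x \<longleftrightarrow> jump k n x \<and> (\<forall>i\<in>W. i < k \<longrightarrow> (\<exists>t<n. x t = i))"

lemma jump_family_first_skip: "jump_family k (first_skip W k)"
  unfolding jump_family_def
proof (intro allI conjI impI)
  fix n show "adapted n (first_skip W k n)"
  proof (rule adaptedI)
    fix x y :: "nat \<Rightarrow> nat" assume eq: "\<And>i. i \<le> n \<Longrightarrow> x i = y i" and x: "first_skip W k n x"
    then have "jump k n y" using adaptedD[OF adapted_jump, of n x y k] unfolding first_skip_def by simp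
    moreover have "\<exists>t<n. y t = i" if "i \<in> W" "i < k" for i
      using x that eq unfolding first_skip_def by (metis less_imp_le)
    ultimately show "first_skip W k n y" unfolding first_skip_def by blast
  qed
qed (simp add: first_skip_def)

context walk
begin

lemma pr_bex_disjoint:
  assumes "finite I" "\<And>k. k \<in> I \<Longrightarrow> ev (E k)"
    and "\<And>x k j. k \<in> I \<Longrightarrow> j \<in> I \<Longrightarrow> E k x \<Longrightarrow> E j x \<Longrightarrow> k = j"
  shows "pr (\<lambda>x. \<exists>k\<in>I. E k x) = (\<Sum>k\<in>I. pr (E k))"
proof -
  have "{\<omega> \<in> space M. \<exists>k\<in>I. E k (\<lambda>n. X n \<omega>)} = (\<Union>k\<in>I. {\<omega> \<in> space M. E k (\<lambda>n. X n \<omega>)})" by auto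
  also have "measure M \<dots> = (\<Sum>k\<in>I. measure M {\<omega> \<in> space M. E k (\<lambda>n. X n \<omega>)})"
    using assms by (intro finite_measure_finite_Union) (auto simp: ev_def disjoint_family_on_def)
  finally show ?thesis unfolding pr_def .
qed

lemma ev_bex: "finite I \<Longrightarrow> (\<And>k. k \<in> I \<Longrightarrow> ev (E k)) \<Longrightarrow> ev (\<lambda>x. \<exists>k\<in>I. E k x)"
  unfolding ev_def by (rule sets.sets_Collect_finite_Ex)

end

context lnln_walk
begin

text \<open>The probability \<open>P\<close> of the jump cancels between the joint lower bound and
  the upper bound for \<open>F\<close>. In 52 = 13 * 2 * 2 the factors come from
  \<open>jump_above_ge\<close>, from \<open>escape_le\<close> and from j \<le> 2 k.\<close>

lemma first_skip_skips_ge: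
  fixes W :: "nat set"
  assumes k: "k \<ge> K0" and j: "k + 8 \<le> j" "j \<le> 2 * k"
  defines "F \<equiv> \<lambda>x. \<exists>n. first_skip W k n x \<and> (\<forall>i\<ge>n. x i > k)"
  shows "c0 * 2 powr (-\<beta>) / 52 * (1 / real (j - k)) * pr F \<le> pr (\<lambda>x. F x \<and> skips j x)"
proof -
  have k16: "k \<ge> 16" using k K0(1) by simp
  define P where "P = pr (\<lambda>x. \<exists>n. first_skip W k n x)"
  have low: "c0 * (eps j / real j) * (1 / (13 * (real j - real k))) * P \<le> pr (\<lambda>x. F x \<and> skips j x)"
    unfolding F_def P_def by (rule family_skips_ge[OF k j(1) jump_family_first_skip])
  have up: "pr F \<le> 2 * eps k / real k * P"
    unfolding F_def P_def by (rule family_escape_le[OF k jump_family_first_skip])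
  have ratio: "2 powr (-\<beta>) * eps k / (2 * real k) \<le> eps j / real j"
  proof (rule frac_le)
    have "2 * k \<le> k^2" using k16 by (simp add: power2_eq_square)
    then have "eps (k^2) \<le> eps j" using j k16 by (intro eps_antimono) auto
    then show "2 powr (-\<beta>) * eps k \<le> eps j" using eps_square[OF k16] by linarith
  qed (use j k16 eps_pos[of j] in auto)
  have "c0 * 2 powr (-\<beta>) / 52 * (1 / real (j - k)) * pr F \<le>
      c0 * 2 powr (-\<beta>) / 52 * (1 / real (j - k)) * (2 * eps k / real k * P)"
    using up c0_pos by (intro mult_left_mono) auto
  also have "\<dots> = c0 * (2 powr (-\<beta>) * eps k / (2 * real k)) * (1 / (13 * (real j - real k))) * P"
    using j by (simp add: of_nat_diff field_simps)
  also have "\<dots> \<le> c0 * (eps j / real j) * (1 / (13 * (real j - real k))) * P"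
    using ratio c0_pos j
    by (intro mult_right_mono mult_left_mono) (auto simp: P_def)
  also note low
  finally show ?thesis .
qed

text \<open>Double counting of pairs consisting of a first skipped site k of W and a skipped site j
  of W'. The window W' reaches to 2^(m+2) so that it contains every j up to 2 k.\<close>

lemma window_skip_le:
  assumes m: "m \<ge> 10" "2 ^ m \<ge> K0"
  shows "pr (\<lambda>x. \<exists>k\<in>{2^m<..2^(m+1)}. skips k x) \<le> 18 / (c0 * 2 powr (-\<beta>) / 52) * (eps (2^m) / real m)"
proof -
  define W W' where "W = {2^m<..(2::nat)^(m+1)}" and "W' = {2^m<..(2::nat)^(m+2)}"
  define F where "F k x \<longleftrightarrow> (\<exists>n. first_skip W k n x \<and> (\<forall>i\<ge>n. x i > k))" for k x
  define c1 where "c1 = c0 * 2 powr (-\<beta>) / 52"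
  have c1: "c1 > 0" using c0_pos by (simp add: c1_def)
  have m16: "(2::nat)^m \<ge> 16" using m K0(1) by linarith
  have evF: "ev (F k)" for k
    unfolding F_def by (intro ev_intros ev_family[OF jump_family_first_skip])
  \<comment> \<open>The larger of two such sites would require the smaller one to have been
    visited.\<close>
  have dF: "k = j" if "k \<in> W" "j \<in> W" "F k x" "F j x" for k j x
  proof -
    have "\<not> (k < j)" if kj: "k \<in> W" "j \<in> W" "F k x" "F j x" for k j
    proof
      assume "k < j"
      with kj obtain t where "x t = k" unfolding F_def first_skip_def by blast
      moreover have "skips k x" using kj(3) unfolding F_def first_skip_def skips_def by blast
      ultimately show False using skips_imp_skipped_point unfolding skipped_point_def by blast
    qed
    from this[of k j] this[of j k] that show ?thesis by force
  qed
  have "pr (\<lambda>x. \<exists>k\<in>W. skips k x) \<le> pr (\<lambda>x. \<exists>k\<in>W. F k x)"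
  proof (rule pr_mono_valid)
    show "ev (\<lambda>x. \<exists>k\<in>W. F k x)" by (intro ev_bex evF) (simp add: W_def)
  next
    fix x assume valid: "valid x" and "\<exists>k\<in>W. skips k x"
    then obtain k0 where k0: "k0 \<in> W" "skips k0 x" by blast
    define k where "k = (LEAST k. k \<in> W \<and> skipped_point x k)"
    have ex: "k0 \<in> W \<and> skipped_point x k0" using k0 skips_imp_skipped_point by blast
    have k: "k \<in> W" "skipped_point x k" using LeastI[of "\<lambda>k. k \<in> W \<and> skipped_point x k", OF ex] unfolding k_def by auto
    \<comment> \<open>The path does climb past \<open>k\<close>, since it jumps over
      \<open>k0\<close>, which is at least as large.\<close>
    have "k \<le> k0" unfolding k_def using ex by (rule Least_le)
    moreover obtain n0 where "x n0 = k0 + 1" using k0(2) unfolding skips_def jump_def by blast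
    ultimately have "skips k x" using k by (intro valid_skipped_skips[OF valid, of k n0]) (auto simp: W_def)
    then obtain n where n: "jump k n x" "\<forall>i\<ge>n. x i > k" unfolding skips_def by blast
    have "\<exists>t<n. x t = i" if i: "i \<in> W" "i < k" for i
    proof -
      have "\<not> skipped_point x i" using not_less_Least[of i "\<lambda>k. k \<in> W \<and> skipped_point x k"] i unfolding k_def by blast
      then obtain t where t: "x t = i" unfolding skipped_point_def by blast
      have "t < n" using n(2) t i(2) by (metis not_less not_less_iff_gr_or_eq)
      with t show ?thesis by blast
    qed
    with n k show "\<exists>k\<in>W. F k x" unfolding F_def first_skip_def by blast
  qed
  also have "\<dots> = (\<Sum>k\<in>W. pr (F k))" by (rule pr_bex_disjoint) (use evF dF in \<open>auto simp: W_def\<close>)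
  finally have le: "pr (\<lambda>x. \<exists>k\<in>W. skips k x) \<le> (\<Sum>k\<in>W. pr (F k))" .
  \<comment> \<open>The harmonic sum from 8 to k is at least ln k - 3, hence at least 2 m / 3 - 3,
    which is at least m / 3 because m is at least 10.\<close>
  have "(\<Sum>k\<in>W. c1 * (real m / 3) * pr (F k)) \<le> (\<Sum>k\<in>W. \<Sum>j\<in>W'. pr (\<lambda>x. F k x \<and> skips j x))"
  proof (rule sum_mono)
    fix k assume k: "k \<in> W"
    have kK: "k \<ge> K0" using k m by (auto simp: W_def)
    have km: "real k \<ge> 2^m" using k of_nat_mono[of "2^m" k, where 'a = real] by (auto simp: W_def)
    have harm: "(\<Sum>j\<in>{k+8..2*k}. 1 / real (j - k)) \<ge> real m / 3"
    proof -
      have k8: "k \<ge> 8" using kK K0(1) by simp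
      have "(\<Sum>j\<in>{k+8..2*k}. 1 / real (j - k)) = (\<Sum>d\<in>{8..k}. inverse (real d))"
        by (rule sum.reindex_bij_witness[of _ "\<lambda>d. d + k" "\<lambda>j. j - k"]) (auto simp: inverse_eq_divide)
      also have "\<dots> = harm k - harm 7"
      proof -
        have "{1..k} = {1..7} \<union> {8..k}" using k8 by auto
        then have "harm k = harm 7 + (\<Sum>d\<in>{8..k}. inverse (real d))"
          unfolding harm_def by (simp add: sum.union_disjoint)
        then show ?thesis by simp
      qed
      also have "\<dots> \<ge> ln (real k) - 3"
      proof -
        have "ln (real k) \<le> ln (real k + 1)" using k8 by (subst ln_le_cancel_iff) auto
        then show ?thesis using harm_ge_ln[of k] by (simp add: harm_expand)
      qed
      finally have 1: "(\<Sum>j\<in>{k+8..2*k}. 1 / real (j - k)) \<ge> ln (real k) - 3" .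
      have "ln ((2::real)^m) \<le> ln (real k)" using km k8 by (subst ln_le_cancel_iff) auto
      then have "real m * ln 2 \<le> ln (real k)" by (simp add: ln_realpow)
      moreover have "real m * (2/3) \<le> real m * ln 2" using ln2_ge_two_thirds by (intro mult_left_mono) auto
      moreover have "real m * (2/3) - 3 \<ge> real m / 3" using m by simp
      ultimately show ?thesis using 1 by linarith
    qed
    have "c1 * (real m / 3) * pr (F k) \<le> c1 * (\<Sum>j\<in>{k+8..2*k}. 1 / real (j - k)) * pr (F k)"
      using harm c1 by (intro mult_right_mono mult_left_mono) auto
    also have "\<dots> = (\<Sum>j\<in>{k+8..2*k}. c1 * (1 / real (j - k)) * pr (F k))"
      by (simp add: sum_distrib_left sum_distrib_right)
    also have "\<dots> \<le> (\<Sum>j\<in>{k+8..2*k}. pr (\<lambda>x. F k x \<and> skips j x))"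
      using first_skip_skips_ge[OF kK, of _ W] unfolding c1_def F_def by (intro sum_mono) auto
    also have "\<dots> \<le> (\<Sum>j\<in>W'. pr (\<lambda>x. F k x \<and> skips j x))"
      using k by (intro sum_mono2) (auto simp: W_def W'_def)
    finally show "c1 * (real m / 3) * pr (F k) \<le> (\<Sum>j\<in>W'. pr (\<lambda>x. F k x \<and> skips j x))" .
  qed
  also have "\<dots> = (\<Sum>j\<in>W'. \<Sum>k\<in>W. pr (\<lambda>x. F k x \<and> skips j x))" by (rule sum.swap)
  \<comment> \<open>For fixed j the events \<open>F k\<close> are disjoint, so summing over k costs
    nothing. W' has 3 * 2^m sites, which gives 6 eps (2^m); division by m / 3 yields the 18.\<close>
  also have "\<dots> \<le> (\<Sum>j\<in>W'. 2 * eps (2^m) / 2^m)"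
  proof (rule sum_mono)
    fix j assume j: "j \<in> W'"
    have "(\<Sum>k\<in>W. pr (\<lambda>x. F k x \<and> skips j x)) = pr (\<lambda>x. \<exists>k\<in>W. F k x \<and> skips j x)"
      by (rule pr_bex_disjoint[symmetric]) (use dF in \<open>auto simp: W_def intro!: ev_conj evF ev_skips\<close>)
    also have "\<dots> \<le> pr (skips j)" by (rule pr_mono[OF ev_skips]) blast
    also have "\<dots> \<le> 2 * eps j / real j" using j m by (intro skips_le) (auto simp: W'_def)
    also have "\<dots> \<le> 2 * eps (2^m) / 2^m"
    proof (rule frac_le)
      show "2 * eps j \<le> 2 * eps (2^m)" using j m16 by (intro mult_left_mono eps_antimono) (auto simp: W'_def)
      show "(2::real)^m \<le> real j" using j of_nat_mono[of "2^m" j, where 'a = real] by (auto simp: W'_def)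
    qed (use eps_pos[OF m16] in auto)
    finally show "(\<Sum>k\<in>W. pr (\<lambda>x. F k x \<and> skips j x)) \<le> 2 * eps (2^m) / 2^m" .
  qed
  also have "\<dots> = 6 * eps (2^m)" by (simp add: W'_def algebra_simps)
  finally have "c1 * (real m / 3) * (\<Sum>k\<in>W. pr (F k)) \<le> 6 * eps (2^m)" by (simp add: sum_distrib_left)
  then have "(\<Sum>k\<in>W. pr (F k)) \<le> 18 / c1 * (eps (2^m) / real m)"
    using c1 m by (simp add: field_simps)
  with le show ?thesis unfolding W_def c1_def by linarith
qed

lemma summable_window_skip:
  assumes "\<beta> > 1"
  shows "summable (\<lambda>m. pr (\<lambda>x. \<exists>k\<in>{2^m<..2^(m+1)}. skips k x))"
proof -
  define C where "C = 18 / (c0 * 2 powr (-\<beta>) / 52)"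
  have C: "C > 0" using c0_pos by (simp add: C_def)
  have "summable (\<lambda>m. C * 2 powr \<beta> * (1 / (real m * ln (real m) powr \<beta>)))"
    by (intro summable_mult summable_inverse_ln_powr assms)
  moreover have "\<forall>\<^sub>F m in sequentially. norm (pr (\<lambda>x. \<exists>k\<in>{2^m<..2^(m+1)}. skips k x))
     \<le> C * 2 powr \<beta> * (1 / (real m * ln (real m) powr \<beta>))"
  proof -
    have "\<forall>\<^sub>F m in sequentially. ln (real m) / 2 \<le> ln (real m * ln 2)" by real_asymp
    then show ?thesis using eventually_ge_at_top[of "max 10 K0"]
    proof eventually_elim
      case (elim m)
      then have m: "m \<ge> 10" "m \<ge> K0" by auto
      have "m < 2^m" by (rule less_exp)
      then have "2^m \<ge> K0" using m by linarith
      then have "pr (\<lambda>x. \<exists>k\<in>{2^m<..2^(m+1)}. skips k x) \<le> C * (eps (2^m) / real m)"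
        unfolding C_def using m by (intro window_skip_le)
      also have "eps (2^m) \<le> (ln (real m) / 2) powr (-\<beta>)"
        unfolding eps_def using elim(1) m assms by (intro powr_mono2') (auto simp: ln_realpow)
      also have "(ln (real m) / 2) powr (-\<beta>) = 2 powr \<beta> / ln (real m) powr \<beta>"
        using m by (simp add: powr_divide powr_minus field_simps)
      finally have "pr (\<lambda>x. \<exists>k\<in>{2^m<..2^(m+1)}. skips k x) \<le> C * (2 powr \<beta> / ln (real m) powr \<beta> / real m)"
        using C by (simp add: divide_right_mono mult_left_mono)
      then show ?case by (simp add: mult_ac)
    qed
  qed
  ultimately show ?thesis by (rule summable_comparison_test_ev[rotated])
qed

lemma AE_finite_skipped:
  assumes "\<beta> > 1"
  shows "AE \<omega> in M. finite {k. skipped_point (\<lambda>n. X n \<omega>) k}"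
proof -
  define A where "A m = {\<omega> \<in> space M. \<exists>k\<in>{2^m<..2^(m+1)}. skips k (\<lambda>n. X n \<omega>)}" for m
  have "ev (\<lambda>x. \<exists>k\<in>{2^m<..2^(m+1)}. skips k x)" for m by (intro ev_bex ev_skips) auto
  then have meas: "A m \<in> sets M" for m unfolding A_def ev_def .
  have "AE \<omega> in M. eventually (\<lambda>m. \<omega> \<in> space M - A m) sequentially"
    using summable_window_skip[OF assms] unfolding pr_def A_def[symmetric]
    by (intro borel_cantelli_AE1 meas) (auto simp: less_top[symmetric])
  then show ?thesis using AE_valid AE_unbounded
  proof eventually_elim
    case (elim \<omega>)
    obtain N where N: "\<And>m. m \<ge> N \<Longrightarrow> \<omega> \<in> space M - A m" using elim(1) unfolding eventually_sequentially by blast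
    have "{k. skipped_point (\<lambda>n. X n \<omega>) k} \<subseteq> {..2 ^ (N + 1)}"
    proof
      fix k assume "k \<in> {k. skipped_point (\<lambda>n. X n \<omega>) k}"
      then have sk: "skipped_point (\<lambda>n. X n \<omega>) k" by simp
      show "k \<in> {..2 ^ (N + 1)}"
      proof (rule ccontr)
        assume "k \<notin> {..2 ^ (N + 1)}"
        then have k: "k > 2 ^ (N + 1)" by simp
        then have k2: "k \<ge> 2" using one_le_power[of "2::nat" "N + 1"] by linarith
        obtain m where m: "2^m < k" "k \<le> 2^(m+1)" using ex_power_ivl2[of 2 k] k2 by auto
        have "2 ^ (N + 1) < (2::nat) ^ (m + 1)" using k m by linarith
        then have "N \<le> m" by simp
        obtain n where "k \<le> X n \<omega>" using elim(3) by blast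
        then have "skips k (\<lambda>n. X n \<omega>)" using valid_skipped_skips[OF elim(2) _ sk] k2 by auto
        then show False using N[OF \<open>N \<le> m\<close>] m unfolding A_def by auto
      qed
    qed
    then show ?case using finite_subset by blast
  qed
qed

end

section \<open>Infinitely many skipped points for exponents up to 1\<close>

lemma sum_symmetric_split:
  fixes g :: "nat \<Rightarrow> nat \<Rightarrow> real"
  assumes fin: "finite I" and sym: "\<And>i j. g i j = g j i"
  shows "(\<Sum>k\<in>I. \<Sum>j\<in>I. g k j) = (\<Sum>k\<in>I. g k k) + 2 * (\<Sum>k\<in>I. \<Sum>j\<in>{j\<in>I. k < j}. g k j)"
proof -
  have "(\<Sum>j\<in>I. g k j) = g k k + (\<Sum>j\<in>{j\<in>I. k < j}. g k j) + (\<Sum>j\<in>{j\<in>I. j < k}. g k j)" if "k \<in> I" for k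
  proof -
    have "I = {k} \<union> ({j\<in>I. k < j} \<union> {j\<in>I. j < k})" using that by auto
    then have "(\<Sum>j\<in>I. g k j) = (\<Sum>j\<in>{k} \<union> ({j\<in>I. k < j} \<union> {j\<in>I. j < k}). g k j)" by simp
    also have "\<dots> = g k k + (\<Sum>j\<in>{j\<in>I. k < j}. g k j) + (\<Sum>j\<in>{j\<in>I. j < k}. g k j)"
      using fin by (subst sum.union_disjoint, simp, simp, force)+ simp
    finally show ?thesis .
  qed
  moreover have "(\<Sum>k\<in>I. \<Sum>j\<in>{j\<in>I. j < k}. g k j) = (\<Sum>j\<in>I. \<Sum>k\<in>{k\<in>I. j < k}. g k j)"
    by (rule sum.swap_restrict[OF fin fin])
  moreover have "\<dots> = (\<Sum>k\<in>I. \<Sum>j\<in>{j\<in>I. k < j}. g k j)" using sym by simp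
  ultimately show ?thesis by (simp add: sum.distrib)
qed

context walk
begin

text \<open>For \<open>Y \<ge> 0\<close> the indicator of \<open>Y > 0\<close> dominates \<open>2tY - t\<^sup>2Y\<^sup>2\<close>.\<close>

lemma second_moment:
  assumes fin: "finite I" and ev: "\<And>k. k \<in> I \<Longrightarrow> ev (E k)"
  shows "2 * t * (\<Sum>k\<in>I. w k * pr (E k)) - t\<^sup>2 * (\<Sum>k\<in>I. \<Sum>j\<in>I. w k * w j * pr (\<lambda>x. E k x \<and> E j x))
    \<le> pr (\<lambda>x. \<exists>k\<in>I. E k x)"
proof -
  define A where "A k = {\<omega> \<in> space M. E k (\<lambda>n. X n \<omega>)}" for k
  have A [measurable]: "A k \<in> sets M" if "k \<in> I" for k using ev[OF that] unfolding A_def ev_def .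
  define Y where "Y \<omega> = (\<Sum>k\<in>I. w k * indicator (A k) \<omega>)" for \<omega>
  define U where "U = (\<Union>k\<in>I. A k)"
  have U [measurable]: "U \<in> sets M" unfolding U_def using fin A by blast
  have iA: "integrable M (\<lambda>\<omega>. indicator (A k) \<omega> :: real)" if "k \<in> I" for k
    using A[OF that] by (simp add: less_top[symmetric])
  have iAA: "integrable M (\<lambda>\<omega>. indicator (A k \<inter> A j) \<omega> :: real)" if "k \<in> I" "j \<in> I" for k j
    using A that by (simp add: less_top[symmetric])
  have Y2: "(Y \<omega>)\<^sup>2 = (\<Sum>k\<in>I. \<Sum>j\<in>I. w k * w j * indicator (A k \<inter> A j) \<omega>)" for \<omega>
    unfolding Y_def power2_eq_square sum_product by (simp add: indicator_inter_arith mult_ac)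
  have iY: "integrable M Y" unfolding Y_def using iA by (intro Bochner_Integration.integrable_sum integrable_mult_right) auto
  have iY2: "integrable M (\<lambda>\<omega>. (Y \<omega>)\<^sup>2)" unfolding Y2
    using iAA by (intro Bochner_Integration.integrable_sum integrable_mult_right) auto
  have EY: "(\<integral>\<omega>. Y \<omega> \<partial>M) = (\<Sum>k\<in>I. w k * pr (E k))"
  proof -
    have "(\<integral>\<omega>. Y \<omega> \<partial>M) = (\<Sum>k\<in>I. \<integral>\<omega>. w k * indicator (A k) \<omega> \<partial>M)"
      unfolding Y_def using iA by (intro Bochner_Integration.integral_sum integrable_mult_right) auto
    also have "\<dots> = (\<Sum>k\<in>I. w k * pr (E k))"
      using A by (intro sum.cong) (auto simp: pr_def A_def)
    finally show ?thesis .
  qed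
  have EY2: "(\<integral>\<omega>. (Y \<omega>)\<^sup>2 \<partial>M) = (\<Sum>k\<in>I. \<Sum>j\<in>I. w k * w j * pr (\<lambda>x. E k x \<and> E j x))"
  proof -
    have "(\<integral>\<omega>. (Y \<omega>)\<^sup>2 \<partial>M) = (\<Sum>k\<in>I. \<integral>\<omega>. (\<Sum>j\<in>I. w k * w j * indicator (A k \<inter> A j) \<omega>) \<partial>M)"
      unfolding Y2 using iAA by (intro Bochner_Integration.integral_sum Bochner_Integration.integrable_sum integrable_mult_right) auto
    also have "\<dots> = (\<Sum>k\<in>I. \<Sum>j\<in>I. \<integral>\<omega>. w k * w j * indicator (A k \<inter> A j) \<omega> \<partial>M)"
      using iAA by (intro sum.cong Bochner_Integration.integral_sum integrable_mult_right) auto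
    also have "\<dots> = (\<Sum>k\<in>I. \<Sum>j\<in>I. w k * w j * pr (\<lambda>x. E k x \<and> E j x))"
    proof (intro sum.cong refl)
      fix k j assume kj: "k \<in> I" "j \<in> I"
      have "A k \<inter> A j = {\<omega> \<in> space M. E k (\<lambda>n. X n \<omega>) \<and> E j (\<lambda>n. X n \<omega>)}" unfolding A_def by auto
      then show "(\<integral>\<omega>. w k * w j * indicator (A k \<inter> A j) \<omega> \<partial>M) = w k * w j * pr (\<lambda>x. E k x \<and> E j x)"
        using sets.Int[OF A[OF kj(1)] A[OF kj(2)]] by (simp add: pr_def sets.Int_space_eq2)
    qed
    finally show ?thesis .
  qed
  have iU: "integrable M (\<lambda>\<omega>. indicator U \<omega> :: real)" by (simp add: less_top[symmetric])
  have "(\<integral>\<omega>. 2 * t * Y \<omega> - t\<^sup>2 * (Y \<omega>)\<^sup>2 \<partial>M) \<le> (\<integral>\<omega>. indicator U \<omega> \<partial>M)"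
  proof (rule integral_mono)
    fix \<omega>
    show "2 * t * Y \<omega> - t\<^sup>2 * (Y \<omega>)\<^sup>2 \<le> indicator U \<omega>"
    proof (cases "\<omega> \<in> U")
      case True
      have "0 \<le> (1 - t * Y \<omega>)\<^sup>2" by simp
      then show ?thesis using True by (simp add: power2_eq_square algebra_simps)
    next
      case False
      then have "Y \<omega> = 0" unfolding Y_def U_def by (intro sum.neutral) auto
      then show ?thesis using False by simp
    qed
  qed (use iY iY2 iU in auto)
  moreover have "(\<integral>\<omega>. indicator U \<omega> \<partial>M) = pr (\<lambda>x. \<exists>k\<in>I. E k x)"
  proof -
    have "U = {\<omega> \<in> space M. \<exists>k\<in>I. E k (\<lambda>n. X n \<omega>)}" unfolding U_def A_def by auto
    then show ?thesis using U by (simp add: pr_def)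
  qed
  moreover have "(\<integral>\<omega>. 2 * t * Y \<omega> - t\<^sup>2 * (Y \<omega>)\<^sup>2 \<partial>M) =
      2 * t * (\<Sum>k\<in>I. w k * pr (E k)) - t\<^sup>2 * (\<Sum>k\<in>I. \<Sum>j\<in>I. w k * w j * pr (\<lambda>x. E k x \<and> E j x))"
    using iY iY2 by (simp add: EY EY2)
  ultimately show ?thesis by simp
qed

end

context lnln_walk
begin

text \<open>The bound \<open>L\<close> on the past ensures that every site above \<open>L\<close> is
  first passed after time \<open>m\<close>, so its skipping lies entirely in the future.\<close>

definition past_below :: "nat \<Rightarrow> nat \<Rightarrow> ((nat \<Rightarrow> nat) \<Rightarrow> bool) \<Rightarrow> bool" where
  "past_below m L \<Phi> \<longleftrightarrow> adapted m \<Phi> \<and> (\<forall>x i. \<Phi> x \<longrightarrow> i \<le> m \<longrightarrow> x i \<le> L)"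

definition after :: "nat \<Rightarrow> ((nat \<Rightarrow> nat) \<Rightarrow> bool) \<Rightarrow> nat \<Rightarrow> nat \<Rightarrow> (nat \<Rightarrow> nat) \<Rightarrow> bool" where
  "after m \<Phi> k n x \<longleftrightarrow> m < n \<and> \<Phi> x \<and> jump k n x"

lemma jump_family_after:
  assumes "adapted m \<Phi>"
  shows "jump_family k (after m \<Phi> k)"
  unfolding jump_family_def
proof (intro allI conjI impI)
  fix n show "adapted n (after m \<Phi> k n)"
  proof (rule adaptedI)
    fix x y :: "nat \<Rightarrow> nat" assume eq: "\<And>i. i \<le> n \<Longrightarrow> x i = y i" and x: "after m \<Phi> k n x"
    then have "jump k n y" using adaptedD[OF adapted_jump, of n x y k] unfolding after_def by simp
    moreover have "\<Phi> y" using adaptedD[OF assms, of x y] x eq unfolding after_def by simp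
    ultimately show "after m \<Phi> k n y" using x unfolding after_def by blast
  qed
qed (simp add: after_def)

lemma after_iff:
  assumes "past_below m L \<Phi>" "k > L"
  shows "(\<exists>n. after m \<Phi> k n x \<and> (\<forall>i\<ge>n. x i > k)) \<longleftrightarrow> \<Phi> x \<and> skips k x"
proof -
  have "m < n" if "\<Phi> x" "jump k n x" for n
  proof (rule ccontr)
    assume "\<not> m < n"
    then have "x n \<le> L" using assms(1) that(1) unfolding past_below_def by simp
    then show False using that(2) assms(2) unfolding jump_def by simp
  qed
  then show ?thesis unfolding after_def skips_def by blast
qed

text \<open>Split according to the position at time \<open>m\<close>, which is below
  \<open>k\<close>, and apply \<open>jump_ge\<close> from each position.\<close>

lemma Ex_after_ge:
  assumes pb: "past_below m L \<Phi>" and k: "k > L" "k \<ge> K0 + 4"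
  shows "1/13 * pr \<Phi> \<le> pr (\<lambda>x. \<exists>n. after m \<Phi> k n x)"
proof -
  have ad: "adapted m \<Phi>" and L: "\<And>x i. \<Phi> x \<Longrightarrow> i \<le> m \<Longrightarrow> x i \<le> L"
    using pb unfolding past_below_def by blast+
  have "1/13 * pr (\<lambda>x. \<exists>a. \<Phi> x \<and> x m = a) \<le> 1 * pr (\<lambda>x. \<exists>a. (\<Phi> x \<and> x m = a) \<and> hit m {..<k} {k + 1} x)"
  proof (rule pr_Ex_le)
    fix a
    show "1/13 * pr (\<lambda>x. \<Phi> x \<and> x m = a) \<le> 1 * pr (\<lambda>x. (\<Phi> x \<and> x m = a) \<and> hit m {..<k} {k + 1} x)"
    proof (cases "a < k")
      case True
      have "located m a (\<lambda>x. \<Phi> x \<and> x m = a)" by (intro locatedI adapted_conj ad adapted_at) auto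
      from jump_ge[OF k(2) True this] show ?thesis by simp
    next
      case False
      have "pr (\<lambda>x. \<Phi> x \<and> x m = a) = 0" by (rule pr_conj_0) (use L[of _ m] k False in fastforce)
      then show ?thesis by simp
    qed
  qed (auto intro!: ev_conj ev_adapted[OF ad] ev_at ev_hit)
  also have "1 * pr (\<lambda>x. \<exists>a. (\<Phi> x \<and> x m = a) \<and> hit m {..<k} {k + 1} x) \<le> pr (\<lambda>x. \<exists>n. after m \<Phi> k n x)"
    unfolding mult_1
  proof (rule pr_mono)
    fix x assume "\<exists>a. (\<Phi> x \<and> x m = a) \<and> hit m {..<k} {k + 1} x"
    then obtain n where n: "\<Phi> x" "n \<ge> m" "x n = k + 1" "\<forall>i. m \<le> i \<and> i < n \<longrightarrow> x i < k"
      unfolding hit_def by auto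
    have "x i < k" if "i < n" for i
      using n(4) L[OF n(1), of i] k that by (cases "i \<le> m") auto
    moreover have "n \<noteq> m" using L[OF n(1), of m] n(3) k by auto
    ultimately show "\<exists>n. after m \<Phi> k n x" unfolding after_def jump_def using n by (intro exI[of _ n]) auto
  qed (intro ev_ex ev_family[OF jump_family_after[OF ad]])
  finally show ?thesis by simp
qed

lemma skips_after_ge:
  assumes pb: "past_below m L \<Phi>" and k: "k > L" "k \<ge> K0 + 4"
  shows "c0 / 13 * (eps k / real k) * pr \<Phi> \<le> pr (\<lambda>x. \<Phi> x \<and> skips k x)"
proof -
  have ad: "adapted m \<Phi>" using pb unfolding past_below_def by blast
  have k16: "k \<ge> 16" using k K0(1) by simp
  have "c0 * (eps k / real k) * (1/13 * pr \<Phi>) \<le> c0 * (eps k / real k) * pr (\<lambda>x. \<exists>n. after m \<Phi> k n x)"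
    using c0_pos eps_pos[OF k16] by (intro mult_left_mono Ex_after_ge[OF pb k]) auto
  also have "\<dots> \<le> pr (\<lambda>x. \<exists>n. after m \<Phi> k n x \<and> (\<forall>i\<ge>n. x i > k))"
    using k by (intro family_escape_ge jump_family_after[OF ad]) auto
  also have "\<dots> = pr (\<lambda>x. \<Phi> x \<and> skips k x)" by (intro pr_cong after_iff[OF pb k(1)])
  finally show ?thesis by simp
qed

text \<open>The probability \<open>P\<close> of the jump over \<open>k\<close> is traded for that of
  skipping \<open>k\<close> through the lower escape bound. This divides by
  \<open>eps k / k\<close>, and monotonicity of \<open>eps\<close> disposes of the remaining ratio
  \<open>eps j / eps k\<close>.\<close>

lemma skips_pair_after_le:
  assumes pb: "past_below m L \<Phi>"
    and k: "k > L" "k \<ge> K0" and j: "j > k"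
  shows "pr (\<lambda>x. (\<Phi> x \<and> skips k x) \<and> (\<Phi> x \<and> skips j x)) \<le>
    4 / c0 * (eps j / real j + 1 / (real j * ln (real j / real k))) * pr (\<lambda>x. \<Phi> x \<and> skips k x)"
proof -
  have ad: "adapted m \<Phi>" using pb unfolding past_below_def by blast
  have k16: "k \<ge> 16" using k K0(1) by simp
  have ek: "eps k > 0" "0 < eps j" "eps j \<le> eps k" using eps_pos[OF k16] eps_pos[of j] eps_antimono[OF k16, of j] k16 j by auto
  have l: "ln (real j / real k) > 0" using j k16 by simp
  define P where "P = pr (\<lambda>x. \<exists>n. after m \<Phi> k n x)"
  define S where "S = pr (\<lambda>x. \<Phi> x \<and> skips k x)"
  define u where "u = ln (real j / real k)"
  note iff = after_iff[OF pb k(1)]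
  have "c0 * (eps k / real k) * P \<le> S"
    using family_escape_ge[OF k(2) jump_family_after[OF ad, of k]] unfolding iff P_def S_def .
  then have P: "P \<le> real k / (c0 * eps k) * S" using c0_pos ek k16 by (simp add: field_simps)
  have "pr (\<lambda>x. (\<Phi> x \<and> skips k x) \<and> (\<Phi> x \<and> skips j x)) = pr (\<lambda>x. (\<Phi> x \<and> skips k x) \<and> skips j x)"
    by (rule pr_cong) blast
  also have "\<dots> \<le> 2 * eps j / real j * (2 * eps k / real k + 1 / (real k * u)) * P"
    using family_skips_le[OF k(2) j jump_family_after[OF ad, of k]] unfolding iff P_def u_def .
  also have "\<dots> \<le> 2 * eps j / real j * (2 * eps k / real k + 1 / (real k * u)) * (real k / (c0 * eps k) * S)"
    using ek l by (intro mult_left_mono P) (auto simp: u_def)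
  also have "\<dots> = (4 / c0 * (eps j / real j) + 2 / c0 * ((eps j / eps k) * (1 / (real j * u)))) * S"
    using ek k16 c0_pos l j unfolding u_def[symmetric] by (simp add: field_simps)
  also have "\<dots> \<le> (4 / c0 * (eps j / real j) + 4 / c0 * (1 * (1 / (real j * u)))) * S"
    using ek c0_pos l by (intro mult_right_mono add_left_mono mult_mono) (auto simp: u_def S_def divide_right_mono)
  finally show ?thesis unfolding S_def u_def by (simp add: distrib_left)
qed

lemma sum_eps_unbounded:
  assumes "\<beta> \<le> 1" "K \<ge> 81"
  shows "\<exists>N. (\<Sum>j\<in>{K<..N}. 1 / ln (real j) * (eps j / real j)) \<ge> 1"
proof -
  obtain N where N: "(\<Sum>j\<in>{K<..N}. 1 / (real j * ln (real j) * ln (ln (real j)))) \<ge> 1"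
    using sum_inverse_ln_lnln_unbounded[of K] assms by auto
  have "(\<Sum>j\<in>{K<..N}. 1 / (real j * ln (real j) * ln (ln (real j)))) \<le> (\<Sum>j\<in>{K<..N}. 1 / ln (real j) * (eps j / real j))"
  proof (rule sum_mono)
    fix j assume j: "j \<in> {K<..N}"
    \<comment> \<open>Since 81 = 3^4, ln j is at least 4 and so exceeds e; then ln ln j is at least
      1, and an exponent \<beta> of at most 1 does not increase it.\<close>
    have "1 \<le> ln (3::real)" using exp_le by (subst ln_ge_iff) auto
    moreover have "ln (81::real) = 4 * ln 3" using ln_realpow[of 3 4] by simp
    moreover have "ln (81::real) \<le> ln (real j)" using j assms by (subst ln_le_cancel_iff) auto
    ultimately have "exp 1 \<le> ln (real j)" using exp_le by linarith
    then have l: "1 \<le> ln (ln (real j))" by (subst ln_ge_iff) (auto intro: less_le_trans[OF exp_gt_zero])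
    have "ln (ln (real j)) powr \<beta> \<le> ln (ln (real j)) powr 1" using l assms by (intro powr_mono) auto
    then have "1 / ln (ln (real j)) \<le> eps j"
      unfolding eps_def using l by (simp add: powr_minus inverse_eq_divide frac_le)
    then have "1 / (real j * ln (real j)) * (1 / ln (ln (real j))) \<le> 1 / (real j * ln (real j)) * eps j"
      using j assms by (intro mult_left_mono) auto
    then show "1 / (real j * ln (real j) * ln (ln (real j))) \<le> 1 / ln (real j) * (eps j / real j)"
      by (simp add: mult_ac)
  qed
  with N show ?thesis by (intro exI[of _ N]) linarith
qed

text \<open>The second moment method restricted to \<Phi>. The constant must not depend on \<Phi>,
  \<open>m\<close> or \<open>L\<close>: only the range of summation does, and it enters solely
  through S \<ge> 1.\<close>

lemma skip_beyond_ge: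
  assumes b1: "\<beta> \<le> 1"
  shows "\<exists>c>0. \<forall>m \<Phi> L. past_below m L \<Phi> \<longrightarrow>
    c * pr \<Phi> \<le> pr (\<lambda>x. \<Phi> x \<and> (\<exists>k>L. skips k x))"
proof -
  obtain C where C: "C > 0" "\<And>k N. k \<ge> 3 \<Longrightarrow> (\<Sum>j\<in>{k<..N}. 1 / (real j * ln (real j) * ln (real j / real k))) \<le> C"
    using sum_inverse_ln_ratio_bounded by blast
  define D where "D = 4 / c0"
  define c where "c = (c0 / 13) / (1 + 2 * D * (1 + C))"
  have D: "D > 0" using c0_pos by (simp add: D_def)
  have c: "c > 0" using c0_pos D C by (simp add: c_def add_pos_pos)
  have "c * pr \<Phi> \<le> pr (\<lambda>x. \<Phi> x \<and> (\<exists>k>L. skips k x))"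
    if pb: "past_below m L \<Phi>" for m \<Phi> L
  proof -
    have ad: "adapted m \<Phi>" using pb unfolding past_below_def by blast
    define K where "K = max (max L (K0 + 4)) 81"
    obtain N where N: "(\<Sum>j\<in>{K<..N}. 1 / ln (real j) * (eps j / real j)) \<ge> 1"
      using sum_eps_unbounded[OF b1, of K] by (auto simp: K_def)
    define I where "I = {K<..N}"
    define w where "w j = 1 / ln (real j)" for j :: nat
    define S where "S = (\<Sum>j\<in>I. w j * (eps j / real j))"
    define E where "E k x \<longleftrightarrow> \<Phi> x \<and> skips k x" for k x
    define b where "b = (\<Sum>k\<in>I. w k * pr (E k))"
    have S: "S \<ge> 1" using N by (simp add: S_def I_def w_def)
    have I: "k > L" "k \<ge> K0 + 4" "k \<ge> K0" "k \<ge> 16" if "k \<in> I" for k using that by (auto simp: I_def K_def)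
    have w: "0 < w k" "w k \<le> 1" if "k \<in> I" for k
    proof -
      have "1 \<le> ln (real k)" using I(4)[OF that] exp_le by (subst ln_ge_iff) auto
      then show "0 < w k" "w k \<le> 1" by (auto simp: w_def)
    qed
    have evE: "ev (E k)" for k unfolding E_def by (intro ev_conj ev_adapted[OF ad] ev_skips)
    have b: "c0 / 13 * S * pr \<Phi> \<le> b"
    proof -
      have "c0 / 13 * S * pr \<Phi> = (\<Sum>k\<in>I. w k * (c0 / 13 * (eps k / real k) * pr \<Phi>))"
        by (simp add: S_def sum_distrib_left sum_distrib_right mult_ac)
      also have "\<dots> \<le> b" unfolding b_def E_def
        by (intro sum_mono mult_left_mono skips_after_ge[OF pb] I) (use w in \<open>auto intro: less_imp_le\<close>)
      finally show ?thesis .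
    qed
    have b0: "b \<ge> 0" unfolding b_def using w by (intro sum_nonneg mult_nonneg_nonneg) (auto intro: less_imp_le)
    define q2 where "q2 = (\<Sum>k\<in>I. \<Sum>j\<in>I. w k * w j * pr (\<lambda>x. E k x \<and> E j x))"
    have "q2 = (\<Sum>k\<in>I. w k * w k * pr (\<lambda>x. E k x \<and> E k x)) +
        2 * (\<Sum>k\<in>I. \<Sum>j\<in>{j\<in>I. k < j}. w k * w j * pr (\<lambda>x. E k x \<and> E j x))"
      unfolding q2_def by (rule sum_symmetric_split) (auto simp: I_def conj_commute)
    also have "\<dots> \<le> b + 2 * (\<Sum>k\<in>I. w k * pr (E k) * (D * (S + C)))"
    proof (intro add_mono mult_left_mono)
      show "(\<Sum>k\<in>I. w k * w k * pr (\<lambda>x. E k x \<and> E k x)) \<le> b"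
        unfolding b_def
      proof (rule sum_mono)
        fix k assume k: "k \<in> I"
        have "w k * w k * pr (E k) \<le> 1 * w k * pr (E k)" using w[OF k] by (intro mult_right_mono) auto
        then show "w k * w k * pr (\<lambda>x. E k x \<and> E k x) \<le> w k * pr (E k)" by simp
      qed
      show "(\<Sum>k\<in>I. \<Sum>j\<in>{j\<in>I. k < j}. w k * w j * pr (\<lambda>x. E k x \<and> E j x)) \<le> (\<Sum>k\<in>I. w k * pr (E k) * (D * (S + C)))"
      proof (rule sum_mono)
        fix k assume k: "k \<in> I"
        have "(\<Sum>j\<in>{j\<in>I. k < j}. w k * w j * pr (\<lambda>x. E k x \<and> E j x)) \<le>
          (\<Sum>j\<in>{j\<in>I. k < j}. w k * pr (E k) * D * (w j * (eps j / real j) + 1 / (real j * ln (real j) * ln (real j / real k))))"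
        proof (rule sum_mono)
          fix j assume j: "j \<in> {j\<in>I. k < j}"
          have "pr (\<lambda>x. E k x \<and> E j x) \<le> D * (eps j / real j + 1 / (real j * ln (real j / real k))) * pr (E k)"
            unfolding E_def D_def using j by (intro skips_pair_after_le[OF pb I(1,3)[OF k]]) auto
          then have "w k * w j * pr (\<lambda>x. E k x \<and> E j x) \<le>
             w k * w j * (D * (eps j / real j + 1 / (real j * ln (real j / real k))) * pr (E k))"
            using w[OF k] w[of j] j by (intro mult_left_mono) auto
          also have "\<dots> = w k * pr (E k) * D * (w j * (eps j / real j) + 1 / (real j * ln (real j) * ln (real j / real k)))"
            by (simp add: w_def distrib_left mult_ac)
          finally show "w k * w j * pr (\<lambda>x. E k x \<and> E j x) \<le>
            w k * pr (E k) * D * (w j * (eps j / real j) + 1 / (real j * ln (real j) * ln (real j / real k)))" .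
        qed
        also have "\<dots> = w k * pr (E k) * D * ((\<Sum>j\<in>{j\<in>I. k < j}. w j * (eps j / real j)) +
           (\<Sum>j\<in>{j\<in>I. k < j}. 1 / (real j * ln (real j) * ln (real j / real k))))"
          by (simp only: sum_distrib_left[symmetric] sum.distrib)
        also have "\<dots> \<le> w k * pr (E k) * D * (S + C)"
        proof (intro mult_left_mono add_mono)
          show "(\<Sum>j\<in>{j\<in>I. k < j}. w j * (eps j / real j)) \<le> S" unfolding S_def
            by (rule sum_mono2) (use w I eps_pos in \<open>auto simp: I_def less_imp_le\<close>)
          have "(\<Sum>j\<in>{j\<in>I. k < j}. 1 / (real j * ln (real j) * ln (real j / real k))) =
             (\<Sum>j\<in>{k<..N}. 1 / (real j * ln (real j) * ln (real j / real k)))"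
            using k by (intro sum.cong) (auto simp: I_def)
          also have "\<dots> \<le> C" using I(4)[OF k] by (intro C(2)) auto
          finally show "(\<Sum>j\<in>{j\<in>I. k < j}. 1 / (real j * ln (real j) * ln (real j / real k))) \<le> C" .
        qed (use w[OF k] D in auto)
        finally show "(\<Sum>j\<in>{j\<in>I. k < j}. w k * w j * pr (\<lambda>x. E k x \<and> E j x)) \<le> w k * pr (E k) * (D * (S + C))"
          by (simp add: mult.assoc)
      qed
    qed auto
    also have "\<dots> = b * (1 + 2 * D * (S + C))"
      unfolding b_def sum_distrib_right[symmetric] by (simp add: algebra_simps)
    finally have q2: "q2 \<le> b * (1 + 2 * D * (S + C))" .
    \<comment> \<open>With this \<open>t\<close> the quadratic term t^2 q2 is at most t b, so half
      of the linear term 2 t b survives.\<close>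
    define t where "t = 1 / (1 + 2 * D * (S + C))"
    have den: "1 + 2 * D * (S + C) > 0" using D S C by (simp add: add_pos_pos)
    have t: "t > 0" "t * (1 + 2 * D * (S + C)) = 1" using den by (auto simp: t_def)
    have "c * pr \<Phi> \<le> t * b"
    proof -
      \<comment> \<open>Here S \<ge> 1 enters: the first moment grows like S and the denominator at
        most like S, so t S stays above a constant free of S.\<close>
      have "1 + 2 * D * (S + C) \<le> S * (1 + 2 * D * (1 + C))"
      proof -
        have "(1 + 2 * D * C) * 1 \<le> (1 + 2 * D * C) * S" using S D C by (intro mult_left_mono) auto
        then show ?thesis by (simp add: algebra_simps)
      qed
      then have "1 / (1 + 2 * D * (1 + C)) \<le> t * S"
        unfolding t_def using den D C by (simp add: field_simps add_pos_pos)
      then have "c0 / 13 * (1 / (1 + 2 * D * (1 + C))) * pr \<Phi> \<le> c0 / 13 * (t * S) * pr \<Phi>"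
        using c0_pos by (intro mult_right_mono mult_left_mono) auto
      also have "\<dots> = t * (c0 / 13 * S * pr \<Phi>)" by simp
      also have "\<dots> \<le> t * b" using t b by (intro mult_left_mono) auto
      finally show ?thesis by (simp add: c_def)
    qed
    also have "t * b \<le> 2 * t * b - t\<^sup>2 * q2"
    proof -
      have "t\<^sup>2 * q2 \<le> t\<^sup>2 * (b * (1 + 2 * D * (S + C)))" using q2 by (intro mult_left_mono) auto
      also have "\<dots> = t * b * (t * (1 + 2 * D * (S + C)))" by (simp only: power2_eq_square mult_ac)
      also have "\<dots> = t * b" unfolding t(2) by simp
      finally have "t\<^sup>2 * q2 \<le> t * b" .
      moreover have "2 * t * b = t * b + t * b" by simp
      ultimately show ?thesis by linarith
    qed
    also have "\<dots> \<le> pr (\<lambda>x. \<exists>k\<in>I. E k x)"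
      unfolding b_def q2_def by (rule second_moment) (auto simp: I_def evE)
    also have "\<dots> \<le> pr (\<lambda>x. \<Phi> x \<and> (\<exists>k>L. skips k x))"
      using I(1) by (intro pr_mono ev_intros ev_adapted[OF ad] ev_skips) (auto simp: E_def)
    finally show ?thesis .
  qed
  with c show ?thesis by blast
qed

text \<open>The event is approximated by events from the past of some time \<open>m\<close>; conditionally on these a
  later skip still has probability at least \<open>c\<close>, so the event is null.\<close>

lemma pr_all_visited_0:
  assumes b1: "\<beta> \<le> 1"
  shows "pr (\<lambda>x. \<forall>k\<ge>n. \<exists>t. x t = k) = 0"
proof -
  obtain c where c: "c > 0" "\<And>m \<Phi> L. past_below m L \<Phi> \<Longrightarrow>
      c * pr \<Phi> \<le> pr (\<lambda>x. \<Phi> x \<and> (\<exists>k>L. skips k x))"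
    using skip_beyond_ge[OF b1] by metis
  define B where "B x \<longleftrightarrow> (\<forall>k\<ge>n. \<exists>t. x t = k)" for x :: "nat \<Rightarrow> nat"
  \<comment> \<open>\<open>V l\<close> decreases to \<open>B\<close> as \<open>l\<close> grows, and
    \<open>G l m\<close>, the same visits completed by time \<open>m\<close>, increases to
    \<open>V l\<close>.\<close>
  define V where "V l x \<longleftrightarrow> (\<forall>k\<in>{n..l}. \<exists>t. x t = k)" for l :: nat and x :: "nat \<Rightarrow> nat"
  define G where "G l m x \<longleftrightarrow> (\<forall>k\<in>{n..l}. \<exists>t\<le>m. x t = k)" for l m :: nat and x :: "nat \<Rightarrow> nat"
  have evB: "ev B" unfolding B_def by (intro ev_intros)
  have evV: "ev (V l)" for l unfolding V_def Ball_def by (intro ev_intros)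
  have adG: "adapted m (G l m)" for l m
    by (rule adaptedI) (unfold G_def, metis)
  have evG: "ev (G l m)" for l m by (rule ev_adapted[OF adG])
  have "pr B \<le> e + e / c" if e: "e > 0" for e
  proof -
    have "\<exists>l. pr (V l) < pr B + e"
    proof (rule ccontr)
      assume "\<not> ?thesis"
      then have "pr B + e \<le> pr (\<lambda>x. \<forall>l. V l x)"
        using pr_All_mono_ge[of V "pr B + e", OF evV] by (simp add: V_def not_less)
      moreover have "(\<forall>l. V l x) \<longleftrightarrow> B x" for x unfolding V_def B_def by fastforce
      ultimately show False using e by simp
    qed
    then obtain l where l: "pr (V l) < pr B + e" by blast
    have "\<exists>m. pr (V l) - e < pr (G l m)"
    proof (rule ccontr)
      assume "\<not> ?thesis"
      then have "pr (\<lambda>x. \<exists>m. G l m x) \<le> pr (V l) - e"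
        using pr_Ex_mono_le[of "G l" "pr (V l) - e", OF evG] by (simp add: G_def not_less) (meson le_SucI)
      moreover have "pr (V l) \<le> pr (\<lambda>x. \<exists>m. G l m x)"
      proof (rule pr_mono[OF ev_ex[OF evG]])
        fix x assume "V l x"
        then obtain t where t: "\<And>k. k \<in> {n..l} \<Longrightarrow> x (t k) = k" unfolding V_def by metis
        have "t k \<le> Max (t ` {n..l})" if "k \<in> {n..l}" for k using that by (intro Max_ge) auto
        then show "\<exists>m. G l m x" unfolding G_def using t by blast
      qed
      ultimately show False using e by simp
    qed
    then obtain m where m: "pr (V l) - e < pr (G l m)" by blast
    \<comment> \<open>Valid paths are at most 2 m up to time m, so this cut loses no mass. Adding
      \<open>n\<close> places every later skipped site beyond \<open>n\<close>, where it contradicts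
      \<open>B\<close>.\<close>
    define \<Phi> where "\<Phi> x \<longleftrightarrow> G l m x \<and> (\<forall>i\<le>m. x i \<le> 2 * m + n)" for x
    have ad: "adapted m \<Phi>" unfolding \<Phi>_def by (intro adapted_conj adG) (auto simp: adapted_def)
    have "pr (G l m) \<le> pr \<Phi>"
    proof (rule pr_mono_valid[OF ev_adapted[OF ad]])
      fix x assume x: "valid x" "G l m x"
      have "x i \<le> 2 * m + n" if "i \<le> m" for i using valid_le[OF x(1), of i] that by simp
      with x show "\<Phi> x" by (simp add: \<Phi>_def)
    qed
    moreover have "c * pr \<Phi> \<le> pr (\<lambda>x. \<Phi> x \<and> (\<exists>k>2 * m + n. skips k x))"
      by (rule c(2)[of m]) (use ad in \<open>simp add: past_below_def \<Phi>_def\<close>)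
    moreover have "pr (\<lambda>x. \<Phi> x \<and> (\<exists>k>2 * m + n. skips k x)) \<le> pr (\<lambda>x. V l x \<and> \<not> B x)"
    proof (rule pr_mono)
      fix x assume x: "\<Phi> x \<and> (\<exists>k>2 * m + n. skips k x)"
      then obtain k where k: "k > 2 * m + n" "skips k x" by blast
      then have "\<not> (\<exists>t. x t = k)" using skips_imp_skipped_point[of k x] unfolding skipped_point_def by blast
      moreover have "k \<ge> n" using k(1) by simp
      ultimately have "\<not> B x" unfolding B_def by blast
      moreover have "V l x" using x unfolding \<Phi>_def G_def V_def by blast
      ultimately show "V l x \<and> \<not> B x" by blast
    qed (intro ev_conj ev_not evV evB)
    \<comment> \<open>A skip beyond the past takes the path out of \<open>B\<close> but leaves it in
      \<open>V l\<close>. Therefore c times \<open>pr \<Phi>\<close> is at most the gap between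
      \<open>pr (V l)\<close> and \<open>pr B\<close>, which is below \<open>e\<close>.\<close>
    moreover have "pr (V l) = pr (\<lambda>x. V l x \<and> \<not> B x) + pr B"
    proof -
      have "pr (V l) = pr (\<lambda>x. (V l x \<and> \<not> B x) \<or> B x)"
        by (rule pr_cong) (auto simp: V_def B_def)
      also have "\<dots> = pr (\<lambda>x. V l x \<and> \<not> B x) + pr B"
        by (rule pr_disj) (auto intro!: ev_conj ev_not evV evB)
      finally show ?thesis .
    qed
    ultimately have "pr B - e \<le> pr \<Phi>" "c * pr \<Phi> \<le> e" using l m pr_nonneg[of "\<lambda>x. V l x \<and> \<not> B x"] by linarith+
    moreover from this(2) have "pr \<Phi> \<le> e / c" using c(1) by (simp add: field_simps)
    ultimately show ?thesis by linarith
  qed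
  moreover have "pr B \<le> 0"
  proof (rule ccontr)
    assume "\<not> pr B \<le> 0"
    then have p: "pr B > 0" by simp
    define z where "z = 1 + 1/c"
    \<comment> \<open>Chosen so that e + e / c is exactly half of \<open>pr B\<close>.\<close>
    define e where "e = pr B / (2 * z)"
    have "z > 0" using c(1) by (simp add: z_def add_pos_pos)
    then have "e > 0" "e * z = pr B / 2" using p by (auto simp: e_def)
    moreover have "e * z = e + e / c" by (simp add: z_def distrib_left)
    ultimately show False using \<open>\<And>e. e > 0 \<Longrightarrow> pr B \<le> e + e / c\<close>[of e] p by simp
  qed
  ultimately show ?thesis using pr_nonneg[of B] unfolding B_def by linarith
qed

lemma infinitely_many_skipped:
  assumes b1: "\<beta> \<le> 1"
  shows "\<P>(\<omega> in M. infinite {k. skipped_point (\<lambda>n. X n \<omega>) k}) = 1"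
proof -
  have iff: "infinite {k. skipped_point x k} \<longleftrightarrow> (\<forall>n. \<not> (\<forall>k\<ge>n. \<exists>t. x t = k))" for x
    unfolding infinite_nat_iff_unbounded_le skipped_point_def by auto
  have "AE \<omega> in M. \<not> (\<forall>k\<ge>n. \<exists>t. X t \<omega> = k)" for n
  proof (rule AE_I)
    show "emeasure M {\<omega> \<in> space M. \<forall>k\<ge>n. \<exists>t. X t \<omega> = k} = 0"
      using pr_all_visited_0[OF b1, of n] unfolding pr_def by (simp add: emeasure_eq_measure)
    show "{\<omega> \<in> space M. \<forall>k\<ge>n. \<exists>t. X t \<omega> = k} \<in> sets M" by measurable
  qed auto
  then have "AE \<omega> in M. \<forall>n. \<not> (\<forall>k\<ge>n. \<exists>t. X t \<omega> = k)" by (subst AE_all_countable) blast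
  then show ?thesis unfolding iff by (subst prob_Collect_eq_1) measurable
qed

end

theorem theorem2:
  fixes \<beta> :: real and r p :: "nat \<Rightarrow> real"
    and M :: "'a measure" and X :: "nat \<Rightarrow> 'a \<Rightarrow> nat"
  assumes "\<beta> > 0"
    and "\<And>i. i \<ge> 1 \<Longrightarrow> r i = r_seq \<beta> i"
    and "\<And>i. i \<ge> 1 \<Longrightarrow> r i < 2/3"
    and "\<And>i. i \<ge> 1 \<Longrightarrow> p i = 1/3 + r i"
    and "markov_chain M (step_prob p) X"
    and "AE \<omega> in M. X 0 \<omega> = 0"
  shows "(\<beta> > 1 \<longrightarrow> (AE \<omega> in M. finite {k. skipped_point (\<lambda>n. X n \<omega>) k})) \<and>
         (\<beta> \<le> 1 \<longrightarrow> \<P>(\<omega> in M. infinite {k. skipped_point (\<lambda>n. X n \<omega>) k}) \<ge> 11/27)"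
proof -
  define q where "q i = (if i = 0 then 1 else p i)" for i
  have mc: "prob_space M" "\<And>n. X n \<in> measurable M (count_space UNIV)"
     "\<And>n x y. \<P>(\<omega> in M. \<forall>k\<le>n. X k \<omega> = x k) > 0 \<Longrightarrow>
        \<P>(\<omega> in M. X (Suc n) \<omega> = y \<bar> \<forall>k\<le>n. X k \<omega> = x k) = step_prob p (x n) y"
    using assms(5) unfolding markov_chain_def by blast+
  have step: "step_prob p a b = (if b = a + 2 then q a else if b = a - 1 then 1 - q a else 0)" for a b
    unfolding step_prob_def q_def by auto
  interpret prob_space M by (rule mc(1))
  interpret lnln_walk M X q \<beta>
  proof
    show "X n \<in> measurable M (count_space UNIV)" for n by (rule mc(2))
    show "\<P>(\<omega> in M. X (Suc n) \<omega> = y \<bar> \<forall>k\<le>n. X k \<omega> = x k) =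
        (if y = x n + 2 then q (x n) else if y = x n - 1 then 1 - q (x n) else 0)"
      if "0 < \<P>(\<omega> in M. \<forall>k\<le>n. X k \<omega> = x k)" for n x y
      using mc(3)[OF that] step by simp
    show "1/3 \<le> q i" for i using assms(2,4)[of i] by (auto simp: q_def r_seq_def)
    show "q i \<le> 1" for i using assms(3,4)[of i] by (auto simp: q_def)
    show "q i = 1/3 + (1 + ln (ln (real i)) powr (-\<beta>)) / (3 * real i)" if "i \<ge> 4" for i
      using assms(2,4)[of i] that by (simp add: q_def r_seq_def powr_minus inverse_eq_divide add_divide_distrib distrib_left mult_ac)
  qed (use assms in auto)
  show ?thesis using AE_finite_skipped infinitely_many_skipped by auto
qed

end
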